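(* Let $p \in [1,\infty)$. Then the metric space $(\mathcal{D},W_p)$ of persistence diagrams with the $p$-Wasserstein distance admits a coarse embedding into a Hilbert space if and only if the $p$-Wasserstein space $\mathcal{P}_p(\mathbb{R}^2)$ over the plane admits a coarse embedding into a Hilbert space.
   Context: Throughout $\mathbb{R}^2$ carries the $\ell^\infty$ distance $d(x,y)=\|x-y\|_\infty$. Wasserstein space: for $1\le p<\infty$, $\mathcal{P}_p(\mathbb{R}^2)$ is the set of Borel probability measures on $\mathbb{R}^2$ with finite $p$-th moment, with the metric $W_p(\alpha,\beta)=\left(\inf_{\gamma}\int d(x,y)^p\,d\gamma(x,y)\right)^{1/p}$, where $\gamma$ ranges over Borel probability measures on $\mathbb{R}^2\times\mathbb{R}^2$ with marginals $\alpha$ and $\beta$. Persistence diagrams: let $\mathbb{R}^2_<=\{(b,d)\in\mathbb{R}^2: b<d\}$ and $\Delta_{\mathbb{R}}=\{(x,x): x\in\mathbb{R}\}$. A persistence diagram is a finite multiset of points of $\mathbb{R}^2_<$ (possibly empty); $\mathcal{D}$ is the set of all of them. A partial matching between $D_1,D_2\in\mathcal{D}$ is a triple $(B_1,B_2,f)$ with $B_1\subseteq D_1$, $B_2\subseteq D_2$ (sub-multisets) and $f\colon B_1\to B_2$ a bijection. Its $p$-cost is $$\mathrm{cost}_p(f)=\Big(\sum_{x\in B_1}d(x,f(x))^p+\sum_{x\in D_1\setminus B_1}d(x,\Delta_{\mathbb{R}})^p+\sum_{x\in D_2\setminus B_2}d(x,\Delta_{\mathbb{R}})^p\Big)^{1/p}.$$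 The $p$-Wasserstein distance $W_p(D_1,D_2)$ is the infimum of $\mathrm{cost}_p(f)$ over all partial matchings between $D_1$ and $D_2$. Coarse embedding: a map $f\colon X\to Y$ of metric spaces is a coarse embedding if there are non-decreasing functions $\rho_1,\rho_2\colon[0,\infty)\to[0,\infty)$ with $\lim_{t\to\infty}\rho_1(t)=+\infty$ and $\rho_1(d(x,y))\le d(f(x),f(y))\le\rho_2(d(x,y))$ for all $x,y\in X$. *)

theory Defs
  imports "HOL-Probability.Probability" "HOL-Algebra.Module" "HOL-Decision_Procs.Algebra_Aux"
begin

text \<open>Only the restrictions of \<open>\<rho>1\<close> and \<open>\<rho>2\<close> to \<open>[0,\<infinity>)\<close> are relevant.\<close>

definition coarse_embedding ::
  "'a set \<Rightarrow> ('a \<Rightarrow> 'a \<Rightarrow> real) \<Rightarrow> 'b set \<Rightarrow> ('b \<Rightarrow> 'b \<Rightarrow> real) \<Rightarrow> ('a \<Rightarrow> 'b) \<Rightarrow> bool" where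
  "coarse_embedding X dX Y dY f \<longleftrightarrow>
     f \<in> X \<rightarrow> Y \<and>
     (\<exists>\<rho>1 \<rho>2 :: real \<Rightarrow> real.
        \<rho>1 \<in> {0..} \<rightarrow> {0..} \<and> mono_on {0..} \<rho>1 \<and>
        \<rho>2 \<in> {0..} \<rightarrow> {0..} \<and> mono_on {0..} \<rho>2 \<and>
        filterlim \<rho>1 at_top at_top \<and>
        (\<forall>x\<in>X. \<forall>y\<in>X. \<rho>1 (dX x y) \<le> dY (f x) (f y) \<and> dY (f x) (f y) \<le> \<rho>2 (dX x y)))"

text \<open>
  Hilbert spaces are represented with explicit carrier and operations, rather than by type
  classes, because a formula cannot quantify existentially over types.
  The fields \<open>mult\<close> and \<open>one\<close> inherited from rings are unused, as always for modules.
\<close>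

record 'h inner_space = "(real, 'h) module" +
  ip :: "'h \<Rightarrow> 'h \<Rightarrow> real"

text \<open>
  The locale \<open>Metric_space\<close> asks for nonnegativity and symmetry also outside the carrier,
  hence the default value \<open>0\<close>.
\<close>

definition ip_dist :: "'h inner_space \<Rightarrow> 'h \<Rightarrow> 'h \<Rightarrow> real" where
  "ip_dist H x y =
     (if x \<in> carrier H \<and> y \<in> carrier H
      then sqrt (ip H (x \<ominus>\<^bsub>H\<^esub> y) (x \<ominus>\<^bsub>H\<^esub> y)) else 0)"

definition hilbert_space :: "'h inner_space \<Rightarrow> bool" where
  "hilbert_space H \<longleftrightarrow>
     Module.module (cring_class_ops :: real ring) H \<and>
     (\<forall>x\<in>carrier H. \<forall>y\<in>carrier H. ip H x y = ip H y x) \<and>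
     (\<forall>x\<in>carrier H. \<forall>y\<in>carrier H. \<forall>z\<in>carrier H. ip H (x \<oplus>\<^bsub>H\<^esub> y) z = ip H x z + ip H y z) \<and>
     (\<forall>a. \<forall>x\<in>carrier H. \<forall>y\<in>carrier H. ip H (a \<odot>\<^bsub>H\<^esub> x) y = a * ip H x y) \<and>
     (\<forall>x\<in>carrier H. 0 \<le> ip H x x) \<and>
     (\<forall>x\<in>carrier H. ip H x x = 0 \<longrightarrow> x = \<zero>\<^bsub>H\<^esub>) \<and>
     Metric_space.mcomplete (carrier H) (ip_dist H)"

text \<open>
  The type argument is the universe from which the points of the Hilbert space are drawn; every
  Hilbert space occurs for a suitable choice of it.
\<close>

definition coarsely_embeds_into_Hilbert ::
  "'h itself \<Rightarrow> 'a set \<Rightarrow> ('a \<Rightarrow> 'a \<Rightarrow> real) \<Rightarrow> bool" where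
  "coarsely_embeds_into_Hilbert _ X d \<longleftrightarrow>
     (\<exists>(H :: 'h inner_space) f. hilbert_space H \<and> coarse_embedding X d (carrier H) (ip_dist H) f)"

text \<open>The class instance \<open>dist\<close> on \<^typ>\<open>real \<times> real\<close> is Euclidean, so it is not used.\<close>

definition linf_dist :: "real \<times> real \<Rightarrow> real \<times> real \<Rightarrow> real" where
  "linf_dist x y = max \<bar>fst x - fst y\<bar> \<bar>snd x - snd y\<bar>"

definition wasserstein_space :: "real \<Rightarrow> (real \<times> real) measure set" where
  "wasserstein_space p =
     {\<mu>. sets \<mu> = sets borel \<and> prob_space \<mu> \<and>
         (\<integral>\<^sup>+ x. ennreal (linf_dist x (0, 0) powr p) \<partial>\<mu>) < \<infinity>}"

definition couplings ::
  "(real \<times> real) measure \<Rightarrow> (real \<times> real) measure \<Rightarrow> ((real \<times> real) \<times> (real \<times> real)) measure set" where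
  "couplings \<alpha> \<beta> =
     {\<gamma>. sets \<gamma> = sets borel \<and> prob_space \<gamma> \<and> distr \<gamma> borel fst = \<alpha> \<and> distr \<gamma> borel snd = \<beta>}"

definition wasserstein_dist ::
  "real \<Rightarrow> (real \<times> real) measure \<Rightarrow> (real \<times> real) measure \<Rightarrow> real" where
  "wasserstein_dist p \<alpha> \<beta> =
     enn2real (INF \<gamma>\<in>couplings \<alpha> \<beta>. \<integral>\<^sup>+ z. ennreal (linf_dist (fst z) (snd z) powr p) \<partial>\<gamma>) powr (1 / p)"

definition persistence_diagrams :: "(real \<times> real) multiset set" where
  "persistence_diagrams = {D. \<forall>x\<in>#D. fst x < snd x}"

definition diagonal :: "(real \<times> real) set" where
  "diagonal = {(x, x) | x. True}"

definition dist_diagonal :: "real \<times> real \<Rightarrow> real" where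
  "dist_diagonal x = (INF y\<in>diagonal. linf_dist x y)"

text \<open>
  Points of a multiset are counted with multiplicity, so a bijection \<open>f\<close> between multisets
  \<open>B1\<close> and \<open>B2\<close> may send distinct copies of one point to different points. It is therefore
  given by its graph: the multiset \<open>F\<close> of all pairs \<open>(x, f x)\<close>, one for each copy of \<open>x\<close> in
  \<open>B1\<close>, whose first projection is \<open>B1\<close> and whose second projection is \<open>B2\<close>.
\<close>

definition partial_matching ::
  "(real \<times> real) multiset \<Rightarrow> (real \<times> real) multiset \<Rightarrow>
   (real \<times> real) multiset \<Rightarrow> (real \<times> real) multiset \<Rightarrow> ((real \<times> real) \<times> (real \<times> real)) multiset \<Rightarrow> bool"
  where
  "partial_matching D1 D2 B1 B2 F \<longleftrightarrow>
     B1 \<subseteq># D1 \<and> B2 \<subseteq># D2 \<and> image_mset fst F = B1 \<and> image_mset snd F = B2"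

definition matching_cost ::
  "real \<Rightarrow> (real \<times> real) multiset \<Rightarrow> (real \<times> real) multiset \<Rightarrow>
   (real \<times> real) multiset \<Rightarrow> (real \<times> real) multiset \<Rightarrow> ((real \<times> real) \<times> (real \<times> real)) multiset \<Rightarrow> real"
  where
  "matching_cost p D1 D2 B1 B2 F =
     ((\<Sum>(x, y)\<in>#F. linf_dist x y powr p)
      + (\<Sum>x\<in>#D1 - B1. dist_diagonal x powr p)
      + (\<Sum>x\<in>#D2 - B2. dist_diagonal x powr p)) powr (1 / p)"

definition diagram_dist ::
  "real \<Rightarrow> (real \<times> real) multiset \<Rightarrow> (real \<times> real) multiset \<Rightarrow> real" where
  "diagram_dist p D1 D2 =
     Inf {matching_cost p D1 D2 B1 B2 F | B1 B2 F. partial_matching D1 D2 B1 B2 F}"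

end

theory Submission
  imports Defs
begin

text \<open>
  Both spaces are coarsely finitely represented in each other. Up to a bounded error, a measure in the
  Wasserstein space is the uniform measure on finitely many points with integer coordinates, and a
  diagram has rational points. By Birkhoff's theorem the transport cost between two uniform measures
  on \<open>N\<close> points is, up to constants, the cost of the best permutation. So finitely many measures embed
  into the diagrams, as the rescaled representing points moved far away from the diagonal, and finitely
  many diagrams embed into the measures, as the uniform measures on their points together with the
  diagonal projections of the points of the other diagrams; all the constants depend only on \<open>p\<close>.

  A coarse embedding into a Hilbert space passes from these finite pieces to the whole space, with
  the \<^emph>\<open>same\<close> Hilbert space \<open>H\<close>: countably many codes suffice, so the maps obtained from the pieces
  are sequences of vectors, and their Gram matrices have a limit along a subsequence. The limit matrix
  is realised in \<open>H\<close> since \<open>H\<close> has either finite dimension or an infinite orthonormal sequence.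
\<close>

section \<open>Limits of bounded maps into a Hilbert space\<close>

text \<open>The statement fixes the type of the points of the Hilbert space, so neither an
  ultraproduct nor an abstract space built from a limiting kernel is available; hence the insistence
  on the given \<open>H\<close>.

  Finite pieces are forced by scale. A uniform measure averages over its points while a matching
  cost sums over them. A factor \<open>N powr (1 / p)\<close> balances the two: points are scaled up
  by it to build measures and down to build diagrams, and \<open>N\<close> grows with the piece. The
  maps of different pieces are therefore unrelated, and only their distortion is uniform. A second
  obstacle is that transport preserves mass while points of a diagram may remain unmatched. Padding
  equalises the masses of the diagrams in one piece; in the other direction, the distance from the
  diagonal makes unmatched points too expensive.

  Coarse embeddings tolerate additive and multiplicative constants. So matchings and couplings that
  are optimal up to \<open>1\<close> suffice, and estimates are made for p-th powers of distances,
  where a triangle inequality costs a factor \<open>3 powr p\<close>.\<close>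

locale hilbert =
  fixes H :: "'h inner_space" (structure)
  assumes hilbert: "hilbert_space H"
begin

lemma module: "Module.module (cring_class_ops :: real ring) H"
  using hilbert by (simp add: hilbert_space_def)

lemma group: "abelian_group H"
  using module by (simp add: Module.module_def)

lemma closed [simp]:
  shows "x \<in> carrier H \<Longrightarrow> y \<in> carrier H \<Longrightarrow> x \<oplus> y \<in> carrier H"
    and "x \<in> carrier H \<Longrightarrow> a \<odot> x \<in> carrier H"
    and "\<zero> \<in> carrier H"
    and "x \<in> carrier H \<Longrightarrow> y \<in> carrier H \<Longrightarrow> x \<ominus> y \<in> carrier H"
proof -
  interpret M: module "cring_class_ops :: real ring" H by (rule module)
  show "x \<in> carrier H \<Longrightarrow> y \<in> carrier H \<Longrightarrow> x \<oplus> y \<in> carrier H"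
    and "x \<in> carrier H \<Longrightarrow> a \<odot> x \<in> carrier H"
    and "\<zero> \<in> carrier H"
    and "x \<in> carrier H \<Longrightarrow> y \<in> carrier H \<Longrightarrow> x \<ominus> y \<in> carrier H"
    by (auto simp: carrier_class)
qed

lemma minus_add_cancel:
  assumes "x \<in> carrier H" "y \<in> carrier H"
  shows "y \<oplus> (x \<ominus> y) = x"
proof -
  interpret M: abelian_group H by (rule group)
  show ?thesis
    using assms M.a_lcomm[of y x "\<ominus> y"] M.r_neg[of y] by (simp add: M.minus_eq)
qed

lemma ip_commute: "x \<in> carrier H \<Longrightarrow> y \<in> carrier H \<Longrightarrow> ip H x y = ip H y x"
  and ip_add: "x \<in> carrier H \<Longrightarrow> y \<in> carrier H \<Longrightarrow> z \<in> carrier H \<Longrightarrow>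
    ip H (x \<oplus> y) z = ip H x z + ip H y z"
  and ip_smult: "x \<in> carrier H \<Longrightarrow> y \<in> carrier H \<Longrightarrow> ip H (a \<odot> x) y = a * ip H x y"
  and ip_nonneg: "x \<in> carrier H \<Longrightarrow> 0 \<le> ip H x x"
  and ip_eq_0: "x \<in> carrier H \<Longrightarrow> ip H x x = 0 \<Longrightarrow> x = \<zero>"
  using hilbert by (auto simp: hilbert_space_def)

lemma ip_minus:
  assumes "x \<in> carrier H" "y \<in> carrier H" "z \<in> carrier H"
  shows "ip H (x \<ominus> y) z = ip H x z - ip H y z"
  using ip_add[of y "x \<ominus> y" z] minus_add_cancel[of x y] assms by simp

lemma smult_zero: "a \<odot> \<zero> = \<zero>"
proof -
  interpret M: module "cring_class_ops :: real ring" H by (rule module)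
  show ?thesis by (simp add: carrier_class)
qed

lemma smult_smult: "x \<in> carrier H \<Longrightarrow> a \<odot> (b \<odot> x) = (a * b) \<odot> x"
  and smult_1: "x \<in> carrier H \<Longrightarrow> 1 \<odot> x = x"
proof -
  interpret M: module "cring_class_ops :: real ring" H by (rule module)
  show "x \<in> carrier H \<Longrightarrow> a \<odot> (b \<odot> x) = (a * b) \<odot> x"
    and "x \<in> carrier H \<Longrightarrow> 1 \<odot> x = x"
    using M.smult_assoc1[of a b x] M.smult_one[of x] by (auto simp: class_simps)
qed

lemma ip_zero: "x \<in> carrier H \<Longrightarrow> ip H \<zero> x = 0"
  using ip_smult[of \<zero> x 0] by (simp add: smult_zero)

lemma add_zero: "x \<in> carrier H \<Longrightarrow> x \<oplus> \<zero> = x"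
proof -
  interpret M: abelian_group H by (rule group)
  show "x \<in> carrier H \<Longrightarrow> x \<oplus> \<zero> = x" by simp
qed

lemma ip_dist_sq:
  assumes "x \<in> carrier H" "y \<in> carrier H"
  shows "ip_dist H x y = sqrt (ip H x x - 2 * ip H x y + ip H y y)"
proof -
  have "x \<ominus> y \<in> carrier H" using assms by simp
  then show ?thesis
    using ip_minus[OF assms, of "x \<ominus> y"] ip_minus[OF assms, of x] ip_minus[OF assms, of y] assms
      ip_commute[of x "x \<ominus> y"] ip_commute[of y "x \<ominus> y"] ip_commute[of y x]
    by (simp add: ip_dist_def)
qed

section \<open>Orthogonal systems and coordinates\<close>

primrec lincomb :: "(nat \<Rightarrow> 'h) \<Rightarrow> (nat \<Rightarrow> real) \<Rightarrow> nat \<Rightarrow> 'h" where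
  "lincomb e c 0 = \<zero>"
| "lincomb e c (Suc n) = lincomb e c n \<oplus> c n \<odot> e n"

lemma lincomb_closed: "(\<And>k. k < n \<Longrightarrow> e k \<in> carrier H) \<Longrightarrow> lincomb e c n \<in> carrier H"
  by (induction n) auto

lemma lincomb_cong:
  "(\<And>k. k < n \<Longrightarrow> e k = e' k) \<Longrightarrow> (\<And>k. k < n \<Longrightarrow> c k = c' k) \<Longrightarrow> lincomb e c n = lincomb e' c' n"
  by (induction n) auto

lemma ip_lincomb:
  assumes "\<And>k. k < n \<Longrightarrow> e k \<in> carrier H" "z \<in> carrier H"
  shows "ip H (lincomb e c n) z = (\<Sum>k<n. c k * ip H (e k) z)"
  using assms by (induction n) (auto simp: ip_zero ip_add ip_smult lincomb_closed)

text \<open>One Gram-Schmidt step. The residual \<open>R\<close> of \<open>x\<close> after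
  subtraction of its Fourier sum \<open>l\<close> is orthogonal to every \<open>e k\<close>, hence
  to \<open>l\<close>, and \<open>r\<close> is \<open>R\<close> normalised. Zero vectors among the
  \<open>e k\<close> do no harm because their Fourier coefficients vanish too; \<open>r\<close> is
  itself zero if \<open>R\<close> is.\<close>

lemma orthogonal_extension:
  fixes e :: "nat \<Rightarrow> 'h"
  assumes e: "\<And>k. k < n \<Longrightarrow> e k \<in> carrier H"
    and unit: "\<And>k. k < n \<Longrightarrow> ip H (e k) (e k) = 1 \<or> e k = \<zero>"
    and orth: "\<And>k l. k < n \<Longrightarrow> l < n \<Longrightarrow> k \<noteq> l \<Longrightarrow> ip H (e k) (e l) = 0"
    and x: "x \<in> carrier H"
  obtains r where "r \<in> carrier H" "ip H r r = 1 \<or> r = \<zero>" "\<And>k. k < n \<Longrightarrow> ip H (e k) r = 0"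
    "x = lincomb e (\<lambda>k. ip H x (e k)) n \<oplus> ip H x r \<odot> r"
proof -
  define l where "l = lincomb e (\<lambda>k. ip H x (e k)) n"
  define R where "R = x \<ominus> l"
  have l: "l \<in> carrier H" using e by (simp add: l_def lincomb_closed)
  then have R: "R \<in> carrier H" using x by (simp add: R_def)
  have xR: "x = l \<oplus> R" using minus_add_cancel[OF x l] by (simp add: R_def)
  have Re: "ip H R (e k) = 0" if k: "k < n" for k
  proof -
    have "ip H l (e k) = (\<Sum>j<n. ip H x (e j) * ip H (e j) (e k))"
      unfolding l_def by (rule ip_lincomb) (use e k in auto)
    also have "\<dots> = (\<Sum>j<n. if j = k then ip H x (e j) * ip H (e j) (e k) else 0)"
      using orth k by (intro sum.cong) auto
    also have "\<dots> = ip H x (e k) * ip H (e k) (e k)" using k by simp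
    also have "\<dots> = ip H x (e k)"
      using unit[OF k] ip_zero[OF x] ip_commute[OF x, of \<zero>] by auto
    finally show ?thesis using ip_minus[OF x l e[OF k]] by (simp add: R_def)
  qed
  have lR: "ip H l R = 0"
  proof -
    have "ip H (e k) R = 0" if "k < n" for k
      using Re[OF that] ip_commute[OF R e[OF that]] by simp
    then show ?thesis
      unfolding l_def using ip_lincomb[OF e R] by simp
  qed
  show ?thesis
  proof (cases "R = \<zero>")
    case True
    show ?thesis
    proof (rule that[of \<zero>])
      show "x = lincomb e (\<lambda>k. ip H x (e k)) n \<oplus> ip H x \<zero> \<odot> \<zero>"
        unfolding smult_zero l_def[symmetric] using xR unfolding True .
      show "ip H (e k) \<zero> = 0" if "k < n" for k
        using ip_commute[OF e[OF that], of \<zero>] ip_zero[OF e[OF that]] by simp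
    qed auto
  next
    case False
    define s where "s = sqrt (ip H R R)"
    have "ip H R R > 0" using False ip_nonneg[OF R] ip_eq_0[OF R] by force
    then have s: "s > 0" "ip H R R = s * s" by (auto simp: s_def)
    define r where "r = (1 / s) \<odot> R"
    have r: "r \<in> carrier H" using R by (simp add: r_def)
    have rz: "ip H r z = ip H R z / s" if "z \<in> carrier H" for z
      using ip_smult[OF R that, of "1/s"] by (simp add: r_def)
    have "ip H x r = ip H r l + ip H r R"
      using ip_add[OF l R r] ip_commute[OF r l] ip_commute[OF r R] by (simp flip: xR)
    also have "\<dots> = s"
      using rz[OF l] rz[OF R] lR ip_commute[OF l R] s by simp
    finally have xr: "ip H x r = s" .
    have rR: "s \<odot> r = R"
      unfolding r_def smult_smult[OF R] using s(1) smult_1[OF R] by simp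
    show ?thesis
    proof (rule that[OF r])
      show "ip H r r = 1 \<or> r = \<zero>" using rz[OF r] rz[OF R] ip_commute[OF r R] s by simp
      show "ip H (e k) r = 0" if "k < n" for k
        using rz[OF e[OF that]] Re[OF that] ip_commute[OF r e[OF that]] by simp
      show "x = lincomb e (\<lambda>k. ip H x (e k)) n \<oplus> ip H x r \<odot> r"
        unfolding xr l_def[symmetric] rR by (rule xR)
    qed
  qed
qed

end

context hilbert
begin

text \<open>Linearly dependent vectors are not treated separately: the orthogonal vectors of the proof may be
  zero, and the corresponding coordinates vanish.\<close>

lemma gram_schmidt:
  fixes u :: "nat \<Rightarrow> 'h"
  assumes u: "\<And>i. u i \<in> carrier H"
  shows "\<exists>w :: nat \<Rightarrow> nat \<Rightarrow> real. (\<forall>i k. i < k \<longrightarrow> w i k = 0) \<and>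
    (\<forall>i j. ip H (u i) (u j) = (\<Sum>k\<le>i. w i k * w j k))"
proof -
  define P where "P f i r \<longleftrightarrow> r \<in> carrier H \<and> (ip H r r = 1 \<or> r = \<zero>) \<and>
      (\<forall>k<i. ip H (f k) r = 0) \<and> u i = lincomb f (\<lambda>k. ip H (u i) (f k)) i \<oplus> ip H (u i) r \<odot> r"
    for f i r
  have "\<exists>f. \<forall>i. P f i (f i)"
  \<comment> \<open>Each vector depends on all its predecessors, so the choice is a recursion along
    the order. The first goal says that \<open>P f i r\<close> sees \<open>f\<close> only below
    \<open>i\<close>.\<close>
  proof (rule dependent_wellorder_choice)
    fix r and f g :: "nat \<Rightarrow> 'h" and i
    assume fg: "\<And>k. k < i \<Longrightarrow> f k = g k"
    have "lincomb f (\<lambda>k. ip H (u i) (f k)) i = lincomb g (\<lambda>k. ip H (u i) (g k)) i"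
      using fg by (intro lincomb_cong) auto
    then show "P f i r = P g i r" by (auto simp: P_def fg)
  next
    fix i f assume "\<And>k. k < i \<Longrightarrow> P f k (f k)"
    then have f: "\<And>k. k < i \<Longrightarrow> f k \<in> carrier H" "\<And>k. k < i \<Longrightarrow> ip H (f k) (f k) = 1 \<or> f k = \<zero>"
      and ord: "\<And>k l. k < l \<Longrightarrow> l < i \<Longrightarrow> ip H (f k) (f l) = 0"
      by (auto simp: P_def)
    have orth: "ip H (f k) (f l) = 0" if "k < i" "l < i" "k \<noteq> l" for k l
      using ord[of k l] ord[of l k] ip_commute[OF f(1)[OF that(1)] f(1)[OF that(2)]] that
      by (cases "k < l") auto
    show "\<exists>r. P f i r"
      using orthogonal_extension[of i f "u i", OF f orth u] unfolding P_def by blast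
  qed
  then obtain f where f: "\<And>i. P f i (f i)" by blast
  have fc: "f i \<in> carrier H" for i using f by (simp add: P_def)
  have ui: "u i = lincomb f (\<lambda>k. ip H (u i) (f k)) (Suc i)" for i
    using f by (simp add: P_def)
  have ipu: "ip H (u i) z = (\<Sum>k\<le>i. ip H (u i) (f k) * ip H (f k) z)" if "z \<in> carrier H" for i z
    using ip_lincomb[of "Suc i" f z "\<lambda>k. ip H (u i) (f k)"] fc that
    by (subst ui) (simp only: lessThan_Suc_atMost)
  show ?thesis
  proof (intro exI[of _ "\<lambda>i k. ip H (u i) (f k)"] conjI allI impI)
    show "ip H (u i) (f k) = 0" if "i < k" for i k
      using that f[of k] by (subst ipu[OF fc]) (auto simp: P_def intro!: sum.neutral)
    show "ip H (u i) (u j) = (\<Sum>k\<le>i. ip H (u i) (f k) * ip H (u j) (f k))" for i j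
      using ipu[OF u, of i j] by (simp add: ip_commute[OF fc u])
  qed
qed

text \<open>Only finitely many coordinates of each vector are needed, either because \<open>H\<close> contains an
  infinite orthonormal sequence, so that the triangular coordinates found by the Gram-Schmidt process
  can be realised, or because \<open>H\<close> is finite-dimensional.\<close>

lemma orthonormal_coordinates:
  obtains m :: "nat \<Rightarrow> nat" and e :: "nat \<Rightarrow> 'h" where
    "\<And>i k. k < m i \<Longrightarrow> e k \<in> carrier H"
    "\<And>i j k l. k < m i \<Longrightarrow> l < m j \<Longrightarrow> ip H (e k) (e l) = of_bool (k = l)"
    "\<And>u. \<forall>i. u i \<in> carrier H \<Longrightarrow> \<exists>w. (\<forall>i k. m i \<le> k \<longrightarrow> w i k = 0) \<and>
       (\<forall>i j. ip H (u i) (u j) = (\<Sum>k<m i. w i k * w j k))"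
proof -
  define P where "P f i r \<longleftrightarrow> r \<in> carrier H \<and> ip H r r = 1 \<and> (\<forall>k<i. ip H (f k) r = 0)"
    for f :: "nat \<Rightarrow> 'h" and i :: nat and r
  have orth: "ip H (f k) (f l) = of_bool (k = l)"
    if P: "\<And>k. k < i \<Longrightarrow> P f k (f k)" and kl: "k < i" "l < i" for f i k l
  proof -
    have "f k \<in> carrier H" "f l \<in> carrier H" using P kl by (auto simp: P_def)
    then show ?thesis
      using P[OF kl(1)] P[OF kl(2)] ip_commute[of "f k" "f l"]
      by (cases k l rule: linorder_cases) (auto simp: P_def)
  qed
  show ?thesis
  \<comment> \<open>Either every finite orthonormal sequence can be prolonged, and the recursive
    choice gives an infinite one, or some finite one is maximal and then spans \<open>H\<close> by
    \<open>orthogonal_extension\<close>.\<close>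
  proof (cases "\<exists>f i. (\<forall>k<i. P f k (f k)) \<and> \<not> (\<exists>r. P f i r)")
    case False
    have "\<exists>f. \<forall>i. P f i (f i)"
    proof (rule dependent_wellorder_choice)
      show "\<exists>r. P f i r" if "\<And>k. k < i \<Longrightarrow> P f k (f k)" for i f using False that by blast
    qed (auto simp: P_def)
    then obtain e where e: "\<And>i. P e i (e i)" by blast
    show ?thesis
    \<comment> \<open>Triangular coordinates of the \<open>i\<close>-th vector have indices
      \<open>0\<close> to \<open>i\<close>, hence \<open>m i = Suc i\<close>. They refer to the
      Gram-Schmidt vectors of \<open>u\<close>, not to \<open>e\<close>, and the vectors
      \<open>u i\<close> need not lie in the span of \<open>e\<close>: only Gram matrices are
      transferred.\<close>
    proof (rule that[of Suc e])
      show "e k \<in> carrier H" for k using e by (simp add: P_def)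
      show "ip H (e k) (e l) = of_bool (k = l)" for k l
        using orth[of "Suc (max k l)" e k l] e by auto
      show "\<exists>w. (\<forall>i k. Suc i \<le> k \<longrightarrow> w i k = 0) \<and>
          (\<forall>i j. ip H (u i) (u j) = (\<Sum>k<Suc i. w i k * w j k))"
        if u: "\<forall>i. u i \<in> carrier H" for u :: "nat \<Rightarrow> 'h"
        using gram_schmidt[of u] u unfolding lessThan_Suc_atMost Suc_le_eq by blast
    qed
  next
    case True
    then obtain e n where e: "\<And>k. k < n \<Longrightarrow> P e k (e k)" and max: "\<And>r. \<not> P e n r" by blast
    have ec: "e k \<in> carrier H" "ip H (e k) (e k) = 1" if "k < n" for k
      using e[OF that] by (auto simp: P_def)
    have eo: "ip H (e k) (e l) = of_bool (k = l)" if "k < n" "l < n" for k l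
      using orth[OF e that] .
    have span: "x = lincomb e (\<lambda>k. ip H x (e k)) n" if x: "x \<in> carrier H" for x
    proof -
      have "\<And>k l. k < n \<Longrightarrow> l < n \<Longrightarrow> k \<noteq> l \<Longrightarrow> ip H (e k) (e l) = 0" using eo by simp
      from orthogonal_extension[of n e x, OF ec(1) disjI1 this x, OF _ ec(2)]
      obtain r where r: "r \<in> carrier H" "ip H r r = 1 \<or> r = \<zero>" "\<And>k. k < n \<Longrightarrow> ip H (e k) r = 0"
        "x = lincomb e (\<lambda>k. ip H x (e k)) n \<oplus> ip H x r \<odot> r" by blast
      \<comment> \<open>A unit vector \<open>r\<close> would prolong the maximal sequence.\<close>
      have r0: "r = \<zero>" using max[of r] r by (auto simp: P_def)
      have l: "lincomb e (\<lambda>k. ip H x (e k)) n \<in> carrier H" using ec by (simp add: lincomb_closed)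
      show ?thesis
        using r(4) unfolding r0 smult_zero add_zero[OF l] .
    qed
    show ?thesis
    proof (rule that[of "\<lambda>_. n" e])
      show "\<exists>w. (\<forall>i k. n \<le> k \<longrightarrow> w i k = 0) \<and> (\<forall>i j. ip H (u i) (u j) = (\<Sum>k<n. w i k * w j k))"
        if "\<forall>i. u i \<in> carrier H" for u :: "nat \<Rightarrow> 'h"
      proof (intro exI[of _ "\<lambda>i k. if k < n then ip H (u i) (e k) else 0"] conjI allI impI)
        fix i j
        have u: "u i \<in> carrier H" for i using that by blast
        have "ip H (u i) (u j) = (\<Sum>k<n. ip H (u i) (e k) * ip H (e k) (u j))"
          by (subst span[OF u, of i], rule ip_lincomb) (use ec u in auto)
        also have "\<dots> = (\<Sum>k<n. ip H (u i) (e k) * ip H (u j) (e k))"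
          using ec u by (intro sum.cong) (auto simp: ip_commute[of "e _" "u j"])
        finally show "ip H (u i) (u j) = (\<Sum>k<n. (if k < n then ip H (u i) (e k) else 0) *
            (if k < n then ip H (u j) (e k) else 0))" by simp
      qed auto
      show "e k \<in> carrier H" if "k < n" for k by (rule ec(1)[OF that])
      show "ip H (e k) (e l) = of_bool (k = l)" if "k < n" "l < n" for k l by (rule eo[OF that])
    qed
  qed
qed

text \<open>The coordinates of \<open>u n i\<close> are bounded by \<open>sqrt (B i)\<close>, so
  they converge along a subsequence. Nothing is lost in the limit because each Gram entry is a sum
  over \<open>m i\<close> coordinates with \<open>m i\<close> independent of \<open>n\<close>. The
  \<open>g i\<close> are not limits of the vectors \<open>u (s n) i\<close>, which may well diverge
  in \<open>H\<close>: the limit coordinates are placed on the fixed vectors \<open>e k\<close>, and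
  only the distances converge.\<close>

lemma bounded_limit:
  fixes u :: "nat \<Rightarrow> nat \<Rightarrow> 'h"
  assumes u: "\<And>n i. u n i \<in> carrier H"
    and bound: "\<And>n i. ip H (u n i) (u n i) \<le> B i"
  obtains g :: "nat \<Rightarrow> 'h" and s :: "nat \<Rightarrow> nat" where
    "strict_mono s" "\<And>i. g i \<in> carrier H"
    "\<And>i j. (\<lambda>n. ip_dist H (u (s n) i) (u (s n) j)) \<longlonglongrightarrow> ip_dist H (g i) (g j)"
proof (rule orthonormal_coordinates)
  fix m :: "nat \<Rightarrow> nat" and e
  assume e: "\<And>i k. k < m i \<Longrightarrow> e k \<in> carrier H"
      "\<And>i j k l. k < m i \<Longrightarrow> l < m j \<Longrightarrow> ip H (e k) (e l) = of_bool (k = l)"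
    and coord: "\<And>u. \<forall>i. u i \<in> carrier H \<Longrightarrow> \<exists>w. (\<forall>i k. m i \<le> k \<longrightarrow> w i k = 0) \<and>
       (\<forall>i j. ip H (u i) (u j) = (\<Sum>k<m i. w i k * w j k))"
  have "\<forall>n. \<exists>w. (\<forall>i k. m i \<le> k \<longrightarrow> w i k = 0) \<and>
       (\<forall>i j. ip H (u n i) (u n j) = (\<Sum>k<m i. w i k * w j k))"
    using coord u by simp
  then obtain w :: "nat \<Rightarrow> nat \<Rightarrow> nat \<Rightarrow> real" where
    w0: "\<And>n i k. m i \<le> k \<Longrightarrow> w n i k = 0" and
    w: "\<And>n i j. ip H (u n i) (u n j) = (\<Sum>k<m i. w n i k * w n j k)"
    by metis
  have wB: "\<bar>w n i k\<bar> \<le> sqrt (B i)" for n i k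
  proof (cases "k < m i")
    case True
    then have "(w n i k)\<^sup>2 \<le> (\<Sum>k<m i. (w n i k)\<^sup>2)" by (intro member_le_sum) auto
    also have "\<dots> \<le> B i" using bound[of n i] w[of n i i] by (simp add: power2_eq_square)
    finally show ?thesis using real_le_rsqrt by force
  next
    case False
    have "0 \<le> B i" using bound[of n i] ip_nonneg[OF u[of n i]] by simp
    then show ?thesis using False w0 by simp
  qed
  \<comment> \<open>A product of compact intervals over the pairs (vector, coordinate). It is
    compact by Tychonoff's theorem, and sequentially compact since there are countably many
    pairs.\<close>
  define K where "K = {f :: nat \<times> nat \<Rightarrow> real. \<forall>q. f q \<in> {- sqrt (B (fst q))..sqrt (B (fst q))}}"
  have "compact K"
  proof -
    have "compactin (product_topology (\<lambda>_. euclidean) UNIV)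
        (PiE UNIV (\<lambda>q :: nat \<times> nat. {- sqrt (B (fst q))..sqrt (B (fst q))}))"
      by (subst compactin_PiE) auto
    also have "PiE UNIV (\<lambda>q :: nat \<times> nat. {- sqrt (B (fst q))..sqrt (B (fst q))}) = K"
      by (auto simp: K_def PiE_def Pi_def)
    finally show ?thesis by (simp add: euclidean_product_topology)
  qed
  moreover have "(\<lambda>q. w n (fst q) (snd q)) \<in> K" for n
    using wB by (auto simp: K_def abs_le_iff minus_le_iff)
  ultimately obtain v and s :: "nat \<Rightarrow> nat" where s: "strict_mono s"
    and lim: "((\<lambda>n q. w n (fst q) (snd q)) \<circ> s) \<longlonglongrightarrow> v"
    using seq_compactE[OF compact_imp_seq_compact, of K "\<lambda>n q. w n (fst q) (snd q)"] by blast
  have limw: "(\<lambda>n. w (s n) i k) \<longlonglongrightarrow> v (i, k)" for i k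
  proof -
    have "continuous_on UNIV (\<lambda>f :: nat \<times> nat \<Rightarrow> real. f (i, k))"
      by (rule continuous_on_product_then_coordinatewise[OF continuous_on_id])
    then have "isCont (\<lambda>f :: nat \<times> nat \<Rightarrow> real. f (i, k)) v"
      by (rule continuous_on_interior) simp
    from isCont_tendsto_compose[OF this lim] show ?thesis by (simp add: o_def)
  qed
  have v0: "v (i, k) = 0" if "m i \<le> k" for i k
    using limw[of i k] by (simp add: w0[OF that] LIMSEQ_const_iff)
  define g where "g i = lincomb e (\<lambda>k. v (i, k)) (m i)" for i
  have g: "g i \<in> carrier H" for i unfolding g_def by (rule lincomb_closed) (rule e)
  have ipg: "ip H (g i) (g j) = (\<Sum>k<m i. v (i, k) * v (j, k))" for i j
  proof -
    have eg: "ip H (e k) (g j) = v (j, k)" if k: "k < m i" for k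
    proof -
      have "ip H (g j) (e k) = (\<Sum>l<m j. v (j, l) * ip H (e l) (e k))"
        unfolding g_def by (rule ip_lincomb) (use e k in auto)
      also have "\<dots> = (\<Sum>l<m j. if l = k then v (j, l) else 0)"
        using e(2)[OF _ k] by (intro sum.cong) auto
      also have "\<dots> = v (j, k)" using v0[of j k] by auto
      finally show ?thesis using ip_commute[OF g e(1)[OF k]] by simp
    qed
    have "ip H (g i) (g j) = (\<Sum>k<m i. v (i, k) * ip H (e k) (g j))"
      unfolding g_def[of i] by (rule ip_lincomb) (use e g in auto)
    then show ?thesis using eg by simp
  qed
  have limip: "(\<lambda>n. ip H (u (s n) i) (u (s n) j)) \<longlonglongrightarrow> ip H (g i) (g j)" for i j
    unfolding w ipg by (intro tendsto_intros limw)
  show ?thesis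
  proof (rule that[OF s g])
    show "(\<lambda>n. ip_dist H (u (s n) i) (u (s n) j)) \<longlonglongrightarrow> ip_dist H (g i) (g j)" for i j
      unfolding ip_dist_sq[OF u u] ip_dist_sq[OF g g] by (intro tendsto_intros limip)
  qed
qed

end

lemma (in hilbert) ip_dist_translate:
  assumes "a \<in> carrier H" "b \<in> carrier H" "c \<in> carrier H"
  shows "ip_dist H (a \<ominus> c) (b \<ominus> c) = ip_dist H a b"
proof -
  have minus2: "ip H (x \<ominus> c) (y \<ominus> c) = ip H x y - ip H x c - ip H y c + ip H c c"
    if "x \<in> carrier H" "y \<in> carrier H" for x y
    using that assms ip_minus[of x c "y \<ominus> c"] ip_minus[of y c x] ip_minus[of y c c]
      ip_commute[of x "y \<ominus> c"] ip_commute[of c "y \<ominus> c"] ip_commute[of y x] ip_commute[of c x]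
    by simp
  show ?thesis
    using assms by (simp add: ip_dist_sq minus2)
qed

text \<open>The maps into the Hilbert space that are obtained from the single \<open>n\<close> are normalised at a base
  point, which bounds them pointwise, and pass to the limit.\<close>

lemma coarsely_embeds_by_finite_approximation:
  fixes X :: "'a set" and Y :: "'b set" and r :: "'a \<Rightarrow> nat" and C :: real
  assumes Y: "coarsely_embeds_into_Hilbert TYPE('h) Y dY"
    and dX: "\<And>x y. dX x y \<ge> 0" and dY: "\<And>x y. dY x y \<ge> 0" and C: "C > 0"
    and approx: "\<And>n. \<exists>\<phi>. \<forall>x\<in>X. \<forall>y\<in>X. r x < n \<longrightarrow> r y < n \<longrightarrow> \<phi> (r x) \<in> Y \<and>
      dX x y \<le> C * (1 + dY (\<phi> (r x)) (\<phi> (r y))) \<and> dY (\<phi> (r x)) (\<phi> (r y)) \<le> C * (1 + dX x y)"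
  shows "coarsely_embeds_into_Hilbert TYPE('h) X dX"
proof -
  obtain H :: "'h inner_space" and f where H: "hilbert_space H"
    and emb: "coarse_embedding Y dY (carrier H) (ip_dist H) f"
    using Y unfolding coarsely_embeds_into_Hilbert_def by blast
  have f: "f \<in> Y \<rightarrow> carrier H" using emb by (simp add: coarse_embedding_def)
  obtain \<rho>1 \<rho>2 where
    \<rho>: "\<rho>1 \<in> {0..} \<rightarrow> {0..}" "mono_on {0..} \<rho>1" "\<rho>2 \<in> {0..} \<rightarrow> {0..}" "mono_on {0..} \<rho>2"
      "filterlim \<rho>1 at_top at_top"
    and bounds: "\<And>x y. x \<in> Y \<Longrightarrow> y \<in> Y \<Longrightarrow>
      \<rho>1 (dY x y) \<le> ip_dist H (f x) (f y) \<and> ip_dist H (f x) (f y) \<le> \<rho>2 (dY x y)"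
    using emb unfolding coarse_embedding_def by auto
  interpret hilbert H by unfold_locales (rule H)
  have \<rho>1_mono: "\<rho>1 s \<le> \<rho>1 t" if "0 \<le> s" "s \<le> t" for s t
    using \<rho>(2) that by (auto simp: mono_on_def)
  have \<rho>2_mono: "\<rho>2 s \<le> \<rho>2 t" if "0 \<le> s" "s \<le> t" for s t
    using \<rho>(4) that by (auto simp: mono_on_def)
  \<comment> \<open>The bound \<open>dX \<le> C * (1 + dY)\<close> gives
    \<open>dX / C - 1 \<le> dY\<close>; the maximum with \<open>0\<close> keeps the argument in the
    range where \<open>\<rho>1\<close> is monotone.\<close>
  define \<sigma>1 \<sigma>2 where "\<sigma>1 t = \<rho>1 (max 0 (t / C - 1))" and "\<sigma>2 t = \<rho>2 (C * (1 + t))" for t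
  have "filterlim (\<lambda>t. max 0 (t / C - 1)) at_top at_top"
    unfolding filterlim_at_top
  proof
    fix Z
    show "eventually (\<lambda>t. Z \<le> max 0 (t / C - 1)) at_top"
      using eventually_ge_at_top[of "C * (Z + 1)"]
    proof eventually_elim
      case (elim t)
      then have "C * (Z + 1) / C \<le> t / C" using C by (intro divide_right_mono) auto
      then show ?case using C by simp
    qed
  qed
  then have \<sigma>1_lim: "filterlim \<sigma>1 at_top at_top"
    unfolding \<sigma>1_def by (rule filterlim_compose[OF \<rho>(5)])
  have \<sigma>1_mono: "mono_on {0..} \<sigma>1"
    unfolding \<sigma>1_def using C by (intro mono_onI \<rho>1_mono max.mono) (auto simp: divide_right_mono)
  have \<sigma>2_mono: "mono_on {0..} \<sigma>2"
    unfolding \<sigma>2_def using C by (intro mono_onI \<rho>2_mono) auto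
  have \<sigma>_nonneg: "\<sigma>1 \<in> {0..} \<rightarrow> {0..}" "\<sigma>2 \<in> {0..} \<rightarrow> {0..}"
    using \<rho>(1,3) C by (auto simp: \<sigma>1_def \<sigma>2_def Pi_def)
  obtain F where F: "F \<in> X \<rightarrow> carrier H"
    and FX: "\<And>x y. x \<in> X \<Longrightarrow> y \<in> X \<Longrightarrow>
      \<sigma>1 (dX x y) \<le> ip_dist H (F x) (F y) \<and> ip_dist H (F x) (F y) \<le> \<sigma>2 (dX x y)"
  proof (cases "X = {}")
    case True
    then show ?thesis by (intro that[of undefined]) auto
  next
    case False
    then obtain x0 where x0: "x0 \<in> X" by blast
    have "\<exists>\<phi>. \<forall>n. \<forall>x\<in>X. \<forall>y\<in>X. r x < n \<longrightarrow> r y < n \<longrightarrow> \<phi> n (r x) \<in> Y \<and>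
        dX x y \<le> C * (1 + dY (\<phi> n (r x)) (\<phi> n (r y))) \<and> dY (\<phi> n (r x)) (\<phi> n (r y)) \<le> C * (1 + dX x y)"
      by (rule choice) (use approx in blast)
    then obtain \<phi> where \<phi>': "\<forall>n. \<forall>x\<in>X. \<forall>y\<in>X. r x < n \<longrightarrow> r y < n \<longrightarrow> \<phi> n (r x) \<in> Y \<and>
        dX x y \<le> C * (1 + dY (\<phi> n (r x)) (\<phi> n (r y))) \<and> dY (\<phi> n (r x)) (\<phi> n (r y)) \<le> C * (1 + dX x y)" ..
    have \<phi>: "\<phi> n (r x) \<in> Y \<and> dX x y \<le> C * (1 + dY (\<phi> n (r x)) (\<phi> n (r y))) \<and>
        dY (\<phi> n (r x)) (\<phi> n (r y)) \<le> C * (1 + dX x y)"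
      if "x \<in> X" "y \<in> X" "r x < n" "r y < n" for x y n
      using \<phi>' that by blast
    have f\<phi>: "f (\<phi> n (r x)) \<in> carrier H" if "x \<in> X" "r x < n" for x n
      using \<phi>[OF that(1) that(1) that(2) that(2)] f by blast
    \<comment> \<open>Subtracting the image of the base point \<open>x0\<close> leaves distances
      unchanged and bounds the vectors. Codes that are not covered at stage \<open>n\<close> get the
      value zero, so that \<open>u\<close> is a total sequence.\<close>
    define u where "u n i = (if i \<in> r ` X \<and> i < n \<and> r x0 < n then f (\<phi> n i) \<ominus>\<^bsub>H\<^esub> f (\<phi> n (r x0)) else \<zero>\<^bsub>H\<^esub>)"
      for n i
    have uc: "u n i \<in> carrier H" for n i
      using f\<phi> x0 by (auto simp: u_def)
    have f_bounds: "\<sigma>1 (dX x y) \<le> ip_dist H (f (\<phi> n (r x))) (f (\<phi> n (r y)))"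
      "ip_dist H (f (\<phi> n (r x))) (f (\<phi> n (r y))) \<le> \<sigma>2 (dX x y)"
      if xy: "x \<in> X" "y \<in> X" "r x < n" "r y < n" for x y n
    proof -
      have Y: "\<phi> n (r x) \<in> Y" "\<phi> n (r y) \<in> Y"
        using \<phi>[OF xy] \<phi>[OF xy(2,1) xy(4,3)] by auto
      let ?d = "dY (\<phi> n (r x)) (\<phi> n (r y))"
      have "\<sigma>1 (dX x y) \<le> \<rho>1 ?d"
        unfolding \<sigma>1_def using \<phi>[OF xy] C dY by (intro \<rho>1_mono) (auto simp: field_simps)
      then show "\<sigma>1 (dX x y) \<le> ip_dist H (f (\<phi> n (r x))) (f (\<phi> n (r y)))"
        using bounds[OF Y] by simp
      have "\<rho>2 ?d \<le> \<sigma>2 (dX x y)"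
        unfolding \<sigma>2_def using \<phi>[OF xy] dY by (intro \<rho>2_mono) auto
      then show "ip_dist H (f (\<phi> n (r x))) (f (\<phi> n (r y))) \<le> \<sigma>2 (dX x y)"
        using bounds[OF Y] by simp
    qed
    \<comment> \<open>The bound must depend on the code alone. Any one element of \<open>X\<close>
      with the code \<open>i\<close> provides it, as \<open>u n i\<close> depends on the code
      only.\<close>
    define B where "B i = (\<sigma>2 (dX (inv_into X r i) x0))\<^sup>2" for i
    have uB: "ip H (u n i) (u n i) \<le> B i" for n i
    proof (cases "i \<in> r ` X \<and> i < n \<and> r x0 < n")
      case True
      define x where "x = inv_into X r i"
      have x: "x \<in> X" "r x = i" using True by (auto simp: x_def inv_into_into f_inv_into_f)
      have c: "f (\<phi> n i) \<in> carrier H" "f (\<phi> n (r x0)) \<in> carrier H"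
        using f\<phi>[OF x(1)] f\<phi>[OF x0] x True by auto
      have "sqrt (ip H (u n i) (u n i)) \<le> \<sigma>2 (dX x x0)"
        using f_bounds(2)[OF x(1) x0, of n] True c x by (simp add: u_def ip_dist_def)
      then show ?thesis
        unfolding B_def x_def[symmetric] by (simp add: sqrt_le_D)
    next
      case False
      then show ?thesis by (auto simp: u_def B_def ip_zero)
    qed
    show ?thesis
    proof (rule bounded_limit[OF uc uB])
      fix g s assume s: "strict_mono s" and g: "\<And>i. g i \<in> carrier H"
      and lim: "\<And>i j. (\<lambda>n. ip_dist H (u (s n) i) (u (s n) j)) \<longlonglongrightarrow> ip_dist H (g i) (g j)"
      show ?thesis
      proof (rule that[of "\<lambda>x. g (r x)"])
        fix x y assume xy: "x \<in> X" "y \<in> X"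
        \<comment> \<open>From the index \<open>N\<close> on, the stage \<open>s n \<ge> n\<close>
          covers the codes of \<open>x\<close>, \<open>y\<close> and the base point.\<close>
        define N where "N = Suc (Max {r x, r y, r x0})"
        have N: "r x < N" "r y < N" "r x0 < N" by (auto simp: N_def less_Suc_eq_le)
        have *: "\<sigma>1 (dX x y) \<le> ip_dist H (u (s n) (r x)) (u (s n) (r y)) \<and>
            ip_dist H (u (s n) (r x)) (u (s n) (r y)) \<le> \<sigma>2 (dX x y)" if "n \<ge> N" for n
        proof -
          have "n \<le> s n" using s by (rule seq_suble)
          then have less: "r x < s n" "r y < s n" "r x0 < s n" using N that by auto
          have "ip_dist H (u (s n) (r x)) (u (s n) (r y)) =
              ip_dist H (f (\<phi> (s n) (r x))) (f (\<phi> (s n) (r y)))"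
            unfolding u_def using less xy f\<phi> x0 by (simp add: ip_dist_translate)
          then show ?thesis using f_bounds[OF xy less(1,2)] by simp
        qed
        show "\<sigma>1 (dX x y) \<le> ip_dist H (g (r x)) (g (r y)) \<and> ip_dist H (g (r x)) (g (r y)) \<le> \<sigma>2 (dX x y)"
          using LIMSEQ_le_const[OF lim] LIMSEQ_le_const2[OF lim] * by blast
      qed (use g in auto)
    qed
  qed
  show ?thesis
    unfolding coarsely_embeds_into_Hilbert_def coarse_embedding_def
    using H F \<sigma>_nonneg \<sigma>1_mono \<sigma>2_mono \<sigma>1_lim FX by blast
qed

section \<open>Optimal permutations\<close>

text \<open>Rado's proof of Hall's marriage theorem: while some \<open>A i\<close> has two elements, one of them can be
  removed without violating the condition.\<close>

lemma hall:
  fixes A :: "'i \<Rightarrow> 'a set"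
  assumes "finite I" "\<And>i. i \<in> I \<Longrightarrow> finite (A i)"
    and "\<And>J. J \<subseteq> I \<Longrightarrow> card J \<le> card (\<Union> (A ` J))"
  shows "\<exists>f. inj_on f I \<and> (\<forall>i\<in>I. f i \<in> A i)"
  using assms(2,3)
proof (induction "\<Sum>i\<in>I. card (A i)" arbitrary: A rule: less_induct)
  case less
  note fin = \<open>finite I\<close> less.prems(1) and hall = less.prems(2)
  show ?case
  proof (cases "\<exists>i\<in>I. 2 \<le> card (A i)")
    case False
    have one: "\<exists>a. A i = {a}" if "i \<in> I" for i
    proof -
      have "card (A i) = 1" using False hall[of "{i}"] that by force
      then show ?thesis by (simp add: card_1_singleton_iff)
    qed
    then obtain f where f: "\<And>i. i \<in> I \<Longrightarrow> A i = {f i}" by metis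
    have "inj_on f I"
    proof (rule inj_onI, rule ccontr)
      fix i j assume ij: "i \<in> I" "j \<in> I" "f i = f j" "i \<noteq> j"
      then show False using hall[of "{i, j}"] f by simp
    qed
    then show ?thesis using f by blast
  next
    case True
    then obtain i where i: "i \<in> I" "2 \<le> card (A i)" by blast
    then obtain x y where xy: "x \<in> A i" "y \<in> A i" "x \<noteq> y"
      by (metis card_le_Suc0_iff_eq fin(2) not_less_eq_eq numeral_2_eq_2)
    show ?thesis
    proof (rule ccontr)
      assume no: "\<not> ?thesis"
      \<comment> \<open>If the condition survived the removal of \<open>z\<close>, the induction
        hypothesis would yield representatives for \<open>A\<close> as well. So some family violates
        it after the removal; this family contains \<open>i\<close>, and \<open>P\<close> is the
        rest of it.\<close>
      have reduce: "\<exists>P \<subseteq> I - {i}. card (\<Union> (A ` P) \<union> (A i - {z})) \<le> card P"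
        if z: "z \<in> A i" for z
      proof (cases "\<forall>J \<subseteq> I. card J \<le> card (\<Union> ((A(i := A i - {z})) ` J))")
        case True
        let ?B = "A(i := A i - {z})"
        have "(\<Sum>k\<in>I. card (?B k)) < (\<Sum>k\<in>I. card (A k))"
        proof (rule sum_strict_mono_ex1[OF fin(1)])
          show "\<forall>k\<in>I. card (?B k) \<le> card (A k)"
            using fin(2) by (simp add: card_Diff_subset card_Diff_singleton_if)
          show "\<exists>k\<in>I. card (?B k) < card (A k)"
            using i(1) card_Diff1_less[OF fin(2)[OF i(1)] z] by (intro bexI[of _ i]) auto
        qed
        then have "\<exists>f. inj_on f I \<and> (\<forall>k\<in>I. f k \<in> ?B k)"
        proof (rule less.hyps)
          show "finite (?B k)" if "k \<in> I" for k using fin(2)[OF that] by (cases "k = i") auto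
          show "card J \<le> card (\<Union> (?B ` J))" if "J \<subseteq> I" for J using True that by blast
        qed
        then obtain f where f: "inj_on f I" "\<And>k. k \<in> I \<Longrightarrow> f k \<in> ?B k" by blast
        have "f k \<in> A k" if "k \<in> I" for k
          using f(2)[OF that] by (cases "k = i") auto
        then have False using f(1) no by blast
        then show ?thesis ..
      next
        case False
        then obtain J where "J \<subseteq> I" "\<not> card J \<le> card (\<Union> ((A(i := A i - {z})) ` J))" by blast
        then have J: "J \<subseteq> I" "card (\<Union> ((A(i := A i - {z})) ` J)) < card J" by (simp_all only: not_le)
        have "i \<in> J"
        proof (rule ccontr)
          assume "i \<notin> J"
          then have "(A(i := A i - {z})) ` J = A ` J" by (intro image_cong) auto
          then show False using hall[OF J(1)] J(2) by simp
        qed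
        have "\<Union> ((A(i := A i - {z})) ` J) = \<Union> (A ` (J - {i})) \<union> (A i - {z})"
          using \<open>i \<in> J\<close> by (auto split: if_splits)
        moreover have "card J = Suc (card (J - {i}))"
          using card.remove[OF finite_subset[OF J(1) fin(1)] \<open>i \<in> J\<close>] .
        ultimately have "card (\<Union> (A ` (J - {i})) \<union> (A i - {z})) \<le> card (J - {i})"
          using J(2) by (simp only: less_Suc_eq_le)
        moreover have "J - {i} \<subseteq> I - {i}" using J(1) by blast
        ultimately show ?thesis by blast
      qed
      obtain P where P: "P \<subseteq> I - {i}" "card (\<Union> (A ` P) \<union> (A i - {x})) \<le> card P"
        using reduce[OF xy(1)] by blast
      obtain Q where Q: "Q \<subseteq> I - {i}" "card (\<Union> (A ` Q) \<union> (A i - {y})) \<le> card Q"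
        using reduce[OF xy(2)] by blast
      let ?U = "\<Union> (A ` P) \<union> (A i - {x})" and ?V = "\<Union> (A ` Q) \<union> (A i - {y})"
      have finPQ: "finite P" "finite Q" using P Q fin(1) by (blast intro: finite_subset)+
      have finUV: "finite ?U" "finite ?V" using finPQ P Q fin(2) i by blast+
      \<comment> \<open>Since \<open>x \<noteq> y\<close>, all of \<open>A i\<close> lies in the
        union of \<open>?U\<close> and \<open>?V\<close>. The condition for
        \<open>insert i (P \<union> Q)\<close> and for \<open>P \<inter> Q\<close> makes the
        cardinalities of \<open>?U\<close> and \<open>?V\<close> add up to more than those of
        \<open>P\<close> and \<open>Q\<close>, against the choice of \<open>P\<close> and
        \<open>Q\<close>.\<close>
      have "card (insert i (P \<union> Q)) \<le> card (\<Union> (A ` insert i (P \<union> Q)))"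
        using P Q i by (intro hall) auto
      also have "\<dots> \<le> card (?U \<union> ?V)" using finUV xy by (intro card_mono) auto
      finally have "Suc (card (P \<union> Q)) \<le> card (?U \<union> ?V)"
        using P Q finPQ by (subst (asm) card_insert_disjoint) auto
      moreover have "card (P \<inter> Q) \<le> card (\<Union> (A ` (P \<inter> Q)))"
        using P by (intro hall) auto
      moreover have "\<dots> \<le> card (?U \<inter> ?V)" using finUV by (intro card_mono) auto
      ultimately show False
        using card_Un_Int[OF finPQ] card_Un_Int[OF finUV] P(2) Q(2) by linarith
    qed
  qed
qed

text \<open>Birkhoff's theorem in the form of an inequality: subtract a multiple of a permutation matrix from
  \<open>m\<close>, and keep the cheaper one of this permutation and of that for the remaining matrix.\<close>

lemma birkhoff:
  fixes m c :: "'i \<Rightarrow> 'i \<Rightarrow> real"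
  assumes "finite I" "\<And>i j. i \<in> I \<Longrightarrow> j \<in> I \<Longrightarrow> 0 \<le> m i j"
    and "\<And>i. i \<in> I \<Longrightarrow> (\<Sum>j\<in>I. m i j) = s" and "\<And>j. j \<in> I \<Longrightarrow> (\<Sum>i\<in>I. m i j) = s"
  shows "\<exists>\<sigma>. bij_betw \<sigma> I I \<and> s * (\<Sum>i\<in>I. c i (\<sigma> i)) \<le> (\<Sum>i\<in>I. \<Sum>j\<in>I. m i j * c i j)"
  using assms(2-4)
proof (induction "card {(i, j). i \<in> I \<and> j \<in> I \<and> 0 < m i j}" arbitrary: m s rule: less_induct)
  case less
  note nonneg = less.prems(1) and row = less.prems(2) and col = less.prems(3)
  have le_s: "m i j \<le> s" if "i \<in> I" "j \<in> I" for i j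
    using row[OF that(1)] member_le_sum[of j I "m i"] nonneg that \<open>finite I\<close> by auto
  show ?case
  proof (cases "s > 0 \<and> I \<noteq> {}")
    case False
    have "m i j = 0" "s = 0" if "i \<in> I" "j \<in> I" for i j
      using le_s[OF that] nonneg[OF that] False that by auto
    then have "(\<Sum>i\<in>I. \<Sum>j\<in>I. m i j * c i j) = 0" "s * (\<Sum>i\<in>I. c i i) = 0" by (auto intro!: sum.neutral)
    then show ?thesis by (intro exI[of _ id]) auto
  next
    case True
    then have s: "0 < s" and "I \<noteq> {}" by auto
    define A where "A i = {j \<in> I. 0 < m i j}" for i
    have "\<exists>f. inj_on f I \<and> (\<forall>i\<in>I. f i \<in> A i)"
    proof (rule hall[OF \<open>finite I\<close>])
      show "finite (A i)" for i using \<open>finite I\<close> by (simp add: A_def)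
      fix J assume J: "J \<subseteq> I"
      let ?N = "\<Union> (A ` J)"
      have N: "?N \<subseteq> I" by (auto simp: A_def)
      \<comment> \<open>Double counting: the mass of the rows in \<open>J\<close> lies entirely in
        the columns of \<open>?N\<close>, which hold \<open>s * card ?N\<close> in total.\<close>
      have "s * card J = (\<Sum>i\<in>J. \<Sum>j\<in>I. m i j)" using J row by (simp add: subset_iff)
      also have "\<dots> = (\<Sum>i\<in>J. \<Sum>j\<in>?N. m i j)"
      proof (rule sum.cong[OF refl])
        fix i assume i: "i \<in> J"
        have "\<forall>j\<in>I - ?N. m i j = 0" using i J nonneg by (force simp: A_def)
        then show "(\<Sum>j\<in>I. m i j) = (\<Sum>j\<in>?N. m i j)"
          by (rule sum.mono_neutral_right[OF \<open>finite I\<close> N])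
      qed
      also have "\<dots> = (\<Sum>j\<in>?N. \<Sum>i\<in>J. m i j)" by (rule sum.swap)
      also have "\<dots> \<le> (\<Sum>j\<in>?N. \<Sum>i\<in>I. m i j)"
        using J N \<open>finite I\<close> nonneg by (intro sum_mono sum_mono2) auto
      also have "\<dots> = s * card ?N" using N col by (simp add: subset_iff)
      finally show "card J \<le> card ?N" using s by simp
    qed
    then obtain f where f: "inj_on f I" "\<And>i. i \<in> I \<Longrightarrow> f i \<in> I" "\<And>i. i \<in> I \<Longrightarrow> 0 < m i (f i)"
      by (auto simp: A_def)
    have bij: "bij_betw f I I"
      using f endo_inj_surj[OF \<open>finite I\<close> _ f(1)] by (auto simp: bij_betw_def)
    \<comment> \<open>The largest multiple of the permutation matrix that can be subtracted without
      negative entries. It annihilates the entry at \<open>k\<close>, so the support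
      shrinks.\<close>
    define t where "t = Min ((\<lambda>i. m i (f i)) ` I)"
    have tin: "t \<in> (\<lambda>i. m i (f i)) ` I"
      unfolding t_def using \<open>finite I\<close> \<open>I \<noteq> {}\<close> by (intro Min_in) auto
    have t_le: "t \<le> m i (f i)" if "i \<in> I" for i
      unfolding t_def using \<open>finite I\<close> that by (intro Min_le) auto
    obtain k where k: "k \<in> I" "m k (f k) = t" using tin by auto
    have t: "0 < t" "t \<le> s" using k f le_s by auto
    define m' where "m' i j = m i j - (if j = f i then t else 0)" for i j
    have row': "(\<Sum>j\<in>I. m' i j) = s - t" if "i \<in> I" for i
      using that row f(2) \<open>finite I\<close> by (simp add: m'_def sum_subtractf)
    have col': "(\<Sum>i\<in>I. m' i j) = s - t" if j: "j \<in> I" for j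
    proof -
      have "j \<in> f ` I" using bij j by (simp add: bij_betw_def)
      then obtain l where l: "l \<in> I" "f l = j" by blast
      have "(\<Sum>i\<in>I. if j = f i then t else 0) = (\<Sum>i\<in>I. if i = l then t else 0)"
        using l f(1) by (intro sum.cong) (auto dest: inj_onD)
      then show ?thesis using j col l \<open>finite I\<close> by (simp add: m'_def sum_subtractf)
    qed
    have "{(i, j). i \<in> I \<and> j \<in> I \<and> 0 < m' i j} \<subset> {(i, j). i \<in> I \<and> j \<in> I \<and> 0 < m i j}"
      (is "?S' \<subset> ?S")
    proof
      show "?S' \<subseteq> ?S" using t by (auto simp: m'_def split: if_splits)
      have "(k, f k) \<in> ?S" "(k, f k) \<notin> ?S'" using k f by (auto simp: m'_def)
      then show "?S' \<noteq> ?S" by blast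
    qed
    moreover have "finite ?S"
      by (rule finite_subset[of _ "I \<times> I"]) (use \<open>finite I\<close> in auto)
    ultimately have card: "card ?S' < card ?S" by (simp only: psubset_card_mono)
    have nonneg': "0 \<le> m' i j" if "i \<in> I" "j \<in> I" for i j
      using nonneg[OF that] t_le[OF that(1)] by (auto simp: m'_def)
    obtain \<sigma> where \<sigma>: "bij_betw \<sigma> I I"
      "(s - t) * (\<Sum>i\<in>I. c i (\<sigma> i)) \<le> (\<Sum>i\<in>I. \<Sum>j\<in>I. m' i j * c i j)"
      using less.hyps[OF card nonneg' row' col'] by blast
    have "(\<Sum>j\<in>I. m' i j * c i j) = (\<Sum>j\<in>I. m i j * c i j) - t * c i (f i)" if "i \<in> I" for i
    proof -
      have "m' i j * c i j = m i j * c i j - (if j = f i then t * c i j else 0)" for j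
        by (simp add: m'_def algebra_simps)
      then show ?thesis using f(2)[OF that] \<open>finite I\<close> by (simp add: sum_subtractf)
    qed
    then have "(\<Sum>i\<in>I. \<Sum>j\<in>I. m' i j * c i j) =
        (\<Sum>i\<in>I. \<Sum>j\<in>I. m i j * c i j) - t * (\<Sum>i\<in>I. c i (f i))"
      by (simp add: sum_subtractf sum_distrib_left)
    with \<sigma> have sum_le: "(s - t) * (\<Sum>i\<in>I. c i (\<sigma> i)) + t * (\<Sum>i\<in>I. c i (f i)) \<le>
        (\<Sum>i\<in>I. \<Sum>j\<in>I. m i j * c i j)" by linarith
    show ?thesis
    proof (cases "(\<Sum>i\<in>I. c i (\<sigma> i)) \<le> (\<Sum>i\<in>I. c i (f i))")
      case True
      then have "t * (\<Sum>i\<in>I. c i (\<sigma> i)) \<le> t * (\<Sum>i\<in>I. c i (f i))" using t by simp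
      then show ?thesis using \<sigma>(1) sum_le by (intro exI[of _ \<sigma>]) (auto simp: algebra_simps)
    next
      case False
      then have "(s - t) * (\<Sum>i\<in>I. c i (f i)) \<le> (s - t) * (\<Sum>i\<in>I. c i (\<sigma> i))"
        using t by (intro mult_left_mono) auto
      then show ?thesis using bij sum_le by (intro exI[of _ f]) (auto simp: algebra_simps)
    qed
  qed
qed

section \<open>Matchings of persistence diagrams\<close>

text \<open>The sum is at most three times its largest term. This crude replacement for Minkowski's
  inequality is the origin of the factor \<open>3 powr p\<close> in all later estimates.\<close>

lemma powr_sum3_le:
  fixes a b c p :: real
  assumes "0 \<le> a" "0 \<le> b" "0 \<le> c" "0 < p"
  shows "(a + b + c) powr p \<le> 3 powr p * (a powr p + b powr p + c powr p)"
proof -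
  define m where "m = max a (max b c)"
  have m: "0 \<le> m" "a + b + c \<le> 3 * m" using assms by (auto simp: m_def)
  have "(a + b + c) powr p \<le> (3 * m) powr p"
    using assms m by (intro powr_mono2) auto
  also have "\<dots> = 3 powr p * m powr p" using m by (simp add: powr_mult)
  also have "m powr p \<le> a powr p + b powr p + c powr p"
    by (auto simp: m_def max_def)
  finally show ?thesis by simp
qed

lemma powr_sum2_le:
  fixes a b p :: real
  assumes "0 \<le> a" "0 \<le> b" "0 < p"
  shows "(a + b) powr p \<le> 3 powr p * (a powr p + b powr p)"
  using powr_sum3_le[of a b 0 p] assms by simp

text \<open>Matching and transport costs are p-th powers of distances and are compared as such.
  Because \<open>1 + b powr p \<le> 2 * (1 + b) powr p\<close>, taking roots turns the constant
  \<open>C\<close> into \<open>(2 * C) powr (1 / p)\<close>.\<close>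

lemma coarsely_embeds_by_finite_approximation_powr:
  fixes X :: "'a set" and Y :: "'b set" and r :: "'a \<Rightarrow> nat" and C p :: real
  assumes Y: "coarsely_embeds_into_Hilbert TYPE('h) Y dY"
    and dX: "\<And>x y. dX x y \<ge> 0" and dY: "\<And>x y. dY x y \<ge> 0" and C: "C > 0" and p: "p > 0"
    and approx: "\<And>n. \<exists>\<phi>. \<forall>x\<in>X. \<forall>y\<in>X. r x < n \<longrightarrow> r y < n \<longrightarrow> \<phi> (r x) \<in> Y \<and>
      dX x y powr p \<le> C * (1 + dY (\<phi> (r x)) (\<phi> (r y)) powr p) \<and>
      dY (\<phi> (r x)) (\<phi> (r y)) powr p \<le> C * (1 + dX x y powr p)"
  shows "coarsely_embeds_into_Hilbert TYPE('h) X dX"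
proof -
  have root: "a \<le> (2 * C) powr (1 / p) * (1 + b)"
    if "0 \<le> a" "0 \<le> b" "a powr p \<le> C * (1 + b powr p)" for a b
  proof -
    have "1 \<le> (1 + b) powr p" "b powr p \<le> (1 + b) powr p"
      using that p by (auto intro!: powr_mono2 ge_one_powr_ge_zero)
    then have "C * (1 + b powr p) \<le> C * (2 * (1 + b) powr p)" using C by (intro mult_left_mono) auto
    then have "a powr p \<le> 2 * C * (1 + b) powr p" using that by simp
    then have "(a powr p) powr (1 / p) \<le> (2 * C * (1 + b) powr p) powr (1 / p)"
      using p by (intro powr_mono2) auto
    then show ?thesis using that C p by (simp add: powr_mult powr_powr)
  qed
  show ?thesis
  proof (rule coarsely_embeds_by_finite_approximation[OF Y dX dY, of "(2 * C) powr (1 / p)" X r])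
    fix n
    obtain \<phi> where \<phi>: "\<forall>x\<in>X. \<forall>y\<in>X. r x < n \<longrightarrow> r y < n \<longrightarrow> \<phi> (r x) \<in> Y \<and>
      dX x y powr p \<le> C * (1 + dY (\<phi> (r x)) (\<phi> (r y)) powr p) \<and>
      dY (\<phi> (r x)) (\<phi> (r y)) powr p \<le> C * (1 + dX x y powr p)"
      using approx[of n] ..
    show "\<exists>\<phi>. \<forall>x\<in>X. \<forall>y\<in>X. r x < n \<longrightarrow> r y < n \<longrightarrow> \<phi> (r x) \<in> Y \<and>
      dX x y \<le> (2 * C) powr (1 / p) * (1 + dY (\<phi> (r x)) (\<phi> (r y))) \<and>
      dY (\<phi> (r x)) (\<phi> (r y)) \<le> (2 * C) powr (1 / p) * (1 + dX x y)"
    proof (intro exI[of _ \<phi>] ballI impI conjI)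
      fix x y assume xy: "x \<in> X" "y \<in> X" "r x < n" "r y < n"
      have *: "\<phi> (r x) \<in> Y \<and>
        dX x y powr p \<le> C * (1 + dY (\<phi> (r x)) (\<phi> (r y)) powr p) \<and>
        dY (\<phi> (r x)) (\<phi> (r y)) powr p \<le> C * (1 + dX x y powr p)"
        using \<phi> xy by blast
      show "\<phi> (r x) \<in> Y" using * by blast
      show "dX x y \<le> (2 * C) powr (1 / p) * (1 + dY (\<phi> (r x)) (\<phi> (r y)))"
        using * by (intro root dX dY) blast
      show "dY (\<phi> (r x)) (\<phi> (r y)) \<le> (2 * C) powr (1 / p) * (1 + dX x y)"
        using * by (intro root dX dY) blast
    qed
  qed (use C in simp)
qed

section \<open>The l-infinity distance and the projection to the diagonal\<close>

lemma linf_dist_nonneg [simp]: "0 \<le> linf_dist x y"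
  and linf_dist_self [simp]: "linf_dist x x = 0"
  and linf_dist_commute: "linf_dist x y = linf_dist y x"
  and linf_dist_triangle: "linf_dist x z \<le> linf_dist x y + linf_dist y z"
  by (auto simp: linf_dist_def)

lemma linf_powr_triangle3:
  assumes "0 < p"
  shows "linf_dist x w powr p \<le>
    3 powr p * (linf_dist x y powr p + linf_dist y z powr p + linf_dist z w powr p)"
proof -
  have "linf_dist x w \<le> linf_dist x y + linf_dist y z + linf_dist z w"
    using linf_dist_triangle[of x w y] linf_dist_triangle[of y w z] by simp
  then have "linf_dist x w powr p \<le> (linf_dist x y + linf_dist y z + linf_dist z w) powr p"
    using assms by (intro powr_mono2) auto
  also have "\<dots> \<le> 3 powr p * (linf_dist x y powr p + linf_dist y z powr p + linf_dist z w powr p)"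
    using assms by (intro powr_sum3_le) auto
  finally show ?thesis .
qed

text \<open>The nearest diagonal point. The projection is 1-Lipschitz for the l-infinity distance,
  so projections of matched points can be matched at no higher cost.\<close>

definition diagonal_proj :: "real \<times> real \<Rightarrow> real \<times> real" where
  "diagonal_proj x = ((fst x + snd x) / 2, (fst x + snd x) / 2)"

lemma dist_diagonal_eq: "dist_diagonal x = \<bar>snd x - fst x\<bar> / 2"
  unfolding dist_diagonal_def
proof (rule cInf_eq_minimum)
  have "linf_dist x (diagonal_proj x) = \<bar>snd x - fst x\<bar> / 2"
    by (auto simp: linf_dist_def diagonal_proj_def field_simps abs_if max_def)
  moreover have "diagonal_proj x \<in> diagonal" unfolding diagonal_def diagonal_proj_def by blast
  ultimately show "\<bar>snd x - fst x\<bar> / 2 \<in> linf_dist x ` diagonal" by (metis imageI)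
  show "\<bar>snd x - fst x\<bar> / 2 \<le> t" if tx: "t \<in> linf_dist x ` diagonal" for t
  proof -
    obtain a where "t = linf_dist x (a, a)" using tx unfolding diagonal_def by blast
    then have t: "t = max \<bar>fst x - a\<bar> \<bar>snd x - a\<bar>" by (simp add: linf_dist_def)
    have "\<bar>fst x - a\<bar> \<le> t" "\<bar>snd x - a\<bar> \<le> t" by (simp_all add: t)
    moreover have "\<bar>snd x - fst x\<bar> \<le> \<bar>snd x - a\<bar> + \<bar>fst x - a\<bar>"
      using abs_triangle_ineq4[of "snd x - a" "fst x - a"] by simp
    ultimately show ?thesis by simp
  qed
qed

lemma linf_diagonal_proj: "linf_dist x (diagonal_proj x) = dist_diagonal x"
  and linf_diagonal_proj_le: "linf_dist (diagonal_proj x) (diagonal_proj y) \<le> linf_dist x y"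
  and dist_diagonal_le: "fst y = snd y \<Longrightarrow> dist_diagonal x \<le> linf_dist x y"
  and dist_diagonal_le_add: "dist_diagonal x \<le> linf_dist x y + dist_diagonal y"
  and dist_diagonal_nonneg [simp]: "0 \<le> dist_diagonal x"
      apply (auto simp: linf_dist_def diagonal_proj_def dist_diagonal_eq field_simps abs_if max_def)
  done

text \<open>Diagrams are indexed by finite sets, and the bijection of a partial matching is then a partial
  injection \<open>g\<close> of the index sets, with domain \<open>A\<close>.\<close>

definition matching :: "'i set \<Rightarrow> 'j set \<Rightarrow> 'i set \<Rightarrow> ('i \<Rightarrow> 'j) \<Rightarrow> bool" where
  "matching I J A g \<longleftrightarrow> A \<subseteq> I \<and> inj_on g A \<and> g ` A \<subseteq> J"

text \<open>The p-th power of \<open>matching_cost\<close>: without the root, costs can be added and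
  compared term by term.\<close>

definition index_cost ::
  "real \<Rightarrow> 'i set \<Rightarrow> 'j set \<Rightarrow> ('i \<Rightarrow> real \<times> real) \<Rightarrow> ('j \<Rightarrow> real \<times> real) \<Rightarrow> 'i set \<Rightarrow> ('i \<Rightarrow> 'j) \<Rightarrow> real"
  where
  "index_cost p I J x y A g = (\<Sum>i\<in>A. linf_dist (x i) (y (g i)) powr p)
     + (\<Sum>i\<in>I - A. dist_diagonal (x i) powr p) + (\<Sum>j\<in>J - g ` A. dist_diagonal (y j) powr p)"

lemma index_cost_nonneg: "0 \<le> index_cost p I J x y A g"
  by (auto simp: index_cost_def intro!: sum_nonneg add_nonneg_nonneg)

lemma matching_realises_index_cost:
  fixes x :: "'i \<Rightarrow> real \<times> real" and y :: "'j \<Rightarrow> real \<times> real"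
  assumes fin: "finite I" "finite J" and g: "matching I J A g"
  defines "D1 \<equiv> image_mset x (mset_set I)" and "D2 \<equiv> image_mset y (mset_set J)"
    and "B1 \<equiv> image_mset x (mset_set A)" and "B2 \<equiv> image_mset y (mset_set (g ` A))"
    and "F \<equiv> image_mset (\<lambda>i. (x i, y (g i))) (mset_set A)"
  shows "partial_matching D1 D2 B1 B2 F"
    and "matching_cost p D1 D2 B1 B2 F = index_cost p I J x y A g powr (1 / p)"
proof -
  have A: "A \<subseteq> I" "inj_on g A" "g ` A \<subseteq> J" using g by (auto simp: matching_def)
  have finA: "finite A" using A fin finite_subset by blast
  have gA: "mset_set (g ` A) = image_mset g (mset_set A)"
    using A by (simp add: image_mset_mset_set)
  have ygA: "image_mset y (mset_set (g ` A)) = image_mset (\<lambda>i. y (g i)) (mset_set A)"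
    by (simp add: gA image_mset.compositionality o_def)
  show "partial_matching D1 D2 B1 B2 F"
    unfolding partial_matching_def D1_def D2_def B1_def B2_def F_def
    using A fin image_mset_subseteq_mono[OF subset_imp_msubset_mset_set[OF A(3) fin(2)], of y]
    by (simp add: ygA image_mset.compositionality o_def subset_imp_msubset_mset_set
        image_mset_subseteq_mono)
  have diff: "image_mset z (mset_set K) - image_mset z (mset_set L) = image_mset z (mset_set (K - L))"
    if "finite K" "L \<subseteq> K" for K L and z :: "'k \<Rightarrow> real \<times> real"
    using that by (simp add: mset_set_Diff image_mset_Diff subset_imp_msubset_mset_set)
  have sum: "(\<Sum>v\<in>#image_mset z (mset_set K). f v) = (\<Sum>k\<in>K. f (z k))" for K f and z :: "'k \<Rightarrow> 'l"
    by (simp add: image_mset.compositionality o_def sum_unfold_sum_mset)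
  show "matching_cost p D1 D2 B1 B2 F = index_cost p I J x y A g powr (1 / p)"
    unfolding matching_cost_def index_cost_def D1_def D2_def B1_def B2_def F_def
      diff[OF fin(1) A(1)] diff[OF fin(2) A(3)] sum by simp
qed

text \<open>Induction on the graph. When a pair \<open>(a, b)\<close> is added, the multiplicities
  of \<open>a\<close> and \<open>b\<close> in the two diagrams leave an index over each that is
  still free; which of the free copies is taken does not matter.\<close>

lemma partial_matching_indexed:
  fixes x :: "'i \<Rightarrow> real \<times> real" and y :: "'j \<Rightarrow> real \<times> real"
  assumes fin: "finite I" "finite J"
    and "image_mset fst F \<subseteq># image_mset x (mset_set I)" "image_mset snd F \<subseteq># image_mset y (mset_set J)"
  shows "\<exists>A g. matching I J A g \<and> F = image_mset (\<lambda>i. (x i, y (g i))) (mset_set A)"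
  using assms(3,4)
proof (induction F)
  case empty
  show ?case by (intro exI[of _ "{}"] exI[of _ undefined]) (simp add: matching_def)
next
  case (add ab F)
  obtain a b where ab: "ab = (a, b)" by (cases ab)
  have sub: "add_mset a (image_mset fst F) \<subseteq># image_mset x (mset_set I)"
    "add_mset b (image_mset snd F) \<subseteq># image_mset y (mset_set J)"
    using add.prems ab by auto
  have "image_mset fst F \<subseteq># image_mset x (mset_set I)" "image_mset snd F \<subseteq># image_mset y (mset_set J)"
    using sub by (auto dest: mset_subset_eq_insertD subset_mset.less_imp_le)
  then obtain A g where g: "matching I J A g"
    and F: "F = image_mset (\<lambda>i. (x i, y (g i))) (mset_set A)" using add.IH by blast
  have A: "A \<subseteq> I" "inj_on g A" "g ` A \<subseteq> J" using g by (auto simp: matching_def)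
  have finA: "finite A" using A fin finite_subset by blast
  have fresh: "\<exists>k\<in>K - L. z k = c"
    if "add_mset c (image_mset z (mset_set L)) \<subseteq># image_mset z (mset_set K)" "finite K" "L \<subseteq> K"
    for c K L and z :: "'k \<Rightarrow> real \<times> real"
  proof -
    have "count (image_mset z (mset_set L)) c < count (image_mset z (mset_set K)) c"
      using mset_subset_eq_count[OF that(1), of c] by (simp only: count_add_mset refl if_True Suc_le_eq)
    then have "c \<in># image_mset z (mset_set K) - image_mset z (mset_set L)"
      by (simp only: in_diff_count)
    also have "image_mset z (mset_set K) - image_mset z (mset_set L) = image_mset z (mset_set (K - L))"
      using that by (simp add: mset_set_Diff image_mset_Diff subset_imp_msubset_mset_set)
    finally show ?thesis using that by auto
  qed
  have "image_mset fst F = image_mset x (mset_set A)"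
    by (simp add: F image_mset.compositionality o_def)
  then obtain i where i: "i \<in> I - A" "x i = a" using fresh[of a x A I] sub(1) fin A by auto
  have "image_mset snd F = image_mset y (mset_set (g ` A))"
    using A by (simp add: F image_mset.compositionality o_def flip: image_mset_mset_set)
  then obtain j where j: "j \<in> J - g ` A" "y j = b" using fresh[of b y "g ` A" J] sub(2) fin A by auto
  have "inj_on (g(i := j)) (insert i A)"
    using i j A(2) by (auto simp: inj_on_def)
  moreover have "g(i := j) ` insert i A \<subseteq> J" using i j A by auto
  ultimately have "matching I J (insert i A) (g(i := j))" using i A by (auto simp: matching_def)
  moreover have "add_mset ab F = image_mset (\<lambda>k. (x k, y ((g(i := j)) k))) (mset_set (insert i A))"
  proof -
    have "image_mset (\<lambda>k. (x k, y ((g(i := j)) k))) (mset_set A) = F"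
      unfolding F using i finA by (intro image_mset_cong) auto
    then show ?thesis using i j finA ab by simp
  qed
  ultimately show ?case by blast
qed

lemma diagram_dist_nonneg: "0 \<le> diagram_dist p D1 D2"
proof -
  have "partial_matching D1 D2 {#} {#} {#}" by (simp add: partial_matching_def)
  then show ?thesis
    unfolding diagram_dist_def by (intro cInf_greatest) (auto simp: matching_cost_def)
qed

lemma diagram_dist_le_index_cost:
  fixes x :: "'i \<Rightarrow> real \<times> real" and y :: "'j \<Rightarrow> real \<times> real"
  assumes "finite I" "finite J" "matching I J A g" "0 < p"
  shows "diagram_dist p (image_mset x (mset_set I)) (image_mset y (mset_set J)) powr p \<le>
    index_cost p I J x y A g"
proof -
  let ?D1 = "image_mset x (mset_set I)" and ?D2 = "image_mset y (mset_set J)"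
  have "diagram_dist p ?D1 ?D2 \<le> index_cost p I J x y A g powr (1 / p)"
    unfolding diagram_dist_def
  proof (rule cInf_lower)
    show "index_cost p I J x y A g powr (1 / p) \<in>
        {matching_cost p ?D1 ?D2 B1 B2 F |B1 B2 F. partial_matching ?D1 ?D2 B1 B2 F}"
      using matching_realises_index_cost(1)[OF assms(1-3), where x = x and y = y]
        matching_realises_index_cost(2)[OF assms(1-3), where x = x and y = y and p = p] by force
    show "bdd_below {matching_cost p ?D1 ?D2 B1 B2 F |B1 B2 F. partial_matching ?D1 ?D2 B1 B2 F}"
      by (intro bdd_belowI[of _ 0]) (auto simp: matching_cost_def)
  qed
  then have "diagram_dist p ?D1 ?D2 powr p \<le> (index_cost p I J x y A g powr (1 / p)) powr p"
    using assms(4) diagram_dist_nonneg by (intro powr_mono2) auto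
  then show ?thesis using assms(4) index_cost_nonneg[of p I J x y A g] by (simp add: powr_powr)
qed

text \<open>Some partial matching comes within \<open>1\<close> of the infimum. The factor
  \<open>3 powr p\<close> arises when the p-th power of \<open>diagram_dist p D1 D2 + 1\<close> is
  split.\<close>

lemma ex_index_cost_le_diagram_dist:
  fixes x :: "'i \<Rightarrow> real \<times> real" and y :: "'j \<Rightarrow> real \<times> real"
  assumes "finite I" "finite J" "0 < p"
  shows "\<exists>A g. matching I J A g \<and> index_cost p I J x y A g \<le> 3 powr p *
    (diagram_dist p (image_mset x (mset_set I)) (image_mset y (mset_set J)) powr p + 1)"
proof -
  let ?D1 = "image_mset x (mset_set I)" and ?D2 = "image_mset y (mset_set J)"
  let ?S = "{matching_cost p ?D1 ?D2 B1 B2 F |B1 B2 F. partial_matching ?D1 ?D2 B1 B2 F}"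
  have "partial_matching ?D1 ?D2 {#} {#} {#}" by (simp add: partial_matching_def)
  then have "?S \<noteq> {}" by blast
  moreover have "Inf ?S < diagram_dist p ?D1 ?D2 + 1" by (simp add: diagram_dist_def)
  ultimately obtain z where "z \<in> ?S" "z < diagram_dist p ?D1 ?D2 + 1" using cInf_lessD by meson
  then obtain B1 B2 F where F: "partial_matching ?D1 ?D2 B1 B2 F"
    and cost: "matching_cost p ?D1 ?D2 B1 B2 F < diagram_dist p ?D1 ?D2 + 1" by blast
  obtain A g where g: "matching I J A g" and Fg: "F = image_mset (\<lambda>i. (x i, y (g i))) (mset_set A)"
    using partial_matching_indexed[OF assms(1,2), of F x y] F by (auto simp: partial_matching_def)
  have B: "B1 = image_mset x (mset_set A)" "B2 = image_mset y (mset_set (g ` A))"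
    using F g by (auto simp: partial_matching_def matching_def Fg image_mset.compositionality o_def
        simp flip: image_mset_mset_set)
  have "index_cost p I J x y A g powr (1 / p) < diagram_dist p ?D1 ?D2 + 1"
    using cost matching_realises_index_cost(2)[OF assms(1,2) g, where x = x and y = y and p = p] by (simp add: B Fg)
  then have "(index_cost p I J x y A g powr (1 / p)) powr p \<le> (diagram_dist p ?D1 ?D2 + 1) powr p"
    using assms(3) by (intro powr_mono2) auto
  then have "index_cost p I J x y A g \<le> (diagram_dist p ?D1 ?D2 + 1) powr p"
    using assms(3) index_cost_nonneg[of p I J x y A g] by (simp add: powr_powr)
  also have "\<dots> \<le> 3 powr p * (diagram_dist p ?D1 ?D2 powr p + 1)"
    using powr_sum2_le[of "diagram_dist p ?D1 ?D2" 1 p] diagram_dist_nonneg assms(3) by simp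
  finally show ?thesis using g by blast
qed

section \<open>Optimal transport between quantized measures\<close>

lemma linf_dist_measurable [measurable]:
  assumes "f \<in> borel_measurable M" "g \<in> borel_measurable M"
  shows "(\<lambda>z. linf_dist (f z) (g z)) \<in> borel_measurable M"
  using assms
  by (rule borel_measurable_continuous_Pair) (unfold linf_dist_def, intro continuous_intros)

text \<open>
  The functions \<open>h i\<close> are the densities of sub-measures of \<open>\<alpha>\<close> of mass \<open>1 / card I\<close> each, and these
  add up to \<open>\<alpha>\<close>. Moving the \<open>i\<close>-th one to the point \<open>x i\<close> gives a transport plan from \<open>\<alpha>\<close> to the uniform
  measure on the points \<open>x i\<close>, of cost at most \<open>e\<close>.
\<close>

definition quantization ::
  "real \<Rightarrow> 'i set \<Rightarrow> (real \<times> real) measure \<Rightarrow> ('i \<Rightarrow> real \<times> real) \<Rightarrow> ('i \<Rightarrow> real \<times> real \<Rightarrow> ennreal) \<Rightarrow>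
    real \<Rightarrow> bool" where
  "quantization p I \<alpha> x h e \<longleftrightarrow>
     finite I \<and> I \<noteq> {} \<and> sets \<alpha> = sets borel \<and> prob_space \<alpha> \<and>
     (\<forall>i\<in>I. h i \<in> borel_measurable borel) \<and> (AE a in \<alpha>. (\<Sum>i\<in>I. h i a) = 1) \<and>
     (\<forall>i\<in>I. (\<integral>\<^sup>+a. h i a \<partial>\<alpha>) = ennreal (1 / card I)) \<and>
     (\<Sum>i\<in>I. \<integral>\<^sup>+a. h i a * ennreal (linf_dist (x i) a powr p) \<partial>\<alpha>) \<le> ennreal e"

text \<open>The extended value has its own name because \<open>enn2real\<close> in
  \<open>wasserstein_dist\<close> sends \<infinity> to \<open>0\<close>: a bound on
  \<open>wasserstein_dist\<close> says something about couplings only once finiteness is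
  known.\<close>

definition transport_cost :: "real \<Rightarrow> (real \<times> real) measure \<Rightarrow> (real \<times> real) measure \<Rightarrow> ennreal" where
  "transport_cost p \<alpha> \<beta> =
     (INF \<gamma>\<in>couplings \<alpha> \<beta>. \<integral>\<^sup>+ z. ennreal (linf_dist (fst z) (snd z) powr p) \<partial>\<gamma>)"

lemma wasserstein_dist_powr:
  "0 < p \<Longrightarrow> wasserstein_dist p \<alpha> \<beta> powr p = enn2real (transport_cost p \<alpha> \<beta>)"
  by (simp add: wasserstein_dist_def transport_cost_def powr_powr)

lemma nn_integral_pair_mult:
  fixes u v :: "real \<times> real \<Rightarrow> ennreal"
  assumes "prob_space \<alpha>" "prob_space \<beta>" "u \<in> borel_measurable \<alpha>" "v \<in> borel_measurable \<beta>"
  shows "(\<integral>\<^sup>+z. u (fst z) * v (snd z) \<partial>(\<alpha> \<Otimes>\<^sub>M \<beta>)) = (\<integral>\<^sup>+a. u a \<partial>\<alpha>) * (\<integral>\<^sup>+b. v b \<partial>\<beta>)"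
proof -
  interpret A: prob_space \<alpha> by fact
  interpret B: prob_space \<beta> by fact
  have "(\<integral>\<^sup>+z. u (fst z) * v (snd z) \<partial>(\<alpha> \<Otimes>\<^sub>M \<beta>)) = (\<integral>\<^sup>+a. \<integral>\<^sup>+b. u a * v b \<partial>\<beta> \<partial>\<alpha>)"
    using assms by (subst B.nn_integral_fst[symmetric]) auto
  also have "\<dots> = (\<integral>\<^sup>+a. u a * (\<integral>\<^sup>+b. v b \<partial>\<beta>) \<partial>\<alpha>)"
    using assms by (simp add: nn_integral_cmult)
  finally show ?thesis using assms by (simp add: nn_integral_multc)
qed

lemma ennreal_linf_powr_triangle3:
  assumes "0 < p"
  shows "ennreal (linf_dist x w powr p) \<le> ennreal (3 powr p) *
    (ennreal (linf_dist x y powr p) + ennreal (linf_dist y z powr p) + ennreal (linf_dist z w powr p))"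
proof -
  have "ennreal (linf_dist x w powr p) \<le> ennreal (3 powr p *
    (linf_dist x y powr p + linf_dist y z powr p + linf_dist z w powr p))"
    by (rule ennreal_leI) (rule linf_powr_triangle3[OF assms])
  then show ?thesis by (simp add: ennreal_mult ennreal_plus)
qed

text \<open>The \<open>i\<close>-th piece of \<open>\<alpha>\<close> is coupled with the piece of
  \<open>\<beta>\<close> numbered \<open>\<sigma> i\<close> by their normalised product. The sum of
  these plans is a coupling, and its cost is estimated along the detour through \<open>x i\<close>
  and \<open>y (\<sigma> i)\<close>.\<close>

lemma transport_cost_le_permutation:
  assumes \<alpha>: "quantization p I \<alpha> x h e" and \<beta>: "quantization p I \<beta> y k e'"
    and \<sigma>: "bij_betw \<sigma> I I" and p: "0 < p" and e: "0 \<le> e" "0 \<le> e'"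
  shows "transport_cost p \<alpha> \<beta> \<le>
    ennreal (3 powr p * (e + e' + (\<Sum>i\<in>I. linf_dist (x i) (y (\<sigma> i)) powr p) / card I))"
proof -
  define N where "N = card I"
  have I: "finite I" "I \<noteq> {}" and N: "0 < N" using \<alpha> by (auto simp: quantization_def N_def card_gt_0_iff)
  have sets [measurable_cong, simp]: "sets \<alpha> = sets borel" "sets \<beta> = sets borel"
    and prob: "prob_space \<alpha>" "prob_space \<beta>" using \<alpha> \<beta> by (auto simp: quantization_def)
  have h [measurable]: "i \<in> I \<Longrightarrow> h i \<in> borel_measurable borel"
    and k [measurable]: "i \<in> I \<Longrightarrow> k i \<in> borel_measurable borel"
    and hsum: "AE a in \<alpha>. (\<Sum>i\<in>I. h i a) = 1" and ksum: "AE a in \<beta>. (\<Sum>i\<in>I. k i a) = 1"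
    and hint: "i \<in> I \<Longrightarrow> (\<integral>\<^sup>+a. h i a \<partial>\<alpha>) = ennreal (1 / N)"
    and kint: "i \<in> I \<Longrightarrow> (\<integral>\<^sup>+a. k i a \<partial>\<beta>) = ennreal (1 / N)"
    and hcost: "(\<Sum>i\<in>I. \<integral>\<^sup>+a. h i a * ennreal (linf_dist (x i) a powr p) \<partial>\<alpha>) \<le> ennreal e"
    and kcost: "(\<Sum>i\<in>I. \<integral>\<^sup>+a. k i a * ennreal (linf_dist (y i) a powr p) \<partial>\<beta>) \<le> ennreal e'" for i
    using \<alpha> \<beta> by (auto simp: quantization_def N_def)
  have \<sigma>I: "i \<in> I \<Longrightarrow> \<sigma> i \<in> I" for i using \<sigma> by (auto simp: bij_betw_def)
  have NN: "ennreal N * ennreal (1 / N) = 1" using N by (simp flip: ennreal_mult)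
  \<comment> \<open>A product of two pieces has mass \<open>1 / N\<close> squared. The factor
    \<open>N\<close> restores the mass \<open>1 / N\<close> and gives the plan the two pieces as
    marginals.\<close>
  define D where "D z = (\<Sum>i\<in>I. ennreal N * (h i (fst z) * k (\<sigma> i) (snd z)))" for z
  define \<gamma> where "\<gamma> = density (\<alpha> \<Otimes>\<^sub>M \<beta>) D"
  have D [measurable]: "D \<in> borel_measurable (\<alpha> \<Otimes>\<^sub>M \<beta>)"
    unfolding D_def using \<sigma>I by measurable
  have sets_pair: "sets (\<alpha> \<Otimes>\<^sub>M \<beta>) = sets (borel :: ((real \<times> real) \<times> (real \<times> real)) measure)"
    using sets_pair_measure_cong[OF sets] by (simp only: borel_prod)
  have sets_\<gamma>: "sets \<gamma> = sets borel" by (simp only: \<gamma>_def sets_density sets_pair)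
  have int_\<gamma>: "(\<integral>\<^sup>+z. w z \<partial>\<gamma>) = (\<Sum>i\<in>I. ennreal N * (\<integral>\<^sup>+z. h i (fst z) * k (\<sigma> i) (snd z) * w z \<partial>(\<alpha> \<Otimes>\<^sub>M \<beta>)))"
    if [measurable]: "w \<in> borel_measurable (\<alpha> \<Otimes>\<^sub>M \<beta>)" for w
  proof -
    have "(\<integral>\<^sup>+z. w z \<partial>\<gamma>) = (\<integral>\<^sup>+z. D z * w z \<partial>(\<alpha> \<Otimes>\<^sub>M \<beta>))"
      unfolding \<gamma>_def by (rule nn_integral_density) measurable
    also have "\<dots> = (\<integral>\<^sup>+z. (\<Sum>i\<in>I. ennreal N * (h i (fst z) * k (\<sigma> i) (snd z) * w z)) \<partial>(\<alpha> \<Otimes>\<^sub>M \<beta>))"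
      by (simp add: D_def sum_distrib_right mult.assoc)
    also have "\<dots> = (\<Sum>i\<in>I. \<integral>\<^sup>+z. ennreal N * (h i (fst z) * k (\<sigma> i) (snd z) * w z) \<partial>(\<alpha> \<Otimes>\<^sub>M \<beta>))"
      using \<sigma>I by (intro nn_integral_sum) measurable
    also have "\<dots> = (\<Sum>i\<in>I. ennreal N * (\<integral>\<^sup>+z. h i (fst z) * k (\<sigma> i) (snd z) * w z \<partial>(\<alpha> \<Otimes>\<^sub>M \<beta>)))"
      using \<sigma>I by (intro sum.cong refl nn_integral_cmult) measurable
    finally show ?thesis .
  qed
  have int_prod: "(\<integral>\<^sup>+z. u (fst z) * v (snd z) \<partial>(\<alpha> \<Otimes>\<^sub>M \<beta>)) = (\<integral>\<^sup>+a. u a \<partial>\<alpha>) * (\<integral>\<^sup>+b. v b \<partial>\<beta>)"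
    if "u \<in> borel_measurable borel" "v \<in> borel_measurable borel" for u v
    using that by (intro nn_integral_pair_mult prob) (simp_all add: measurable_cong_sets[OF sets(1) refl] measurable_cong_sets[OF sets(2) refl])
  have int_fst: "(\<integral>\<^sup>+z. u (fst z) \<partial>\<gamma>) = (\<integral>\<^sup>+a. u a \<partial>\<alpha>)" if [measurable]: "u \<in> borel_measurable borel" for u
  proof -
    have "(\<integral>\<^sup>+z. h i (fst z) * k (\<sigma> i) (snd z) * u (fst z) \<partial>(\<alpha> \<Otimes>\<^sub>M \<beta>)) =
        (\<integral>\<^sup>+a. h i a * u a \<partial>\<alpha>) * ennreal (1 / N)" if i: "i \<in> I" for i
      using int_prod[of "\<lambda>a. h i a * u a" "k (\<sigma> i)"] i \<sigma>I[OF i] kint[OF \<sigma>I[OF i]]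
      by (simp add: mult_ac)
    then have "(\<integral>\<^sup>+z. u (fst z) \<partial>\<gamma>) = (\<Sum>i\<in>I. ennreal N * ((\<integral>\<^sup>+a. h i a * u a \<partial>\<alpha>) * ennreal (1 / N)))"
      by (subst int_\<gamma>) auto
    also have "\<dots> = (\<Sum>i\<in>I. \<integral>\<^sup>+a. h i a * u a \<partial>\<alpha>)"
      by (intro sum.cong refl) (metis NN mult.commute mult.left_commute mult_1)
    also have "\<dots> = (\<integral>\<^sup>+a. (\<Sum>i\<in>I. h i a * u a) \<partial>\<alpha>)" by (rule nn_integral_sum[symmetric]) measurable
    also have "\<dots> = (\<integral>\<^sup>+a. u a \<partial>\<alpha>)"
      using hsum by (intro nn_integral_cong_AE) (auto simp flip: sum_distrib_right)
    finally show ?thesis .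
  qed
  have int_snd: "(\<integral>\<^sup>+z. v (snd z) \<partial>\<gamma>) = (\<integral>\<^sup>+b. v b \<partial>\<beta>)" if [measurable]: "v \<in> borel_measurable borel" for v
  proof -
    have "(\<integral>\<^sup>+z. h i (fst z) * k (\<sigma> i) (snd z) * v (snd z) \<partial>(\<alpha> \<Otimes>\<^sub>M \<beta>)) =
        ennreal (1 / N) * (\<integral>\<^sup>+b. k (\<sigma> i) b * v b \<partial>\<beta>)" if i: "i \<in> I" for i
      using int_prod[of "h i" "\<lambda>b. k (\<sigma> i) b * v b"] i \<sigma>I[OF i] hint[OF i]
      by (simp add: mult_ac)
    then have "(\<integral>\<^sup>+z. v (snd z) \<partial>\<gamma>) = (\<Sum>i\<in>I. ennreal N * (ennreal (1 / N) * (\<integral>\<^sup>+b. k (\<sigma> i) b * v b \<partial>\<beta>)))"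
      by (subst int_\<gamma>) auto
    also have "\<dots> = (\<Sum>i\<in>I. \<integral>\<^sup>+b. k (\<sigma> i) b * v b \<partial>\<beta>)"
      by (intro sum.cong refl) (metis NN mult.assoc mult_1)
    also have "\<dots> = (\<Sum>i\<in>I. \<integral>\<^sup>+b. k i b * v b \<partial>\<beta>)"
      by (rule sum.reindex_bij_betw[OF \<sigma>])
    also have "\<dots> = (\<integral>\<^sup>+b. (\<Sum>i\<in>I. k i b * v b) \<partial>\<beta>)" by (rule nn_integral_sum[symmetric]) measurable
    also have "\<dots> = (\<integral>\<^sup>+b. v b \<partial>\<beta>)"
      using ksum by (intro nn_integral_cong_AE) (auto simp flip: sum_distrib_right)
    finally show ?thesis .
  qed
  have meas_\<gamma>: "fst \<in> measurable \<gamma> borel" "snd \<in> measurable \<gamma> borel"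
    unfolding measurable_cong_sets[OF sets_\<gamma> refl] by (intro borel_measurable_continuous_onI continuous_intros)+
  have "distr \<gamma> borel fst = \<alpha>"
  proof (rule measure_eqI)
    fix B assume "B \<in> sets (distr \<gamma> borel fst)"
    then have B: "B \<in> sets borel" by simp
    then show "emeasure (distr \<gamma> borel fst) B = emeasure \<alpha> B"
      using int_fst[of "indicator B"] nn_integral_distr[OF meas_\<gamma>(1), of "indicator B"] by simp
  qed simp
  moreover have "distr \<gamma> borel snd = \<beta>"
  proof (rule measure_eqI)
    fix B assume "B \<in> sets (distr \<gamma> borel snd)"
    then have B: "B \<in> sets borel" by simp
    then show "emeasure (distr \<gamma> borel snd) B = emeasure \<beta> B"
      using int_snd[of "indicator B"] nn_integral_distr[OF meas_\<gamma>(2), of "indicator B"] by simp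
  qed simp
  moreover have "prob_space \<gamma>"
    using int_fst[of "\<lambda>_. 1"] prob_space.emeasure_space_1[OF prob(1)] by (intro prob_spaceI) simp
  ultimately have \<gamma>: "\<gamma> \<in> couplings \<alpha> \<beta>" using sets_\<gamma> by (simp add: couplings_def)
  let ?c = "\<lambda>a b. ennreal (linf_dist a b powr p)" and ?C = "ennreal (3 powr p)"
  \<comment> \<open>In each of the three terms of the triangle inequality one density integrates to
    \<open>1 / N\<close>, which cancels the factor \<open>N\<close>.\<close>
  have term_le: "ennreal N * (\<integral>\<^sup>+z. h i (fst z) * k (\<sigma> i) (snd z) * ?c (fst z) (snd z) \<partial>(\<alpha> \<Otimes>\<^sub>M \<beta>)) \<le>
      ?C * ((\<integral>\<^sup>+a. h i a * ?c (x i) a \<partial>\<alpha>) + ennreal (1 / N) * ?c (x i) (y (\<sigma> i)) +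
        (\<integral>\<^sup>+b. k (\<sigma> i) b * ?c (y (\<sigma> i)) b \<partial>\<beta>))" if i: "i \<in> I" for i
  proof -
    note [measurable] = h[OF i] k[OF \<sigma>I[OF i]]
    have "(\<integral>\<^sup>+z. h i (fst z) * k (\<sigma> i) (snd z) * ?c (fst z) (snd z) \<partial>(\<alpha> \<Otimes>\<^sub>M \<beta>)) \<le>
      (\<integral>\<^sup>+z. h i (fst z) * k (\<sigma> i) (snd z) * (?C * (?c (x i) (fst z) + ?c (x i) (y (\<sigma> i)) +
        ?c (y (\<sigma> i)) (snd z))) \<partial>(\<alpha> \<Otimes>\<^sub>M \<beta>))"
      using ennreal_linf_powr_triangle3[OF p, of _ _ "x i" "y (\<sigma> i)"]
      by (intro nn_integral_mono mult_left_mono) (auto simp: linf_dist_commute[of _ "x i"])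
    also have "\<dots> = (\<integral>\<^sup>+z. ?C * ((h i (fst z) * ?c (x i) (fst z)) * k (\<sigma> i) (snd z) +
        (?c (x i) (y (\<sigma> i)) * h i (fst z)) * k (\<sigma> i) (snd z) +
        h i (fst z) * (k (\<sigma> i) (snd z) * ?c (y (\<sigma> i)) (snd z))) \<partial>(\<alpha> \<Otimes>\<^sub>M \<beta>))"
      by (intro nn_integral_cong) (simp add: algebra_simps)
    also have "\<dots> = ?C * ((\<integral>\<^sup>+z. (h i (fst z) * ?c (x i) (fst z)) * k (\<sigma> i) (snd z) \<partial>(\<alpha> \<Otimes>\<^sub>M \<beta>)) +
        (\<integral>\<^sup>+z. (?c (x i) (y (\<sigma> i)) * h i (fst z)) * k (\<sigma> i) (snd z) \<partial>(\<alpha> \<Otimes>\<^sub>M \<beta>)) +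
        (\<integral>\<^sup>+z. h i (fst z) * (k (\<sigma> i) (snd z) * ?c (y (\<sigma> i)) (snd z)) \<partial>(\<alpha> \<Otimes>\<^sub>M \<beta>)))"
      by (simp add: nn_integral_cmult nn_integral_add)
    also have "\<dots> = ?C * ((\<integral>\<^sup>+a. h i a * ?c (x i) a \<partial>\<alpha>) * ennreal (1 / N) +
        ?c (x i) (y (\<sigma> i)) * ennreal (1 / N) * ennreal (1 / N) +
        ennreal (1 / N) * (\<integral>\<^sup>+b. k (\<sigma> i) b * ?c (y (\<sigma> i)) b \<partial>\<beta>))"
      using int_prod[of "\<lambda>a. h i a * ?c (x i) a" "k (\<sigma> i)"]
        int_prod[of "\<lambda>a. ?c (x i) (y (\<sigma> i)) * h i a" "k (\<sigma> i)"]
        int_prod[of "h i" "\<lambda>b. k (\<sigma> i) b * ?c (y (\<sigma> i)) b"] hint[OF i] kint[OF \<sigma>I[OF i]]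
      by (simp add: nn_integral_cmult)
    also have "\<dots> = ennreal (1 / N) * (?C * ((\<integral>\<^sup>+a. h i a * ?c (x i) a \<partial>\<alpha>) + ennreal (1 / N) * ?c (x i) (y (\<sigma> i)) +
        (\<integral>\<^sup>+b. k (\<sigma> i) b * ?c (y (\<sigma> i)) b \<partial>\<beta>)))"
      by (simp only: distrib_left mult_ac)
    finally show ?thesis
      by (rule mult_left_mono[of _ _ "ennreal N", THEN order_trans]) (simp_all add: NN flip: mult.assoc)
  qed
  have "transport_cost p \<alpha> \<beta> \<le> (\<integral>\<^sup>+z. ?c (fst z) (snd z) \<partial>\<gamma>)"
    unfolding transport_cost_def by (rule INF_lower[OF \<gamma>])
  also have "\<dots> = (\<Sum>i\<in>I. ennreal N * (\<integral>\<^sup>+z. h i (fst z) * k (\<sigma> i) (snd z) * ?c (fst z) (snd z) \<partial>(\<alpha> \<Otimes>\<^sub>M \<beta>)))"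
    by (rule int_\<gamma>) measurable
  also have "\<dots> \<le> (\<Sum>i\<in>I. ?C * ((\<integral>\<^sup>+a. h i a * ?c (x i) a \<partial>\<alpha>) + ennreal (1 / N) * ?c (x i) (y (\<sigma> i)) +
        (\<integral>\<^sup>+b. k (\<sigma> i) b * ?c (y (\<sigma> i)) b \<partial>\<beta>)))"
    by (intro sum_mono term_le)
  also have "\<dots> = ?C * ((\<Sum>i\<in>I. \<integral>\<^sup>+a. h i a * ?c (x i) a \<partial>\<alpha>) +
      ennreal (1 / N) * (\<Sum>i\<in>I. ?c (x i) (y (\<sigma> i))) + (\<Sum>i\<in>I. \<integral>\<^sup>+b. k i b * ?c (y i) b \<partial>\<beta>))"
    by (simp add: sum.distrib flip: sum_distrib_left sum.reindex_bij_betw[OF \<sigma>, of "\<lambda>i. \<integral>\<^sup>+b. k i b * ?c (y i) b \<partial>\<beta>"])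
  also have "\<dots> \<le> ?C * (ennreal e + ennreal (1 / N) * (\<Sum>i\<in>I. ?c (x i) (y (\<sigma> i))) + ennreal e')"
    using hcost kcost by (intro mult_left_mono add_mono) auto
  finally have le: "transport_cost p \<alpha> \<beta> \<le>
    ?C * (ennreal e + ennreal (1 / N) * (\<Sum>i\<in>I. ?c (x i) (y (\<sigma> i))) + ennreal e')" .
  define S where "S = (\<Sum>i\<in>I. linf_dist (x i) (y (\<sigma> i)) powr p)"
  have S: "0 \<le> S" "(\<Sum>i\<in>I. ?c (x i) (y (\<sigma> i))) = ennreal S"
    by (simp_all add: S_def sum_nonneg sum_ennreal)
  have SN: "ennreal (1 / N) * ennreal S = ennreal (S / N)"
    using ennreal_mult[of "1 / N" S] S(1) by simp
  have "?C * (ennreal e + ennreal (1 / N) * ennreal S + ennreal e') =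
      ennreal (3 powr p * (e + S / N + e'))"
    using e S(1) by (simp add: SN ennreal_plus ennreal_mult)
  also have "3 powr p * (e + S / N + e') = 3 powr p * (e + e' + S / N)" by simp
  finally show ?thesis using le unfolding S(2) by (simp add: S_def N_def)
qed

text \<open>Averaging over two independent probability vectors: the middle term is constant, and
  each outer term sees only its own weights. The semiring is general because the weights are
  extended reals.\<close>

lemma sum_weights_split:
  fixes u v A D :: "'i \<Rightarrow> 'a :: comm_semiring_1" and B C :: 'a
  assumes u: "(\<Sum>i\<in>I. u i) = 1" and v: "(\<Sum>j\<in>I. v j) = 1"
  shows "(\<Sum>i\<in>I. \<Sum>j\<in>I. u i * v j * (C * (A i + B + D j))) =
    C * ((\<Sum>i\<in>I. u i * A i) + B + (\<Sum>j\<in>I. v j * D j))"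
proof -
  define S where "S = (\<Sum>j\<in>I. v j * D j)"
  have "(\<Sum>j\<in>I. u i * v j * (C * (A i + B + D j))) = C * (u i * A i) + u i * (C * (B + S))" for i
  proof -
    have "u i * v j * (C * (A i + B + D j)) = (C * u i * (A i + B)) * v j + (C * u i) * (v j * D j)" for j
      by (simp add: algebra_simps)
    then have "(\<Sum>j\<in>I. u i * v j * (C * (A i + B + D j))) =
        (C * u i * (A i + B)) * (\<Sum>j\<in>I. v j) + (C * u i) * S"
      unfolding S_def sum_distrib_left by (simp only: sum.distrib)
    then show ?thesis by (simp add: v algebra_simps)
  qed
  then have "(\<Sum>i\<in>I. \<Sum>j\<in>I. u i * v j * (C * (A i + B + D j))) =
      C * (\<Sum>i\<in>I. u i * A i) + (\<Sum>i\<in>I. u i) * (C * (B + S))"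
    unfolding sum_distrib_left sum_distrib_right by (simp only: sum.distrib)
  then show ?thesis by (simp add: u S_def algebra_simps)
qed

text \<open>A coupling moves the mass \<open>m i j\<close> from the \<open>i\<close>-th piece of
  \<open>\<alpha>\<close> to the \<open>j\<close>-th piece of \<open>\<beta>\<close>. All row and
  column sums are \<open>1 / N\<close>, so \<open>birkhoff\<close> extracts a permutation that costs
  no more than the matrix. The coupling is chosen within \<open>1\<close> of the infimum, which
  explains the last summand of the bound.\<close>

lemma permutation_le_transport_cost:
  assumes \<alpha>: "quantization p I \<alpha> x h e" and \<beta>: "quantization p I \<beta> y k e'"
    and p: "0 < p" and e: "0 \<le> e" "0 \<le> e'" and finite: "transport_cost p \<alpha> \<beta> < \<infinity>"
  shows "\<exists>\<sigma>. bij_betw \<sigma> I I \<and> (\<Sum>i\<in>I. linf_dist (x i) (y (\<sigma> i)) powr p) / card I \<le>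
    3 powr p * (e + e' + enn2real (transport_cost p \<alpha> \<beta>) + 1)"
proof -
  define N where "N = card I"
  have I: "finite I" "I \<noteq> {}" and N: "0 < N" using \<alpha> by (auto simp: quantization_def N_def card_gt_0_iff)
  have sets: "sets \<alpha> = sets borel" "sets \<beta> = sets borel"
    using \<alpha> \<beta> by (auto simp: quantization_def)
  have h [measurable]: "i \<in> I \<Longrightarrow> h i \<in> borel_measurable borel"
    and k [measurable]: "i \<in> I \<Longrightarrow> k i \<in> borel_measurable borel"
    and hsum: "AE a in \<alpha>. (\<Sum>i\<in>I. h i a) = 1" and ksum: "AE a in \<beta>. (\<Sum>i\<in>I. k i a) = 1"
    and hint: "i \<in> I \<Longrightarrow> (\<integral>\<^sup>+a. h i a \<partial>\<alpha>) = ennreal (1 / N)"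
    and kint: "i \<in> I \<Longrightarrow> (\<integral>\<^sup>+a. k i a \<partial>\<beta>) = ennreal (1 / N)"
    and hcost: "(\<Sum>i\<in>I. \<integral>\<^sup>+a. h i a * ennreal (linf_dist (x i) a powr p) \<partial>\<alpha>) \<le> ennreal e"
    and kcost: "(\<Sum>i\<in>I. \<integral>\<^sup>+a. k i a * ennreal (linf_dist (y i) a powr p) \<partial>\<beta>) \<le> ennreal e'" for i
    using \<alpha> \<beta> by (auto simp: quantization_def N_def)
  let ?c = "\<lambda>a b. ennreal (linf_dist a b powr p)" and ?C = "ennreal (3 powr p)"
  define T where "T = enn2real (transport_cost p \<alpha> \<beta>)"
  have T: "0 \<le> T" "transport_cost p \<alpha> \<beta> = ennreal T" using finite by (auto simp: T_def)
  have "transport_cost p \<alpha> \<beta> < ennreal (T + 1)" using T by (simp add: ennreal_less_iff)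
  then obtain \<gamma> where \<gamma>: "\<gamma> \<in> couplings \<alpha> \<beta>"
    and cost_\<gamma>: "(\<integral>\<^sup>+z. ?c (fst z) (snd z) \<partial>\<gamma>) < ennreal (T + 1)"
    unfolding transport_cost_def INF_less_iff by blast
  have sets_\<gamma> [measurable_cong]: "sets \<gamma> = sets borel" and marginals: "distr \<gamma> borel fst = \<alpha>" "distr \<gamma> borel snd = \<beta>"
    using \<gamma> by (auto simp: couplings_def)
  have meas_\<gamma> [measurable]: "fst \<in> measurable \<gamma> borel" "snd \<in> measurable \<gamma> borel"
    unfolding measurable_cong_sets[OF sets_\<gamma> refl] by (intro borel_measurable_continuous_onI continuous_intros)+
  have int_fst: "(\<integral>\<^sup>+z. u (fst z) \<partial>\<gamma>) = (\<integral>\<^sup>+a. u a \<partial>\<alpha>)"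
    and int_snd: "(\<integral>\<^sup>+z. u (snd z) \<partial>\<gamma>) = (\<integral>\<^sup>+a. u a \<partial>\<beta>)" if "u \<in> borel_measurable borel" for u
    using nn_integral_distr[OF meas_\<gamma>(1), of u] nn_integral_distr[OF meas_\<gamma>(2), of u] that
    unfolding marginals measurable_cong_sets[OF sets(1) refl] measurable_cong_sets[OF sets(2) refl]
    by simp_all
  have hsum_\<gamma>: "AE z in \<gamma>. (\<Sum>i\<in>I. h i (fst z)) = 1"
    using hsum unfolding marginals(1)[symmetric] by (rule AE_distrD[OF meas_\<gamma>(1)])
  have ksum_\<gamma>: "AE z in \<gamma>. (\<Sum>j\<in>I. k j (snd z)) = 1"
    using ksum unfolding marginals(2)[symmetric] by (rule AE_distrD[OF meas_\<gamma>(2)])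
  define m where "m i j = (\<integral>\<^sup>+z. h i (fst z) * k j (snd z) \<partial>\<gamma>)" for i j
  have row: "(\<Sum>j\<in>I. m i j) = ennreal (1 / N)" if i: "i \<in> I" for i
  proof -
    note [measurable] = h[OF i]
    have "(\<Sum>j\<in>I. m i j) = (\<integral>\<^sup>+z. (\<Sum>j\<in>I. h i (fst z) * k j (snd z)) \<partial>\<gamma>)"
      unfolding m_def by (rule nn_integral_sum[symmetric]) measurable
    also have "\<dots> = (\<integral>\<^sup>+z. h i (fst z) \<partial>\<gamma>)"
      using ksum_\<gamma> by (intro nn_integral_cong_AE) (auto simp flip: sum_distrib_left)
    also have "\<dots> = ennreal (1 / N)" using int_fst[OF h[OF i]] hint[OF i] by simp
    finally show ?thesis .
  qed
  have col: "(\<Sum>i\<in>I. m i j) = ennreal (1 / N)" if j: "j \<in> I" for j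
  proof -
    note [measurable] = k[OF j]
    have "(\<Sum>i\<in>I. m i j) = (\<integral>\<^sup>+z. (\<Sum>i\<in>I. h i (fst z) * k j (snd z)) \<partial>\<gamma>)"
      unfolding m_def by (rule nn_integral_sum[symmetric]) measurable
    also have "\<dots> = (\<integral>\<^sup>+z. k j (snd z) \<partial>\<gamma>)"
      using hsum_\<gamma> by (intro nn_integral_cong_AE) (auto simp flip: sum_distrib_right)
    also have "\<dots> = ennreal (1 / N)" using int_snd[OF k[OF j]] kint[OF j] by simp
    finally show ?thesis .
  qed
  define r where "r i j = enn2real (m i j)" for i j
  have m_r: "m i j = ennreal (r i j)" if ij: "i \<in> I" "j \<in> I" for i j
  proof -
    have "m i j \<le> (\<Sum>j\<in>I. m i j)" using ij I by (intro member_le_sum) auto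
    then have "m i j < \<infinity>" using row[OF ij(1)] by (auto intro: le_less_trans)
    then show ?thesis by (simp add: r_def)
  qed
  have r_nonneg: "0 \<le> r i j" for i j by (simp add: r_def)
  have row_r: "(\<Sum>j\<in>I. r i j) = 1 / N" if i: "i \<in> I" for i
  proof -
    have "ennreal (\<Sum>j\<in>I. r i j) = (\<Sum>j\<in>I. ennreal (r i j))"
      by (rule sum_ennreal[symmetric]) (rule r_nonneg)
    also have "\<dots> = (\<Sum>j\<in>I. m i j)" using m_r[OF i] by (intro sum.cong) auto
    also have "\<dots> = ennreal (1 / N)" by (rule row[OF i])
    finally show ?thesis by (rule ennreal_inj[THEN iffD1, rotated 2]) (auto intro: sum_nonneg r_nonneg)
  qed
  have col_r: "(\<Sum>i\<in>I. r i j) = 1 / N" if j: "j \<in> I" for j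
  proof -
    have "ennreal (\<Sum>i\<in>I. r i j) = (\<Sum>i\<in>I. ennreal (r i j))"
      by (rule sum_ennreal[symmetric]) (rule r_nonneg)
    also have "\<dots> = (\<Sum>i\<in>I. m i j)" using m_r[OF _ j] by (intro sum.cong) auto
    also have "\<dots> = ennreal (1 / N)" by (rule col[OF j])
    finally show ?thesis by (rule ennreal_inj[THEN iffD1, rotated 2]) (auto intro: sum_nonneg r_nonneg)
  qed
  obtain \<sigma> where \<sigma>: "bij_betw \<sigma> I I"
    "1 / N * (\<Sum>i\<in>I. linf_dist (x i) (y (\<sigma> i)) powr p) \<le> (\<Sum>i\<in>I. \<Sum>j\<in>I. r i j * linf_dist (x i) (y j) powr p)"
    using birkhoff[of I r "1 / N" "\<lambda>i j. linf_dist (x i) (y j) powr p", OF I(1) r_nonneg row_r col_r] by blast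
  define f1 where "f1 z = (\<Sum>i\<in>I. h i (fst z) * ?c (x i) (fst z))" for z :: "(real \<times> real) \<times> (real \<times> real)"
  define f2 where "f2 z = ?c (fst z) (snd z)" for z
  define f3 where "f3 z = (\<Sum>j\<in>I. k j (snd z) * ?c (y j) (snd z))" for z :: "(real \<times> real) \<times> (real \<times> real)"
  define f where "f z = (\<Sum>i\<in>I. \<Sum>j\<in>I. h i (fst z) * k j (snd z) * ?c (x i) (y j))" for z
  have f_meas: "f1 \<in> borel_measurable \<gamma>" "f2 \<in> borel_measurable \<gamma>" "f3 \<in> borel_measurable \<gamma>"
    unfolding f1_def f2_def f3_def by measurable
  \<comment> \<open>At a fixed \<open>z\<close> the numbers \<open>h i (fst z)\<close> and
    \<open>k j (snd z)\<close> are probability weights, and \<open>x i\<close> is joined to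
    \<open>y j\<close> through \<open>fst z\<close> and \<open>snd z\<close>.\<close>
  have f_le: "f z \<le> ?C * (f1 z + f2 z + f3 z)"
    if hz: "(\<Sum>i\<in>I. h i (fst z)) = 1" and kz: "(\<Sum>j\<in>I. k j (snd z)) = 1" for z
  proof -
    have c_le: "?c (x i) (y j) \<le> ?C * (?c (x i) (fst z) + f2 z + ?c (y j) (snd z))" for i j
      using ennreal_linf_powr_triangle3[OF p, of "x i" "y j" "fst z" "snd z"]
      by (simp only: f2_def linf_dist_commute[of "snd z" "y j"])
    have "f z \<le> (\<Sum>i\<in>I. \<Sum>j\<in>I. h i (fst z) * k j (snd z) *
        (?C * (?c (x i) (fst z) + f2 z + ?c (y j) (snd z))))"
      unfolding f_def by (intro sum_mono mult_left_mono c_le) simp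
    then show ?thesis
      unfolding sum_weights_split[OF hz kz] f1_def f3_def .
  qed
  have int_f: "(\<integral>\<^sup>+z. f z \<partial>\<gamma>) = ennreal (\<Sum>i\<in>I. \<Sum>j\<in>I. r i j * linf_dist (x i) (y j) powr p)"
  proof -
    have "ennreal (\<Sum>i\<in>I. \<Sum>j\<in>I. r i j * linf_dist (x i) (y j) powr p) =
        (\<Sum>i\<in>I. ennreal (\<Sum>j\<in>I. r i j * linf_dist (x i) (y j) powr p))"
      by (rule sum_ennreal[symmetric]) (simp add: sum_nonneg r_nonneg)
    also have "\<dots> = (\<Sum>i\<in>I. \<Sum>j\<in>I. ennreal (r i j * linf_dist (x i) (y j) powr p))"
      by (intro sum.cong refl sum_ennreal[symmetric]) (simp add: r_nonneg)
    also have "\<dots> = (\<Sum>i\<in>I. \<Sum>j\<in>I. m i j * ?c (x i) (y j))"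
      by (intro sum.cong refl) (simp add: m_r ennreal_mult r_nonneg)
    also have "\<dots> = (\<Sum>i\<in>I. \<Sum>j\<in>I. \<integral>\<^sup>+z. h i (fst z) * k j (snd z) * ?c (x i) (y j) \<partial>\<gamma>)"
      unfolding m_def by (intro sum.cong refl nn_integral_multc[symmetric]) measurable
    also have "\<dots> = (\<Sum>i\<in>I. \<integral>\<^sup>+z. (\<Sum>j\<in>I. h i (fst z) * k j (snd z) * ?c (x i) (y j)) \<partial>\<gamma>)"
      by (intro sum.cong refl nn_integral_sum[symmetric]) measurable
    also have "\<dots> = (\<integral>\<^sup>+z. f z \<partial>\<gamma>)"
      unfolding f_def by (intro nn_integral_sum[symmetric]) measurable
    finally show ?thesis by (rule sym)
  qed
  have int_f_le: "(\<integral>\<^sup>+z. f z \<partial>\<gamma>) \<le> (\<integral>\<^sup>+z. ?C * (f1 z + f2 z + f3 z) \<partial>\<gamma>)"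
  proof (rule nn_integral_mono_AE)
    show "AE z in \<gamma>. f z \<le> ?C * (f1 z + f2 z + f3 z)"
      using hsum_\<gamma> ksum_\<gamma> by eventually_elim (rule f_le)
  qed
  have int_sum: "(\<integral>\<^sup>+z. ?C * (f1 z + f2 z + f3 z) \<partial>\<gamma>) =
      ?C * ((\<integral>\<^sup>+z. f1 z \<partial>\<gamma>) + (\<integral>\<^sup>+z. f2 z \<partial>\<gamma>) + (\<integral>\<^sup>+z. f3 z \<partial>\<gamma>))"
    using f_meas by (simp add: nn_integral_cmult nn_integral_add)
  have hc: "(\<lambda>a. h i a * ?c (x i) a) \<in> borel_measurable borel"
    and kc: "(\<lambda>a. k i a * ?c (y i) a) \<in> borel_measurable borel" if "i \<in> I" for i
    using h[OF that] k[OF that] by measurable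
  have "(\<integral>\<^sup>+z. f1 z \<partial>\<gamma>) = (\<integral>\<^sup>+a. (\<Sum>i\<in>I. h i a * ?c (x i) a) \<partial>\<alpha>)"
    unfolding f1_def by (rule int_fst) (rule borel_measurable_sum[OF hc])
  also have "\<dots> = (\<Sum>i\<in>I. \<integral>\<^sup>+a. h i a * ?c (x i) a \<partial>\<alpha>)"
    using hc by (intro nn_integral_sum) (simp add: measurable_cong_sets[OF sets(1) refl])
  finally have f1: "(\<integral>\<^sup>+z. f1 z \<partial>\<gamma>) \<le> ennreal e" using hcost by simp
  have "(\<integral>\<^sup>+z. f3 z \<partial>\<gamma>) = (\<integral>\<^sup>+a. (\<Sum>i\<in>I. k i a * ?c (y i) a) \<partial>\<beta>)"
    unfolding f3_def by (rule int_snd) (rule borel_measurable_sum[OF kc])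
  also have "\<dots> = (\<Sum>i\<in>I. \<integral>\<^sup>+a. k i a * ?c (y i) a \<partial>\<beta>)"
    using kc by (intro nn_integral_sum) (simp add: measurable_cong_sets[OF sets(2) refl])
  finally have f3: "(\<integral>\<^sup>+z. f3 z \<partial>\<gamma>) \<le> ennreal e'" using kcost by simp
  have f2: "(\<integral>\<^sup>+z. f2 z \<partial>\<gamma>) \<le> ennreal (T + 1)"
    unfolding f2_def using cost_\<gamma> by (rule less_imp_le)
  have "?C * ((\<integral>\<^sup>+z. f1 z \<partial>\<gamma>) + (\<integral>\<^sup>+z. f2 z \<partial>\<gamma>) + (\<integral>\<^sup>+z. f3 z \<partial>\<gamma>)) \<le>
      ?C * (ennreal e + ennreal (T + 1) + ennreal e')"
    by (intro mult_left_mono add_mono f1 f2 f3) simp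
  also have "\<dots> = ennreal (3 powr p * (e + (T + 1) + e'))"
    using e T(1) by (simp add: ennreal_plus ennreal_mult del: ennreal_1)
  finally have "ennreal (\<Sum>i\<in>I. \<Sum>j\<in>I. r i j * linf_dist (x i) (y j) powr p) \<le>
      ennreal (3 powr p * (e + (T + 1) + e'))"
    using int_f int_f_le int_sum by simp
  moreover have "0 \<le> 3 powr p * (e + (T + 1) + e')" using e T(1) by simp
  ultimately have "(\<Sum>i\<in>I. \<Sum>j\<in>I. r i j * linf_dist (x i) (y j) powr p) \<le> 3 powr p * (e + (T + 1) + e')"
    by (simp only: ennreal_le_iff)
  then show ?thesis
    using \<sigma> by (intro exI[of _ \<sigma>]) (simp add: N_def T_def add_ac)
qed

section \<open>Refining and building quantizations\<close>

lemma sum_mod_lessThan: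
  fixes f :: "nat \<Rightarrow> 'a :: comm_semiring_1"
  shows "(\<Sum>i<n * K. f (i mod n)) = of_nat K * (\<Sum>i<n. f i)"
proof (induction K)
  case (Suc K)
  have "{..<n * Suc K} = {..<n * K} \<union> (\<lambda>i. n * K + i) ` {..<n}"
    using image_add_atLeastLessThan[of "n * K" 0 n] by (auto simp: lessThan_atLeast0 add.commute)
  then have "(\<Sum>i<n * Suc K. f (i mod n)) =
      (\<Sum>i<n * K. f (i mod n)) + (\<Sum>i\<in>(\<lambda>i. n * K + i) ` {..<n}. f (i mod n))"
    by (simp only:) (rule sum.union_disjoint, auto)
  also have "(\<Sum>i\<in>(\<lambda>i. n * K + i) ` {..<n}. f (i mod n)) = (\<Sum>i<n. f i)"
    by (subst sum.reindex) (auto intro!: sum.cong)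
  finally show ?case using Suc by (simp add: algebra_simps)
qed simp

text \<open>The points are repeated cyclically and every density is split into \<open>K\<close>
  equal parts, which leaves the cost as it was. This brings measures with representing lists of
  different lengths to a common number of points.\<close>

lemma quantization_replicate:
  fixes n K :: nat
  assumes q: "quantization p {..<n} \<alpha> x h e" and K: "0 < K"
  shows "quantization p {..<n * K} \<alpha> (\<lambda>i. x (i mod n)) (\<lambda>i a. ennreal (1 / K) * h (i mod n) a) e"
proof -
  have "{..<n} \<noteq> {}" using q by (simp only: quantization_def simp_thms)
  then have n: "0 < n" by (cases n) auto
  have lt: "i mod n < n" for i using n by simp
  have h: "h (i mod n) \<in> borel_measurable borel" "h (i mod n) \<in> borel_measurable \<alpha>" for i
    using q lt by (auto simp: quantization_def measurable_cong_sets[of \<alpha> borel])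
  have KK: "of_nat K * (ennreal (1 / K) * y) = y" for y
  proof -
    have "of_nat K * ennreal (1 / K) = ennreal (real K * (1 / real K))"
      by (simp only: ennreal_of_nat_eq_real_of_nat) (rule ennreal_mult[symmetric], simp_all)
    then show ?thesis using K by (simp flip: mult.assoc)
  qed
  have "(\<Sum>i<n * K. ennreal (1 / K) * h (i mod n) a) = (\<Sum>i<n. h i a)" for a
    using sum_mod_lessThan[of "\<lambda>i. ennreal (1 / K) * h i a" n K] by (simp add: KK flip: sum_distrib_left)
  moreover have "(\<integral>\<^sup>+a. ennreal (1 / K) * h (i mod n) a \<partial>\<alpha>) = ennreal (1 / card {..<n * K})" for i
  proof -
    have "(\<integral>\<^sup>+a. ennreal (1 / K) * h (i mod n) a \<partial>\<alpha>) = ennreal (1 / K) * ennreal (1 / n)"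
      using q lt[of i] h by (simp add: nn_integral_cmult quantization_def)
    then show ?thesis by (simp add: mult.commute flip: ennreal_mult)
  qed
  moreover have "(\<Sum>i<n * K. \<integral>\<^sup>+a. ennreal (1 / K) * h (i mod n) a * ennreal (linf_dist (x (i mod n)) a powr p) \<partial>\<alpha>) =
      (\<Sum>i<n. \<integral>\<^sup>+a. h i a * ennreal (linf_dist (x i) a powr p) \<partial>\<alpha>)"
  proof -
    have "(\<integral>\<^sup>+a. ennreal (1 / K) * h (i mod n) a * ennreal (linf_dist (x (i mod n)) a powr p) \<partial>\<alpha>) =
        ennreal (1 / K) * (\<integral>\<^sup>+a. h (i mod n) a * ennreal (linf_dist (x (i mod n)) a powr p) \<partial>\<alpha>)" for i
    proof -
      have "(\<lambda>a. h (i mod n) a * ennreal (linf_dist (x (i mod n)) a powr p)) \<in> borel_measurable borel"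
        using h(1)[of i] by measurable
      then have "(\<lambda>a. h (i mod n) a * ennreal (linf_dist (x (i mod n)) a powr p)) \<in> borel_measurable \<alpha>"
        using q by (simp add: quantization_def measurable_cong_sets[of \<alpha> borel])
      from nn_integral_cmult[OF this] show ?thesis by (simp add: mult.assoc)
    qed
    then show ?thesis
      using sum_mod_lessThan[of "\<lambda>i. ennreal (1 / K) * (\<integral>\<^sup>+a. h i a * ennreal (linf_dist (x i) a powr p) \<partial>\<alpha>)" n K]
      by (simp add: KK flip: sum_distrib_left)
  qed
  moreover have "0 \<in> {..<n * K}" using n K by simp
  then have "{..<n * K} \<noteq> {}" by blast
  moreover have "(\<lambda>a. ennreal (1 / K) * h (i mod n) a) \<in> borel_measurable borel" for i
    using h(1)[of i] by measurable
  ultimately show ?thesis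
    using q n K unfolding quantization_def by simp
qed

lemma quantization_reindex:
  assumes q: "quantization p I \<alpha> x h e" and f: "bij_betw f J I"
  shows "quantization p J \<alpha> (x \<circ> f) (h \<circ> f) e"
proof -
  have "finite J" "J \<noteq> {}" "card J = card I" "\<And>j. j \<in> J \<Longrightarrow> f j \<in> I"
    using q f bij_betw_finite[OF f] bij_betw_same_card[OF f] bij_betwE[OF f]
    by (auto simp: quantization_def)
  then show ?thesis
    using q sum.reindex_bij_betw[OF f, of "\<lambda>i. h i _"]
      sum.reindex_bij_betw[OF f, of "\<lambda>i. \<integral>\<^sup>+a. h i a * ennreal (linf_dist (x i) a powr p) \<partial>\<alpha>"]
    by (simp add: quantization_def)
qed

text \<open>A partition of unity whose masses are multiples of \<open>1 / N\<close> yields pieces of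
  mass \<open>1 / N\<close> once \<open>w c\<close> is split into \<open>n c\<close> equal parts. A
  weight with \<open>n c = 0\<close> gets no piece at all; it vanishes almost everywhere, so the
  densities still add up to \<open>1\<close> almost everywhere.\<close>

lemma quantization_of_weights:
  fixes w :: "'c \<Rightarrow> real \<times> real \<Rightarrow> ennreal" and n :: "'c \<Rightarrow> nat"
  assumes C: "finite C" and N: "0 < N" and \<alpha>: "sets \<alpha> = sets borel" "prob_space \<alpha>"
    and w: "\<And>c. c \<in> C \<Longrightarrow> w c \<in> borel_measurable borel" and wsum: "\<And>a. (\<Sum>c\<in>C. w c a) = 1"
    and wint: "\<And>c. c \<in> C \<Longrightarrow> (\<integral>\<^sup>+a. w c a \<partial>\<alpha>) = ennreal (n c / N)" and nN: "(\<Sum>c\<in>C. n c) = N"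
    and cost: "(\<Sum>c\<in>C. \<integral>\<^sup>+a. w c a * ennreal (linf_dist (z c) a powr p) \<partial>\<alpha>) \<le> ennreal e"
  shows "quantization p (SIGMA c:C. {..<n c}) \<alpha> (\<lambda>i. z (fst i))
    (\<lambda>i a. ennreal (1 / n (fst i)) * w (fst i) a) e"
proof -
  let ?I = "SIGMA c:C. {..<n c}"
  have I: "finite ?I" "card ?I = N" using C nN by auto
  then have "?I \<noteq> {}" using N by force
  have sumI: "(\<Sum>i\<in>?I. g (fst i)) = (\<Sum>c\<in>C. of_nat (n c) * g c)" for g :: "'c \<Rightarrow> ennreal"
    using C by (subst sum.Sigma[symmetric, of C "\<lambda>c. {..<n c}" "\<lambda>c j. g c", simplified split_def]) auto
  have cancel: "of_nat k * (ennreal (1 / k) * v) = (if k = 0 then 0 else v)" for k :: nat and v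
  proof (cases "k = 0")
    case False
    have "of_nat k * ennreal (1 / k) = ennreal (real k * (1 / real k))"
      by (simp only: ennreal_of_nat_eq_real_of_nat) (rule ennreal_mult[symmetric], simp_all)
    then show ?thesis using False by (simp flip: mult.assoc)
  qed simp
  have w': "w c \<in> borel_measurable \<alpha>" if "c \<in> C" for c
    using w[OF that] by (simp add: measurable_cong_sets[OF \<alpha>(1) refl])
  have "AE a in \<alpha>. w c a = 0" if "c \<in> C" "n c = 0" for c
    using wint[OF that(1)] that(2) nn_integral_0_iff_AE[OF w'[OF that(1)]] by simp
  then have "AE a in \<alpha>. \<forall>c\<in>{c \<in> C. n c = 0}. w c a = 0"
    using C by (intro AE_finite_allI) auto
  then have AE: "AE a in \<alpha>. (\<Sum>i\<in>?I. ennreal (1 / n (fst i)) * w (fst i) a) = 1"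
  proof eventually_elim
    case (elim a)
    have "(\<Sum>i\<in>?I. ennreal (1 / n (fst i)) * w (fst i) a) = (\<Sum>c\<in>C. w c a)"
      unfolding sumI[of "\<lambda>c. ennreal (1 / n c) * w c a"] cancel using elim by (intro sum.cong) auto
    then show ?case by (simp add: wsum)
  qed
  have int: "(\<integral>\<^sup>+a. ennreal (1 / n (fst i)) * w (fst i) a \<partial>\<alpha>) = ennreal (1 / card ?I)" if i: "i \<in> ?I" for i
  proof -
    have c: "fst i \<in> C" "0 < n (fst i)" using i by auto
    have "(\<integral>\<^sup>+a. ennreal (1 / n (fst i)) * w (fst i) a \<partial>\<alpha>) = ennreal (1 / n (fst i)) * ennreal (n (fst i) / N)"
      using w'[OF c(1)] wint[OF c(1)] by (simp add: nn_integral_cmult)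
    then show ?thesis using c(2) by (simp add: I(2) flip: ennreal_mult)
  qed
  have wc: "(\<lambda>a. w c a * ennreal (linf_dist (z c) a powr p)) \<in> borel_measurable \<alpha>" if "c \<in> C" for c
  proof -
    have "(\<lambda>a. w c a * ennreal (linf_dist (z c) a powr p)) \<in> borel_measurable borel"
      using w[OF that] by measurable
    then show ?thesis by (simp add: measurable_cong_sets[OF \<alpha>(1) refl])
  qed
  let ?J = "\<lambda>c. \<integral>\<^sup>+a. w c a * ennreal (linf_dist (z c) a powr p) \<partial>\<alpha>"
  have "(\<Sum>i\<in>?I. \<integral>\<^sup>+a. ennreal (1 / n (fst i)) * w (fst i) a * ennreal (linf_dist (z (fst i)) a powr p) \<partial>\<alpha>) =
      (\<Sum>i\<in>?I. ennreal (1 / n (fst i)) * ?J (fst i))"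
    using wc by (intro sum.cong refl) (auto simp: mult.assoc nn_integral_cmult)
  also have "\<dots> = (\<Sum>c\<in>C. if n c = 0 then 0 else ?J c)"
    unfolding sumI[of "\<lambda>c. ennreal (1 / n c) * ?J c"] cancel ..
  also have "\<dots> \<le> (\<Sum>c\<in>C. ?J c)" by (intro sum_mono) simp
  also have "\<dots> \<le> ennreal e" by (rule cost)
  finally have "(\<Sum>i\<in>?I. \<integral>\<^sup>+a. ennreal (1 / n (fst i)) * w (fst i) a * ennreal (linf_dist (z (fst i)) a powr p) \<partial>\<alpha>)
      \<le> ennreal e" .
  then show ?thesis
    unfolding quantization_def using I(1) \<open>?I \<noteq> {}\<close> \<alpha> AE int w by auto
qed

section \<open>Uniform measures on finite families of points\<close>

definition empirical :: "'i set \<Rightarrow> ('i \<Rightarrow> real \<times> real) \<Rightarrow> (real \<times> real) measure" where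
  "empirical I x = distr (measure_pmf (pmf_of_set I)) borel x"

lemma nn_integral_empirical:
  assumes "finite I" "I \<noteq> {}" "f \<in> borel_measurable borel"
  shows "(\<integral>\<^sup>+a. f a \<partial>empirical I x) = (\<Sum>i\<in>I. f (x i)) * ennreal (1 / card I)"
proof -
  have "(\<integral>\<^sup>+a. f a \<partial>empirical I x) = (\<integral>\<^sup>+i. f (x i) \<partial>measure_pmf (pmf_of_set I))"
    unfolding empirical_def using assms by (intro nn_integral_distr) auto
  also have "\<dots> = (\<Sum>i\<in>I. f (x i) * ennreal (pmf (pmf_of_set I) i))"
    using assms by (subst nn_integral_measure_pmf_finite) auto
  also have "\<dots> = (\<Sum>i\<in>I. f (x i) * ennreal (1 / card I))"
    using assms by (intro sum.cong) auto
  finally show ?thesis by (simp add: sum_distrib_right)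
qed

lemma prob_space_empirical: "prob_space (empirical I x)"
  unfolding empirical_def by (intro measure_pmf.prob_space_distr) simp

lemma empirical_in_wasserstein_space:
  assumes "finite I" "I \<noteq> {}"
  shows "empirical I x \<in> wasserstein_space p"
  using assms nn_integral_empirical[OF assms, of "\<lambda>a. ennreal (linf_dist a (0, 0) powr p)" x]
    prob_space_empirical[of I x]
  by (auto simp: wasserstein_space_def ennreal_mult_less_top sum_ennreal empirical_def)

text \<open>Points of the family may coincide, so the atom at \<open>x i\<close> is shared equally
  by the indices in its fibre \<open>F i\<close>. Each piece sits at its own representing point,
  which makes the cost zero.\<close>

lemma quantization_empirical:
  assumes I: "finite I" "I \<noteq> {}"
  shows "\<exists>h. quantization p I (empirical I x) x h 0"
proof -
  define F where "F i = {j \<in> I. x j = x i}" for i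
  define h where "h i a = ennreal (1 / card (F i)) * indicator {x i} a" for i a
  have F: "0 < card (F i)" if "i \<in> I" for i
    using I that by (auto simp: F_def card_gt_0_iff)
  have h_meas: "h i \<in> borel_measurable borel" for i unfolding h_def by measurable
  have one: "of_nat k * ennreal (1 / k) = 1" if "0 < k" for k :: nat
  proof -
    have "of_nat k * ennreal (1 / k) = ennreal (real k * (1 / real k))"
      by (simp only: ennreal_of_nat_eq_real_of_nat) (rule ennreal_mult[symmetric], simp_all)
    then show ?thesis using that by simp
  qed
  have sum1: "(\<Sum>i\<in>I. h i (x j)) = 1" if "j \<in> I" for j
  proof -
    have "(\<Sum>i\<in>I. h i (x j)) = (\<Sum>i\<in>I. if x i = x j then ennreal (1 / card (F j)) else 0)"
      by (intro sum.cong refl) (auto simp: h_def F_def)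
    also have "\<dots> = (\<Sum>i\<in>F j. ennreal (1 / card (F j)))"
      using I by (simp add: sum.If_cases F_def Int_def conj_commute)
    finally show ?thesis using one[OF F[OF that]] by simp
  qed
  have sumF: "(\<Sum>j\<in>I. h i (x j)) = 1" if "i \<in> I" for i
  proof -
    have "(\<Sum>j\<in>I. h i (x j)) = (\<Sum>j\<in>I. if x j = x i then ennreal (1 / card (F i)) else 0)"
      by (intro sum.cong refl) (auto simp: h_def)
    also have "\<dots> = (\<Sum>j\<in>F i. ennreal (1 / card (F i)))"
      using I by (simp add: sum.If_cases F_def Int_def conj_commute)
    finally show ?thesis using one[OF F[OF that]] by simp
  qed
  have "AE j in measure_pmf (pmf_of_set I). (\<Sum>i\<in>I. h i (x j)) = 1"
    using I sum1 by (simp add: AE_measure_pmf_iff)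
  moreover have S: "(\<lambda>a. \<Sum>i\<in>I. h i a) \<in> borel_measurable borel"
    by (rule borel_measurable_sum[OF h_meas])
  have "{a \<in> space borel. (\<Sum>i\<in>I. h i a) = 1} \<in> sets borel" using S by measurable
  ultimately have AE: "AE a in empirical I x. (\<Sum>i\<in>I. h i a) = 1"
    unfolding empirical_def by (subst AE_distr_iff) simp_all
  have zero: "h i a * ennreal (linf_dist (x i) a powr p) = 0" for i a
    by (auto simp: h_def indicator_def)
  show ?thesis
    unfolding quantization_def
    using I h_meas AE sumF prob_space_empirical[of I x] nn_integral_empirical[OF I h_meas, where x = x]
    by (intro exI[of _ h]) (simp add: zero empirical_def)
qed

lemma quantization_cong:
  assumes "\<And>i. i \<in> I \<Longrightarrow> x i = y i"
  shows "quantization p I \<alpha> x h e \<longleftrightarrow> quantization p I \<alpha> y h e"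
  using assms by (simp add: quantization_def)

section \<open>Approximation by integer points\<close>

definition int_point :: "int \<times> int \<Rightarrow> real \<times> real" where
  "int_point c = (real_of_int (fst c), real_of_int (snd c))"

text \<open>
  The lower left corners of the unit cells represent the mass in a large square, rounded down to
  multiples of \<open>1 / N\<close>; the remaining mass is represented by the origin.
\<close>

lemma ex_integer_quantization:
  assumes \<alpha>: "\<alpha> \<in> wasserstein_space p" and p: "0 < p"
  shows "\<exists>zs h. zs \<noteq> [] \<and> quantization p {..<length zs} \<alpha> (\<lambda>i. int_point (zs ! i)) h 3"
proof -
  have sets: "sets \<alpha> = sets borel" and prob: "prob_space \<alpha>"
    and moment: "(\<integral>\<^sup>+a. ennreal (linf_dist a (0, 0) powr p) \<partial>\<alpha>) < \<infinity>"
    using \<alpha> by (auto simp: wasserstein_space_def)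
  interpret prob_space \<alpha> by (rule prob)
  have space: "space \<alpha> = UNIV" using sets_eq_imp_space_eq[OF sets] by simp
  define c0 where "c0 a = ennreal (linf_dist (0, 0) a powr p)" for a
  have c0_meas: "c0 \<in> borel_measurable borel" unfolding c0_def by measurable
  have c0_fin: "(\<integral>\<^sup>+a. c0 a \<partial>\<alpha>) < \<infinity>" using moment by (simp add: c0_def linf_dist_commute)
  have meas: "f \<in> borel_measurable \<alpha>" if "f \<in> borel_measurable borel" for f :: "real \<times> real \<Rightarrow> ennreal"
    using that by (simp add: measurable_cong_sets[OF sets refl])
  define cell :: "real \<times> real \<Rightarrow> int \<times> int" where "cell a = (\<lfloor>fst a\<rfloor>, \<lfloor>snd a\<rfloor>)" for a
  define Q where "Q c = {a. cell a = c}" for c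
  have Q: "Q c \<in> sets borel" for c
  proof -
    have "Q c = {a. fst a \<in> {real_of_int (fst c)..<real_of_int (fst c) + 1}} \<inter>
        {a. snd a \<in> {real_of_int (snd c)..<real_of_int (snd c) + 1}}"
      by (auto simp: Q_def cell_def floor_eq_iff prod_eq_iff)
    also have "\<dots> = {real_of_int (fst c)..<real_of_int (fst c) + 1} \<times> {real_of_int (snd c)..<real_of_int (snd c) + 1}"
      by auto
    also have "\<dots> \<in> sets (borel \<Otimes>\<^sub>M borel)" by (intro pair_measureI) auto
    finally show ?thesis by (simp only: borel_prod)
  qed
  define K where "K R = {- int R..<int R} \<times> {- int R..<int R}" for R
  have K: "finite (K R)" for R by (simp add: K_def)
  define Out where "Out R = {a. cell a \<notin> K R}" for R
  have Out: "Out R \<in> sets borel" for R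
  proof -
    have "Out R = UNIV - (\<Union>c\<in>K R. Q c)" by (auto simp: Out_def Q_def)
    also have "\<dots> \<in> sets borel" using Q K by (intro sets.Diff sets.finite_UN) auto
    finally show ?thesis .
  qed
  \<comment> \<open>The moment carried by the complement of the square tends to zero, by dominated
    convergence with the integrable function \<open>c0\<close>. It is the cost of sending that mass
    to the origin, and \<open>R\<close> is chosen to make it less than \<open>1\<close>.\<close>
  have "(\<lambda>R. \<integral>\<^sup>+a. c0 a * indicator (Out R) a \<partial>\<alpha>) \<longlonglongrightarrow> (\<integral>\<^sup>+a. 0 \<partial>\<alpha>)"
  proof (rule nn_integral_dominated_convergence[where w = c0])
    show "(\<lambda>a. c0 a * indicator (Out R) a) \<in> borel_measurable \<alpha>" for R
      using c0_meas Out by (intro meas borel_measurable_times_ennreal borel_measurable_indicator)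
    show "AE a in \<alpha>. (\<lambda>R. c0 a * indicator (Out R) a) \<longlonglongrightarrow> 0"
    proof (rule AE_I2, rule tendsto_eventually)
      fix a :: "real \<times> real"
      define r where "r = nat (max \<bar>\<lfloor>fst a\<rfloor>\<bar> \<bar>\<lfloor>snd a\<rfloor>\<bar>) + 1"
      have "a \<notin> Out R" if "r \<le> R" for R
        using that by (auto simp: Out_def K_def cell_def r_def)
      then show "eventually (\<lambda>R. c0 a * indicator (Out R) a = 0) sequentially"
        by (intro eventually_sequentiallyI[of r]) simp
    qed
  qed (use c0_fin meas[OF c0_meas] in \<open>auto simp: indicator_def\<close>)
  then have "(\<lambda>R. \<integral>\<^sup>+a. c0 a * indicator (Out R) a \<partial>\<alpha>) \<longlonglongrightarrow> 0" by simp
  then have "eventually (\<lambda>R. (\<integral>\<^sup>+a. c0 a * indicator (Out R) a \<partial>\<alpha>) < 1) sequentially"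
    by (rule order_tendstoD(2)) simp
  then obtain R where tail: "(\<integral>\<^sup>+a. c0 a * indicator (Out R) a \<partial>\<alpha>) < 1"
    by (auto simp: eventually_sequentially)
  define m where "m = real R powr p"
  have m: "0 \<le> m" by (simp add: m_def)
  have c0_le: "c0 a \<le> ennreal m" if "a \<in> Q c" "c \<in> K R" for a c
  proof -
    have "\<bar>fst a\<bar> \<le> R" "\<bar>snd a\<bar> \<le> R" using that by (auto simp: Q_def K_def cell_def; linarith)+
    then show ?thesis
      unfolding c0_def m_def using p by (intro ennreal_leI powr_mono2) (auto simp: linf_dist_def)
  qed
  define q where "q c = measure \<alpha> (Q c)" for c
  have q: "0 \<le> q c" "emeasure \<alpha> (Q c) = ennreal (q c)" for c
    by (simp_all add: q_def emeasure_eq_measure)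
  \<comment> \<open>Rounding leaves a mass of at most \<open>1 / N\<close> per cell, and sending it
    to the origin costs at most \<open>m\<close> per unit of mass. So
    \<open>N \<ge> card (K R) * m\<close> keeps this cost below \<open>1\<close> in total; adding
    \<open>1\<close> makes \<open>N\<close> positive.\<close>
  define N where "N = nat \<lceil>card (K R) * m\<rceil> + 1"
  have N: "0 < N" "card (K R) * m \<le> N" by (auto simp: N_def) linarith
  define n where "n c = nat \<lfloor>N * q c\<rfloor>" for c
  \<comment> \<open>The fraction of the cell that is kept. On a null cell the division by zero gives
    \<open>0\<close>, in agreement with \<open>n c = 0\<close>.\<close>
  define t where "t c = n c / (N * q c)" for c
  have n: "n c \<le> N * q c" "N * q c < n c + 1" for c
    using q(1)[of c] real_of_int_floor_add_one_gt[of "N * q c"] by (auto simp: n_def add.commute)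
  have tq: "t c * q c = n c / N" and t: "0 \<le> t c" "t c \<le> 1" for c
  proof -
    have "n c = 0" if "q c = 0" using that by (simp add: n_def)
    then show "t c * q c = n c / N" by (auto simp: t_def)
    show "0 \<le> t c" "t c \<le> 1" using n(1)[of c] q(1)[of c] N(1) by (auto simp: t_def divide_le_eq_1)
  qed
  have rest: "(1 - t c) * q c \<le> 1 / N" for c
  proof -
    have "(1 - t c) * q c = q c - n c / N" by (simp only: left_diff_distrib mult_1 tq)
    also have "\<dots> = (N * q c - n c) / N" using N(1) by (simp add: field_simps)
    also have "\<dots> \<le> 1 / N" using n(2)[of c] by (intro divide_right_mono) auto
    finally show ?thesis .
  qed
  define w where "w d a = (case d of
      Some c \<Rightarrow> ennreal (t c) * indicator (Q c) a
    | None \<Rightarrow> (\<Sum>c\<in>K R. ennreal (1 - t c) * indicator (Q c) a) + indicator (Out R) a)" for d a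
  define C where "C = insert None (Some ` K R)"
  have C: "finite C" using K by (simp add: C_def)
  have sumC: "(\<Sum>d\<in>C. g d) = g None + (\<Sum>c\<in>K R. g (Some c))" for g :: "(int \<times> int) option \<Rightarrow> 'z :: comm_monoid_add"
    unfolding C_def using K by (subst sum.insert) (auto simp: sum.reindex)
  have w_meas: "w d \<in> borel_measurable borel" for d
    unfolding w_def using Q Out
    by (cases d) (auto intro!: borel_measurable_add borel_measurable_sum borel_measurable_times_ennreal
        borel_measurable_indicator)
  have wsum: "(\<Sum>d\<in>C. w d a) = 1" for a
  proof -
    have "(\<Sum>d\<in>C. w d a) = (\<Sum>c\<in>K R. (ennreal (1 - t c) + ennreal (t c)) * indicator (Q c) a) + indicator (Out R) a"
      unfolding sumC by (simp add: w_def sum.distrib distrib_right add_ac)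
    also have "\<dots> = (\<Sum>c\<in>K R. if c = cell a then 1 else 0) + indicator (Out R) a"
      using t by (intro arg_cong2[of _ _ _ _ "(+)"] sum.cong refl)
        (auto simp: Q_def indicator_def simp flip: ennreal_plus)
    also have "\<dots> = 1" using K by (simp add: Out_def indicator_def)
    finally show ?thesis .
  qed
  have wSome: "(\<integral>\<^sup>+a. w (Some c) a \<partial>\<alpha>) = ennreal (n c / N)" for c
  proof -
    have "(\<integral>\<^sup>+a. w (Some c) a \<partial>\<alpha>) = ennreal (t c) * ennreal (q c)"
      unfolding w_def option.case using Q sets by (subst nn_integral_cmult_indicator) (auto simp: q)
    then show ?thesis using t q tq[of c] by (simp flip: ennreal_mult)
  qed
  define S where "S = (\<Sum>c\<in>K R. n c)"
  have sum_n: "(\<Sum>c\<in>K R. ennreal (n c / N)) = ennreal (S / N)"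
    by (subst sum_ennreal) (simp_all add: S_def sum_divide_distrib)
  have total: "(\<integral>\<^sup>+a. w None a \<partial>\<alpha>) + ennreal (S / N) = 1"
  proof -
    have "1 = (\<integral>\<^sup>+a. (\<Sum>d\<in>C. w d a) \<partial>\<alpha>)" by (simp add: wsum emeasure_space_1)
    also have "\<dots> = (\<Sum>d\<in>C. \<integral>\<^sup>+a. w d a \<partial>\<alpha>)"
      by (rule nn_integral_sum) (rule meas[OF w_meas])
    finally show ?thesis by (simp add: sumC wSome sum_n)
  qed
  \<comment> \<open>The weights add up to \<open>1\<close>, so the rounded masses do not exceed the
    total. This makes \<open>N - S\<close> a genuine difference of natural numbers.\<close>
  have "ennreal (S / N) \<le> (\<integral>\<^sup>+a. w None a \<partial>\<alpha>) + ennreal (S / N)" by (rule add_increasing) simp_all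
  then have "S / N \<le> 1" unfolding total by (simp only: ennreal_le_1)
  then have SN: "S \<le> N" using N(1) by (simp add: divide_le_eq_1)
  have wNone: "(\<integral>\<^sup>+a. w None a \<partial>\<alpha>) = ennreal ((N - S) / N)"
  proof -
    have "(\<integral>\<^sup>+a. w None a \<partial>\<alpha>) = ennreal 1 - ennreal (S / N)"
      using total ennreal_add_diff_cancel_right[of "ennreal (S / N)" "\<integral>\<^sup>+a. w None a \<partial>\<alpha>"] by simp
    also have "\<dots> = ennreal (1 - S / N)" by (rule ennreal_minus) simp
    also have "1 - S / N = (N - S) / N" using N(1) SN by (simp add: field_simps of_nat_diff)
    finally show ?thesis .
  qed
  define n' where "n' d = (case d of Some c \<Rightarrow> n c | None \<Rightarrow> N - S)" for d :: "(int \<times> int) option"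
  define z where "z d = (case d of Some c \<Rightarrow> c | None \<Rightarrow> (0 :: int, 0 :: int))" for d
  have costSome: "(\<integral>\<^sup>+a. w (Some c) a * ennreal (linf_dist (int_point (z (Some c))) a powr p) \<partial>\<alpha>) \<le> ennreal (n c / N)" for c
    unfolding wSome[symmetric]
  proof (rule nn_integral_mono)
    fix a
    have "linf_dist (int_point c) a powr p \<le> 1" if "a \<in> Q c"
    proof -
      have "linf_dist (int_point c) a \<le> 1"
        using that by (auto simp: Q_def cell_def int_point_def linf_dist_def; linarith)
      then show ?thesis using powr_mono2[of p "linf_dist (int_point c) a" 1] p by simp
    qed
    then show "w (Some c) a * ennreal (linf_dist (int_point (z (Some c))) a powr p) \<le> w (Some c) a"
      using mult_left_mono[of "ennreal (linf_dist (int_point c) a powr p)" 1 "ennreal (t c)"]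
      by (cases "a \<in> Q c") (auto simp: w_def z_def)
  qed
  \<comment> \<open>One unit for the rounding remainders inside the square and one for the tail
    outside it. The kept parts of the cells contribute at most one more, whence the total of
    \<open>3\<close>.\<close>
  have costNone: "(\<integral>\<^sup>+a. w None a * ennreal (linf_dist (int_point (z None)) a powr p) \<partial>\<alpha>) \<le> ennreal 2"
  proof -
    have "w None a * c0 a \<le> (\<Sum>c\<in>K R. ennreal ((1 - t c) * m) * indicator (Q c) a) + c0 a * indicator (Out R) a" for a
    proof -
      have "ennreal (1 - t c) * indicator (Q c) a * c0 a \<le> ennreal ((1 - t c) * m) * indicator (Q c) a" if "c \<in> K R" for c
        using c0_le[OF _ that, of a] t[of c] m
        by (cases "a \<in> Q c") (auto simp: ennreal_mult intro!: mult_left_mono)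
      then have "(\<Sum>c\<in>K R. ennreal (1 - t c) * indicator (Q c) a * c0 a) \<le> (\<Sum>c\<in>K R. ennreal ((1 - t c) * m) * indicator (Q c) a)"
        by (rule sum_mono)
      then show ?thesis
        by (simp add: w_def distrib_right sum_distrib_right mult.commute[of "c0 a"] add_right_mono)
    qed
    then have "(\<integral>\<^sup>+a. w None a * c0 a \<partial>\<alpha>) \<le>
        (\<integral>\<^sup>+a. (\<Sum>c\<in>K R. ennreal ((1 - t c) * m) * indicator (Q c) a) + c0 a * indicator (Out R) a \<partial>\<alpha>)"
      by (intro nn_integral_mono)
    also have "\<dots> = (\<integral>\<^sup>+a. (\<Sum>c\<in>K R. ennreal ((1 - t c) * m) * indicator (Q c) a) \<partial>\<alpha>) + (\<integral>\<^sup>+a. c0 a * indicator (Out R) a \<partial>\<alpha>)"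
      using Q Out c0_meas
      by (intro nn_integral_add meas borel_measurable_sum borel_measurable_times_ennreal borel_measurable_indicator) auto
    also have "(\<integral>\<^sup>+a. (\<Sum>c\<in>K R. ennreal ((1 - t c) * m) * indicator (Q c) a) \<partial>\<alpha>) = (\<Sum>c\<in>K R. ennreal ((1 - t c) * m) * ennreal (q c))"
      using Q sets by (subst nn_integral_sum)
        (auto simp: nn_integral_cmult_indicator q(2) intro!: meas borel_measurable_times_ennreal borel_measurable_indicator)
    also have "\<dots> = ennreal (\<Sum>c\<in>K R. m * ((1 - t c) * q c))"
      using t q(1) m by (subst sum_ennreal[symmetric]) (auto simp: mult_ac simp flip: ennreal_mult)
    also have "\<dots> \<le> ennreal 1"
    proof (rule ennreal_leI)
      have "(\<Sum>c\<in>K R. m * ((1 - t c) * q c)) \<le> (\<Sum>c\<in>K R. m * (1 / N))"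
        using m rest by (intro sum_mono mult_left_mono) auto
      also have "\<dots> \<le> 1" using N by (simp add: field_simps)
      finally show "(\<Sum>c\<in>K R. m * ((1 - t c) * q c)) \<le> 1" .
    qed
    finally have "(\<integral>\<^sup>+a. w None a * c0 a \<partial>\<alpha>) \<le> ennreal 1 + (\<integral>\<^sup>+a. c0 a * indicator (Out R) a \<partial>\<alpha>)"
      by (simp add: add_right_mono)
    also have "\<dots> \<le> ennreal 1 + ennreal 1" using tail by (intro add_left_mono) simp
    also have "\<dots> = ennreal 2" by (subst ennreal_plus[symmetric]) simp_all
    finally show ?thesis by (simp add: z_def int_point_def c0_def)
  qed
  have q0: "quantization p (SIGMA d:C. {..<n' d}) \<alpha> (\<lambda>i. int_point (z (fst i)))
      (\<lambda>i a. ennreal (1 / n' (fst i)) * w (fst i) a) 3"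
  proof (rule quantization_of_weights[OF C N(1) sets prob w_meas wsum])
    show "(\<integral>\<^sup>+a. w d a \<partial>\<alpha>) = ennreal (n' d / N)" for d
      using wSome wNone by (cases d) (auto simp: n'_def)
    show "(\<Sum>d\<in>C. n' d) = N" using SN by (simp add: sumC n'_def S_def)
    have "(\<Sum>d\<in>C. \<integral>\<^sup>+a. w d a * ennreal (linf_dist (int_point (z d)) a powr p) \<partial>\<alpha>) \<le> ennreal 2 + (\<Sum>c\<in>K R. ennreal (n c / N))"
      unfolding sumC by (intro add_mono costNone sum_mono costSome)
    also have "\<dots> \<le> ennreal 2 + ennreal 1"
      unfolding sum_n using SN N(1) by (intro add_left_mono ennreal_leI) simp
    also have "\<dots> = ennreal 3" by (subst ennreal_plus[symmetric]) simp_all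
    finally show "(\<Sum>d\<in>C. \<integral>\<^sup>+a. w d a * ennreal (linf_dist (int_point (z d)) a powr p) \<partial>\<alpha>) \<le> ennreal 3" .
  qed
  define I where "I = (SIGMA d:C. {..<n' d})"
  have I: "finite I" "I \<noteq> {}" using q0 by (auto simp: quantization_def I_def)
  obtain f where f: "bij_betw f {..<card I} I"
    using ex_bij_betw_nat_finite[OF I(1)] by (auto simp: atLeast0LessThan)
  define zs where "zs = map (\<lambda>i. z (fst (f i))) [0..<card I]"
  have "quantization p {..<length zs} \<alpha> ((\<lambda>i. int_point (z (fst i))) \<circ> f) ((\<lambda>i a. ennreal (1 / n' (fst i)) * w (fst i) a) \<circ> f) 3"
    using quantization_reindex[OF q0[folded I_def] f] by (simp add: zs_def)
  then have "quantization p {..<length zs} \<alpha> (\<lambda>i. int_point (zs ! i)) ((\<lambda>i a. ennreal (1 / n' (fst i)) * w (fst i) a) \<circ> f) 3"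
    by (subst quantization_cong[where y = "(\<lambda>i. int_point (z (fst i))) \<circ> f"]) (simp_all add: zs_def)
  moreover have "zs \<noteq> []" using I by (simp add: zs_def card_eq_0_iff)
  ultimately show ?thesis by blast
qed

section \<open>The two coarse embeddings\<close>

text \<open>The real-valued form of the two transport estimates. The finiteness that the second one
  requires comes from the first, applied to the identity permutation.\<close>

lemma wasserstein_dist_quantized:
  assumes \<alpha>: "quantization p I \<alpha> x h e" and \<beta>: "quantization p I \<beta> y k e'"
    and p: "0 < p" and e: "0 \<le> e" "0 \<le> e'"
  shows "bij_betw \<sigma> I I \<Longrightarrow> wasserstein_dist p \<alpha> \<beta> powr p \<le>
      3 powr p * (e + e' + (\<Sum>i\<in>I. linf_dist (x i) (y (\<sigma> i)) powr p) / card I)"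
    and "\<exists>\<sigma>. bij_betw \<sigma> I I \<and> (\<Sum>i\<in>I. linf_dist (x i) (y (\<sigma> i)) powr p) / card I \<le>
      3 powr p * (e + e' + wasserstein_dist p \<alpha> \<beta> powr p + 1)"
proof -
  have le: "transport_cost p \<alpha> \<beta> \<le>
      ennreal (3 powr p * (e + e' + (\<Sum>i\<in>I. linf_dist (x i) (y (\<sigma> i)) powr p) / card I))"
    if "bij_betw \<sigma> I I" for \<sigma>
    by (rule transport_cost_le_permutation[OF \<alpha> \<beta> that p e])
  show "wasserstein_dist p \<alpha> \<beta> powr p \<le>
      3 powr p * (e + e' + (\<Sum>i\<in>I. linf_dist (x i) (y (\<sigma> i)) powr p) / card I)"
    if "bij_betw \<sigma> I I"
    unfolding wasserstein_dist_powr[OF p] using le[OF that] e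
    by (intro enn2real_leI mult_nonneg_nonneg add_nonneg_nonneg divide_nonneg_nonneg sum_nonneg) auto
  have "transport_cost p \<alpha> \<beta> < \<infinity>"
    using le[OF bij_betw_id] by (rule le_less_trans) simp
  then show "\<exists>\<sigma>. bij_betw \<sigma> I I \<and> (\<Sum>i\<in>I. linf_dist (x i) (y (\<sigma> i)) powr p) / card I \<le>
      3 powr p * (e + e' + wasserstein_dist p \<alpha> \<beta> powr p + 1)"
    unfolding wasserstein_dist_powr[OF p] by (rule permutation_le_transport_cost[OF \<alpha> \<beta> p e])
qed

lemma wasserstein_dist_nonneg: "0 \<le> wasserstein_dist p \<alpha> \<beta>"
  by (simp add: wasserstein_dist_def)

text \<open>A measure is sent to the diagram of its \<open>N\<close> representing points, scaled down by \<open>N powr (1 / p)\<close>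
  and moved so far away from the diagonal that leaving a point unmatched never pays off.\<close>

lemma wasserstein_space_embeds_if_diagrams_embed:
  assumes p: "1 \<le> p"
    and D: "coarsely_embeds_into_Hilbert TYPE('h) persistence_diagrams (diagram_dist p)"
  shows "coarsely_embeds_into_Hilbert TYPE('h) (wasserstein_space p) (wasserstein_dist p)"
proof -
  have p0: "0 < p" using p by simp
  obtain zs h where zs: "\<And>\<alpha>. \<alpha> \<in> wasserstein_space p \<Longrightarrow> zs \<alpha> \<noteq> [] \<and>
      quantization p {..<length (zs \<alpha>)} \<alpha> (\<lambda>i. int_point (zs \<alpha> ! i)) (h \<alpha>) 3"
    using ex_integer_quantization[OF _ p0] by metis
  define lst where "lst i = (from_nat i :: (int \<times> int) list)" for i
  define r where "r \<alpha> = to_nat (zs \<alpha>)" for \<alpha>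
  have lst_r: "lst (r \<alpha>) = zs \<alpha>" for \<alpha> by (simp add: lst_def r_def)
  let ?a = "3 powr p :: real"
  have a: "1 \<le> ?a" using p by (intro ge_one_powr_ge_zero) auto
  show ?thesis
  \<comment> \<open>The \<open>7\<close> consists of the two quantization errors \<open>3\<close>
    and the \<open>1\<close> lost at an infimum. One factor \<open>3 powr p\<close> is due to the
    transport estimate, the other to the nearly optimal matching.\<close>
  proof (rule coarsely_embeds_by_finite_approximation_powr[OF D wasserstein_dist_nonneg diagram_dist_nonneg _ p0,
        of "7 * ?a\<^sup>2" _ r])
    fix n
    \<comment> \<open>A common multiple of the lengths of the first \<open>n\<close> lists; the
      maximum with \<open>1\<close> skips the empty list.\<close>
    define N where "N = (\<Prod>i<n. max 1 (length (lst i)))"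
    have N: "0 < N" by (auto simp: N_def)
    have dvd: "length (lst i) dvd N" if "i < n" "lst i \<noteq> []" for i
    proof -
      have "max 1 (length (lst i)) dvd N" unfolding N_def using that by (intro dvd_prodI) auto
      moreover have "max 1 (length (lst i)) = length (lst i)" using that by (cases "lst i") auto
      ultimately show ?thesis by simp
    qed
    define X where "X i j = int_point (lst i ! (j mod length (lst i)))" for i j
    obtain R0 where R0: "\<And>i j. i < n \<Longrightarrow> j < N \<Longrightarrow> linf_dist (X i j) (0, 0) \<le> R0"
    proof -
      have "bdd_above ((\<lambda>(i, j). linf_dist (X i j) (0, 0)) ` ({..<n} \<times> {..<N}))"
        by (intro bdd_above_finite) auto
      then show ?thesis by (auto simp: bdd_above_def intro: that)
    qed
    define R where "R = max 0 R0"
    have R: "0 \<le> R" by (simp add: R_def)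
    have XR: "\<bar>fst (X i j)\<bar> \<le> R" "\<bar>snd (X i j)\<bar> \<le> R" if "i < n" "j < N" for i j
      using R0[OF that] by (auto simp: linf_dist_def R_def)
    \<comment> \<open>Since \<open>s powr p = 1 / N\<close>, the sum of the costs of the scaled
      points is the average over the original ones.\<close>
    define s where "s = N powr (- (1 / p))"
    have s: "0 < s" "s \<le> 1" "s powr p = 1 / N"
    proof -
      show "0 < s" using N by (simp add: s_def)
      show "s \<le> 1" using powr_mono[of "- (1 / p)" 0 N] N p0 by (simp add: s_def)
      have "s powr p = N powr (- (1 / p) * p)" by (simp only: s_def powr_powr)
      also have "- (1 / p) * p = - 1" using p0 by simp
      also have "N powr - 1 = 1 / N" using powr_minus_divide[of "real N" 1] N by simp
      finally show "s powr p = 1 / N" .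
    qed
    \<comment> \<open>Scaled coordinates are at most \<open>R\<close> in absolute value, so the
      distance to the diagonal is at least \<open>L - R = 2 * R + 1\<close>. Distances between the
      original points are at most \<open>2 * R\<close>. The summand \<open>1\<close> keeps the
      points strictly above the diagonal even if \<open>R = 0\<close>.\<close>
    define L where "L = 3 * R + 1"
    define P where "P i j = (s * fst (X i j) - L, s * snd (X i j) + L)" for i j
    define \<phi> where "\<phi> i = image_mset (P i) (mset_set {..<N})" for i
    have P_dist: "linf_dist (P i j) (P i' j') powr p = linf_dist (X i j) (X i' j') powr p / N" for i j i' j'
    proof -
      have "linf_dist (P i j) (P i' j') = s * linf_dist (X i j) (X i' j')"
        using s(1) by (simp add: P_def linf_dist_def abs_mult max_mult_distrib_left flip: right_diff_distrib)
      then show ?thesis using s by (simp add: powr_mult)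
    qed
    have sX: "\<bar>s * fst (X i j)\<bar> \<le> R" "\<bar>s * snd (X i j)\<bar> \<le> R" if "i < n" "j < N" for i j
      using XR[OF that] s R mult_mono[of s 1 "\<bar>fst (X i j)\<bar>" R] mult_mono[of s 1 "\<bar>snd (X i j)\<bar>" R]
      by (auto simp: abs_mult)
    have P_diag: "2 * R \<le> dist_diagonal (P i j)" and P_lt: "fst (P i j) < snd (P i j)" if "i < n" "j < N" for i j
      using sX[OF that] R by (auto simp: dist_diagonal_eq P_def L_def abs_le_iff)
    have X_dist: "linf_dist (X i j) (X i' j') \<le> 2 * R" if "i < n" "j < N" "i' < n" "j' < N" for i j i' j'
      using XR[OF that(1,2)] XR[OF that(3,4)] by (auto simp: linf_dist_def)
    define M where "M i i' \<sigma> = (\<Sum>j<N. linf_dist (X i j) (X i' (\<sigma> j)) powr p) / card {..<N}" for i i' \<sigma>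
    have M_P: "M i i' \<sigma> = (\<Sum>j<N. linf_dist (P i j) (P i' (\<sigma> j)) powr p)" for i i' \<sigma>
      by (simp add: M_def P_dist sum_divide_distrib)
    have upper: "diagram_dist p (\<phi> i) (\<phi> i') powr p \<le> M i i' \<sigma>" if "bij_betw \<sigma> {..<N} {..<N}" for i i' \<sigma>
    proof -
      have "matching {..<N} {..<N} {..<N} \<sigma>" using that by (auto simp: matching_def bij_betw_def)
      from diagram_dist_le_index_cost[OF finite_lessThan finite_lessThan this p0, of "P i" "P i'"] that
      show ?thesis by (simp add: \<phi>_def index_cost_def M_P bij_betw_def)
    qed
    have lower: "\<exists>\<sigma>. bij_betw \<sigma> {..<N} {..<N} \<and> M i i' \<sigma> \<le> ?a * (diagram_dist p (\<phi> i) (\<phi> i') powr p + 1)"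
      if "i < n" "i' < n" for i i'
    proof -
      obtain A g where g: "matching {..<N} {..<N} A g"
        and cost: "index_cost p {..<N} {..<N} (P i) (P i') A g \<le> ?a * (diagram_dist p (\<phi> i) (\<phi> i') powr p + 1)"
        using ex_index_cost_le_diagram_dist[OF finite_lessThan finite_lessThan p0, of N N "P i" "P i'"]
        unfolding \<phi>_def by blast
      show ?thesis
      proof (cases "A = {..<N}")
        case True
        then have "inj_on g {..<N}" "g ` {..<N} \<subseteq> {..<N}" using g by (auto simp: matching_def)
        then have bij: "bij_betw g {..<N} {..<N}"
          by (simp add: bij_betw_def endo_inj_surj)
        then have "index_cost p {..<N} {..<N} (P i) (P i') A g = M i i' g"
          by (simp add: index_cost_def M_P True bij_betw_def)
        then show ?thesis using bij cost by auto
      next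
        case False
        then obtain j where j: "j \<in> {..<N} - A" using g by (auto simp: matching_def)
        \<comment> \<open>As an average of distances to the power \<open>p\<close>, the cost of the
          identity is at most \<open>(2 * R) powr p\<close>, which is no more than the price of the
          single unmatched point \<open>j\<close>.\<close>
        have "M i i' id \<le> (2 * R) powr p"
        proof -
          have "linf_dist (X i j) (X i' (id j)) powr p \<le> (2 * R) powr p" if "j \<in> {..<N}" for j
            using X_dist that \<open>i < n\<close> \<open>i' < n\<close> p0 by (intro powr_mono2) auto
          then have "(\<Sum>j<N. linf_dist (X i j) (X i' (id j)) powr p) \<le> N * (2 * R) powr p"
            using sum_bounded_above[of "{..<N}" _ "(2 * R) powr p"] by simp
          then show ?thesis using N by (simp add: M_def divide_le_eq mult.commute)
        qed
        also have "\<dots> \<le> dist_diagonal (P i j) powr p"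
          using P_diag[of i j] j \<open>i < n\<close> R p0 by (intro powr_mono2) auto
        also have "\<dots> \<le> (\<Sum>j\<in>{..<N} - A. dist_diagonal (P i j) powr p)"
          using j by (intro member_le_sum) auto
        also have "\<dots> \<le> index_cost p {..<N} {..<N} (P i) (P i') A g"
          by (auto simp: index_cost_def intro!: sum_nonneg add_nonneg_nonneg)
        finally show ?thesis using cost bij_betw_id by (intro exI[of _ id]) auto
      qed
    qed
    have quant: "\<exists>k. quantization p {..<N} \<alpha> (X (r \<alpha>)) k 3" if \<alpha>: "\<alpha> \<in> wasserstein_space p" "r \<alpha> < n" for \<alpha>
    proof -
      obtain K where K: "N = length (zs \<alpha>) * K"
        using dvd[OF \<alpha>(2)] zs[OF \<alpha>(1)] by (auto simp: lst_r)
      have "0 < K" using K N by (cases K) auto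
      from quantization_replicate[OF conjunct2[OF zs[OF \<alpha>(1)]] this]
      show ?thesis by (auto simp: K X_def[abs_def] lst_r)
    qed
    show "\<exists>\<phi>. \<forall>\<alpha>\<in>wasserstein_space p. \<forall>\<beta>\<in>wasserstein_space p. r \<alpha> < n \<longrightarrow> r \<beta> < n \<longrightarrow>
        \<phi> (r \<alpha>) \<in> persistence_diagrams \<and>
        wasserstein_dist p \<alpha> \<beta> powr p \<le> 7 * ?a\<^sup>2 * (1 + diagram_dist p (\<phi> (r \<alpha>)) (\<phi> (r \<beta>)) powr p) \<and>
        diagram_dist p (\<phi> (r \<alpha>)) (\<phi> (r \<beta>)) powr p \<le> 7 * ?a\<^sup>2 * (1 + wasserstein_dist p \<alpha> \<beta> powr p)"
    proof (intro exI[of _ \<phi>] ballI impI)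
      fix \<alpha> \<beta> assume \<alpha>: "\<alpha> \<in> wasserstein_space p" "r \<alpha> < n" and \<beta>: "\<beta> \<in> wasserstein_space p" "r \<beta> < n"
      obtain k k' where k: "quantization p {..<N} \<alpha> (X (r \<alpha>)) k 3" and k': "quantization p {..<N} \<beta> (X (r \<beta>)) k' 3"
        using quant[OF \<alpha>] quant[OF \<beta>] by blast
      define W where "W = wasserstein_dist p \<alpha> \<beta> powr p"
      define d where "d = diagram_dist p (\<phi> (r \<alpha>)) (\<phi> (r \<beta>)) powr p"
      have nonneg: "0 \<le> W" "0 \<le> d" by (simp_all add: W_def d_def)
      have aa: "?a \<le> ?a\<^sup>2" using a by (simp add: power2_eq_square)
      obtain \<sigma> where \<sigma>: "bij_betw \<sigma> {..<N} {..<N}" "M (r \<alpha>) (r \<beta>) \<sigma> \<le> ?a * (d + 1)"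
        using lower[OF \<alpha>(2) \<beta>(2)] unfolding d_def by blast
      have "W \<le> ?a * (3 + 3 + M (r \<alpha>) (r \<beta>) \<sigma>)"
        unfolding W_def M_def by (rule wasserstein_dist_quantized(1)[OF k k' p0 _ _ \<sigma>(1)]) simp_all
      also have "\<dots> \<le> ?a * (6 * ?a + ?a * (d + 1))" using \<sigma>(2) a by (intro mult_left_mono) auto
      also have "\<dots> \<le> 7 * ?a\<^sup>2 * (1 + d)"
        using nonneg mult_nonneg_nonneg[of "?a\<^sup>2" d] by (simp add: power2_eq_square algebra_simps)
      finally have W_le: "W \<le> 7 * ?a\<^sup>2 * (1 + d)" .
      obtain \<tau> where \<tau>: "bij_betw \<tau> {..<N} {..<N}" "M (r \<alpha>) (r \<beta>) \<tau> \<le> ?a * (3 + 3 + W + 1)"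
        using wasserstein_dist_quantized(2)[OF k k' p0] unfolding W_def M_def by auto
      have "d \<le> M (r \<alpha>) (r \<beta>) \<tau>" unfolding d_def by (rule upper[OF \<tau>(1)])
      also have "\<dots> \<le> ?a * (7 * (1 + W))" using \<tau>(2) a nonneg by (elim order_trans, intro mult_left_mono) auto
      also have "\<dots> \<le> ?a\<^sup>2 * (7 * (1 + W))" using aa nonneg by (intro mult_right_mono) auto
      finally have d_le: "d \<le> 7 * ?a\<^sup>2 * (1 + W)" by (simp only: mult_ac)
      have "\<phi> (r \<alpha>) \<in> persistence_diagrams"
        using P_lt[OF \<alpha>(2)] by (auto simp: persistence_diagrams_def \<phi>_def)
      then show "\<phi> (r \<alpha>) \<in> persistence_diagrams \<and>
        wasserstein_dist p \<alpha> \<beta> powr p \<le> 7 * ?a\<^sup>2 * (1 + diagram_dist p (\<phi> (r \<alpha>)) (\<phi> (r \<beta>)) powr p) \<and>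
        diagram_dist p (\<phi> (r \<alpha>)) (\<phi> (r \<beta>)) powr p \<le> 7 * ?a\<^sup>2 * (1 + wasserstein_dist p \<alpha> \<beta> powr p)"
        using W_le d_le by (simp add: W_def d_def)
    qed
  qed simp
qed

text \<open>Every point occurs in exactly one term of the cost, matched or unmatched, so its
  displacement is charged only once.\<close>

lemma index_cost_perturb:
  assumes fin: "finite I" "finite J" and g: "matching I J A g" and p: "0 < p"
  shows "index_cost p I J x' y' A g \<le> 3 powr p * (index_cost p I J x y A g +
    (\<Sum>i\<in>I. linf_dist (x' i) (x i) powr p) + (\<Sum>j\<in>J. linf_dist (y' j) (y j) powr p))"
proof -
  let ?a = "3 powr p :: real" and ?cx = "\<lambda>i. linf_dist (x' i) (x i) powr p"
    and ?cy = "\<lambda>j. linf_dist (y' j) (y j) powr p"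
  have A: "A \<subseteq> I" "inj_on g A" "g ` A \<subseteq> J" using g by (auto simp: matching_def)
  have dd: "dist_diagonal u powr p \<le> ?a * (dist_diagonal v powr p + linf_dist u v powr p)" for u v
  proof -
    have "dist_diagonal u powr p \<le> (dist_diagonal v + linf_dist u v) powr p"
      using dist_diagonal_le_add[of u v] p by (intro powr_mono2) (auto simp: add.commute)
    also have "\<dots> \<le> ?a * (dist_diagonal v powr p + linf_dist u v powr p)"
      using p by (intro powr_sum2_le) auto
    finally show ?thesis .
  qed
  have "index_cost p I J x' y' A g \<le>
      (\<Sum>i\<in>A. ?a * (linf_dist (x i) (y (g i)) powr p + ?cx i + ?cy (g i))) +
      (\<Sum>i\<in>I - A. ?a * (dist_diagonal (x i) powr p + ?cx i)) +
      (\<Sum>j\<in>J - g ` A. ?a * (dist_diagonal (y j) powr p + ?cy j))"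
    unfolding index_cost_def
  proof (intro add_mono sum_mono dd)
    show "linf_dist (x' i) (y' (g i)) powr p \<le> ?a * (linf_dist (x i) (y (g i)) powr p + ?cx i + ?cy (g i))" for i
      using linf_powr_triangle3[OF p, of "x' i" "y' (g i)" "x i" "y (g i)"]
      by (simp add: linf_dist_commute[of "y (g i)" "y' (g i)"] add_ac)
  qed
  also have "\<dots> = ?a * (index_cost p I J x y A g + ((\<Sum>i\<in>A. ?cx i) + (\<Sum>i\<in>I - A. ?cx i)) +
      ((\<Sum>i\<in>A. ?cy (g i)) + (\<Sum>j\<in>J - g ` A. ?cy j)))"
    unfolding index_cost_def sum_distrib_left[symmetric] sum.distrib by (simp only: distrib_left add_ac)
  also have "(\<Sum>i\<in>A. ?cx i) + (\<Sum>i\<in>I - A. ?cx i) = (\<Sum>i\<in>I. ?cx i)"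
    using sum.subset_diff[OF A(1) fin(1), of ?cx] by simp
  also have "(\<Sum>i\<in>A. ?cy (g i)) + (\<Sum>j\<in>J - g ` A. ?cy j) = (\<Sum>j\<in>J. ?cy j)"
    using sum.subset_diff[OF A(3) fin(2), of ?cy] sum.reindex[OF A(2), of ?cy] by simp
  finally show ?thesis .
qed

text \<open>
  Points of a diagram that has been padded by the diagonal projections of all other points can be
  matched bijectively. Here \<open>I\<close> indexes all points and \<open>J\<close> those of the diagram.
\<close>

definition padded :: "'i set \<Rightarrow> ('i \<Rightarrow> real \<times> real) \<Rightarrow> 'i \<Rightarrow> real \<times> real" where
  "padded J x u = (if u \<in> J then x u else diagonal_proj (x u))"

text \<open>The permutation is the involution that exchanges \<open>u\<close> and \<open>g u\<close>
  for matched \<open>u\<close> and fixes all other indices; it is well defined as \<open>I1\<close>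
  and \<open>I2\<close> are disjoint. A matched pair counts twice, once for the points and once for
  their projections, hence the factor \<open>2\<close>. An unmatched point moves to its own
  projection.\<close>

lemma permutation_of_matching:
  fixes x :: "'i \<Rightarrow> real \<times> real"
  assumes fin: "finite I" and sub: "I1 \<subseteq> I" "I2 \<subseteq> I" "I1 \<inter> I2 = {}"
    and g: "matching I1 I2 A g" and p: "0 < p"
  shows "\<exists>\<sigma>. bij_betw \<sigma> I I \<and>
    (\<Sum>u\<in>I. linf_dist (padded I1 x u) (padded I2 x (\<sigma> u)) powr p) \<le> 2 * index_cost p I1 I2 x x A g"
proof -
  have A: "A \<subseteq> I1" "inj_on g A" "g ` A \<subseteq> I2" using g by (auto simp: matching_def)
  define gi where "gi = the_inv_into A g"
  have gi: "gi (g u) = u" if "u \<in> A" for u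
    using A(2) that by (simp add: gi_def the_inv_into_f_f)
  define \<sigma> where "\<sigma> u = (if u \<in> A then g u else if u \<in> g ` A then gi u else u)" for u
  have A12: "u \<in> I1" "g u \<in> I2" "g u \<notin> A" "g u \<notin> I1" "u \<notin> I2" "u \<notin> g ` A" if "u \<in> A" for u
    using that A sub by blast+
  have \<sigma>A: "\<sigma> u = g u" "\<sigma> (g u) = u" if "u \<in> A" for u
    using that A12[OF that] gi[OF that] by (auto simp: \<sigma>_def)
  have \<sigma>_id: "\<sigma> u = u" if "u \<notin> A" "u \<notin> g ` A" for u using that by (simp add: \<sigma>_def)
  have inI: "\<sigma> u \<in> I" if "u \<in> I" for u
    using that A12 sub \<sigma>A \<sigma>_id by (cases "u \<in> A \<or> u \<in> g ` A") auto
  have "\<sigma> (\<sigma> u) = u" for u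
    using \<sigma>A \<sigma>_id by (cases "u \<in> A \<or> u \<in> g ` A") auto
  then have bij: "bij_betw \<sigma> I I"
    using inI by (intro bij_betw_byWitness[where f' = \<sigma>]) auto
  define f where "f u = linf_dist (padded I1 x u) (padded I2 x (\<sigma> u)) powr p" for u
  have f_A: "f u = linf_dist (x u) (x (g u)) powr p" if "u \<in> A" for u
    using A12[OF that] \<sigma>A[OF that] by (simp add: f_def padded_def)
  have f_gA: "f (g u) \<le> linf_dist (x u) (x (g u)) powr p" if "u \<in> A" for u
    using A12[OF that] \<sigma>A[OF that] linf_diagonal_proj_le[of "x (g u)" "x u"] p
    by (auto simp: f_def padded_def linf_dist_commute[of "x u"] intro!: powr_mono2)
  have f_1: "f u = dist_diagonal (x u) powr p" if "u \<in> I1 - A" for u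
  proof -
    have "u \<notin> g ` A" "u \<notin> I2" using that A sub by blast+
    then show ?thesis using that by (simp add: f_def padded_def \<sigma>_id linf_diagonal_proj)
  qed
  have f_2: "f u = dist_diagonal (x u) powr p" if "u \<in> I2 - g ` A" for u
  proof -
    have "u \<notin> A" "u \<notin> I1" using that A sub by blast+
    then show ?thesis
      using that by (simp add: f_def padded_def \<sigma>_id linf_dist_commute[of "diagonal_proj _"] linf_diagonal_proj)
  qed
  have f_0: "f u = 0" if "u \<in> I - (I1 \<union> I2)" for u
  proof -
    have "u \<notin> A" "u \<notin> g ` A" using that A by blast+
    then show ?thesis using that by (simp add: f_def padded_def \<sigma>_id)
  qed
  have fin12: "finite I1" "finite I2" using fin sub by (auto intro: finite_subset)
  have "(\<Sum>u\<in>I. f u) = (\<Sum>u\<in>I1 \<union> I2. f u)"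
    using sub f_0 fin by (intro sum.mono_neutral_right) auto
  also have "\<dots> = (\<Sum>u\<in>I1. f u) + (\<Sum>u\<in>I2. f u)"
    by (rule sum.union_disjoint[OF fin12 sub(3)])
  also have "(\<Sum>u\<in>I1. f u) = (\<Sum>u\<in>I1 - A. f u) + (\<Sum>u\<in>A. f u)"
    by (rule sum.subset_diff[OF A(1) fin12(1)])
  also have "(\<Sum>u\<in>I2. f u) = (\<Sum>u\<in>I2 - g ` A. f u) + (\<Sum>u\<in>A. f (g u))"
    using sum.subset_diff[OF A(3) fin12(2), of f] sum.reindex[OF A(2), of f] by simp
  also have "(\<Sum>u\<in>I1 - A. f u) + (\<Sum>u\<in>A. f u) + ((\<Sum>u\<in>I2 - g ` A. f u) + (\<Sum>u\<in>A. f (g u))) \<le>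
      (\<Sum>u\<in>I1 - A. dist_diagonal (x u) powr p) + (\<Sum>u\<in>A. linf_dist (x u) (x (g u)) powr p) +
      ((\<Sum>u\<in>I2 - g ` A. dist_diagonal (x u) powr p) + (\<Sum>u\<in>A. linf_dist (x u) (x (g u)) powr p))"
    by (intro add_mono sum_mono) (auto simp: f_1 f_2 f_A f_gA)
  also have "\<dots> \<le> 2 * index_cost p I1 I2 x x A g"
  proof -
    have le: "a + b + (c + b) \<le> 2 * (b + a + c)" if "0 \<le> a" "0 \<le> c" for a b c :: real
      using that by simp
    show ?thesis unfolding index_cost_def by (rule le) (auto intro!: sum_nonneg)
  qed
  finally show ?thesis using bij unfolding f_def by blast
qed

text \<open>The pairs that lead from \<open>I1\<close> to \<open>I2\<close> are kept. Any other
  point of \<open>I1\<close> is sent to some projection, and any other point of \<open>I2\<close> is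
  reached from one, which costs at least its distance to the diagonal. Each term of the matching
  cost is thus charged to a different index \<open>u\<close>.\<close>

lemma matching_of_permutation:
  fixes x :: "'i \<Rightarrow> real \<times> real"
  assumes fin: "finite I" and sub: "I1 \<subseteq> I" "I2 \<subseteq> I"
    and \<sigma>: "bij_betw \<sigma> I I" and p: "0 < p"
  shows "\<exists>A. matching I1 I2 A \<sigma> \<and> index_cost p I1 I2 x x A \<sigma> \<le>
    (\<Sum>u\<in>I. linf_dist (padded I1 x u) (padded I2 x (\<sigma> u)) powr p)"
proof -
  define f where "f u = linf_dist (padded I1 x u) (padded I2 x (\<sigma> u)) powr p" for u
  define A where "A = {u \<in> I1. \<sigma> u \<in> I2}"
  define B where "B = {u \<in> I - I1. \<sigma> u \<in> I2}"
  have inj: "inj_on \<sigma> I" and img: "\<sigma> ` I = I" using \<sigma> by (auto simp: bij_betw_def)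
  have AI: "A \<subseteq> I1" "A \<subseteq> I" "B \<subseteq> I" using sub by (auto simp: A_def B_def)
  have "matching I1 I2 A \<sigma>"
    using AI inj by (auto simp: matching_def A_def intro: inj_on_subset)
  have rest: "I2 - \<sigma> ` A = \<sigma> ` B"
  proof
    show "I2 - \<sigma> ` A \<subseteq> \<sigma> ` B"
    proof
      fix v assume v: "v \<in> I2 - \<sigma> ` A"
      then have "v \<in> \<sigma> ` I" using sub img by auto
      then obtain u where u: "u \<in> I" "v = \<sigma> u" by blast
      then show "v \<in> \<sigma> ` B" using v by (auto simp: A_def B_def)
    qed
    show "\<sigma> ` B \<subseteq> I2 - \<sigma> ` A"
    proof
      fix v assume "v \<in> \<sigma> ` B"
      then obtain u where u: "u \<in> B" "v = \<sigma> u" by blast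
      have "\<sigma> u \<noteq> \<sigma> w" if "w \<in> A" for w
        using inj u(1) that AI by (auto simp: A_def B_def dest: inj_onD)
      then show "v \<in> I2 - \<sigma> ` A" using u by (auto simp: B_def)
    qed
  qed
  have diag: "dist_diagonal w \<le> linf_dist w (diagonal_proj v)" for v w
    by (rule dist_diagonal_le) (simp add: diagonal_proj_def)
  have f_A: "linf_dist (x u) (x (\<sigma> u)) powr p = f u" if "u \<in> A" for u
    using that by (auto simp: f_def padded_def A_def)
  have f_1: "dist_diagonal (x u) powr p \<le> f u" if "u \<in> I1 - A" for u
    using that p diag[of "x u" "x (\<sigma> u)"]
    by (auto simp: f_def padded_def A_def intro!: powr_mono2)
  have f_B: "dist_diagonal (x (\<sigma> u)) powr p \<le> f u" if "u \<in> B" for u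
    using that p diag[of "x (\<sigma> u)" "x u"]
    by (auto simp: f_def padded_def B_def linf_dist_commute[of "diagonal_proj _"] intro!: powr_mono2)
  have injB: "inj_on \<sigma> B" using inj AI by (auto intro: inj_on_subset)
  have fin': "finite I1" "finite B" using fin sub AI by (auto intro: finite_subset)
  have "index_cost p I1 I2 x x A \<sigma> = (\<Sum>u\<in>A. linf_dist (x u) (x (\<sigma> u)) powr p) +
      (\<Sum>u\<in>I1 - A. dist_diagonal (x u) powr p) + (\<Sum>u\<in>B. dist_diagonal (x (\<sigma> u)) powr p)"
    unfolding index_cost_def rest by (simp add: sum.reindex[OF injB])
  also have "\<dots> \<le> (\<Sum>u\<in>A. f u) + (\<Sum>u\<in>I1 - A. f u) + (\<Sum>u\<in>B. f u)"
    by (intro add_mono sum_mono) (auto simp: f_A f_1 f_B)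
  also have "\<dots> = (\<Sum>u\<in>I1. f u) + (\<Sum>u\<in>B. f u)"
    using sum.subset_diff[OF AI(1) fin'(1), of f] by simp
  also have "\<dots> = (\<Sum>u\<in>I1 \<union> B. f u)"
    using fin' by (intro sum.union_disjoint[symmetric]) (auto simp: B_def)
  also have "\<dots> \<le> (\<Sum>u\<in>I. f u)"
    using fin sub AI by (intro sum_mono2) (auto simp: f_def)
  finally show ?thesis using \<open>matching I1 I2 A \<sigma>\<close> unfolding f_def by blast
qed

section \<open>Rational approximation and coding of diagrams\<close>

definition rat_point :: "rat \<times> rat \<Rightarrow> real \<times> real" where
  "rat_point q = (of_rat (fst q), of_rat (snd q))"

lemma ex_rat_point_close:
  assumes "0 < e" "0 < p"
  shows "\<exists>q. linf_dist x (rat_point q) powr p \<le> e"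
proof -
  define d where "d = e powr (1 / p)"
  have d: "0 < d" using assms by (simp add: d_def)
  obtain q1 q2 :: rat where q: "fst x < of_rat q1" "of_rat q1 < fst x + d" "snd x < of_rat q2" "of_rat q2 < snd x + d"
    using of_rat_dense[of "fst x" "fst x + d"] of_rat_dense[of "snd x" "snd x + d"] d by auto
  then have "linf_dist x (rat_point (q1, q2)) \<le> d" by (auto simp: linf_dist_def rat_point_def)
  then have "linf_dist x (rat_point (q1, q2)) powr p \<le> d powr p" using assms by (intro powr_mono2) auto
  then show ?thesis using assms by (auto simp: d_def powr_powr)
qed

text \<open>A total rounding error of \<open>1\<close> is distributed over the \<open>k\<close>
  points; the denominator \<open>k + 1\<close> also serves the empty diagram. The exact points
  \<open>x\<close> are enumerated together with the rounded ones, so that both share their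
  indices.\<close>

lemma ex_rational_diagram:
  fixes D :: "(real \<times> real) multiset"
  assumes "0 < p"
  shows "\<exists>qs x. D = image_mset x (mset_set {..<length qs}) \<and>
    (\<Sum>j<length qs. linf_dist (x j) (rat_point (qs ! j)) powr p) \<le> 1"
proof -
  obtain ds where ds: "D = mset ds" using ex_mset[of D] by auto
  define k where "k = length ds"
  obtain q where q: "\<And>v. linf_dist v (rat_point (q v)) powr p \<le> 1 / (k + 1)"
    using ex_rat_point_close[OF _ assms, of "1 / (k + 1)"] by (metis of_nat_0_less_iff zero_less_divide_1_iff add_gr_0 zero_less_one of_nat_1 of_nat_add)
  have "mset ds = image_mset (nth ds) (mset_set {..<length ds})"
    by (metis atLeast0LessThan map_nth mset_map mset_upt)
  moreover have "(\<Sum>j<length ds. linf_dist (ds ! j) (rat_point (map q ds ! j)) powr p) \<le> 1"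
  proof -
    have "(\<Sum>j<length ds. linf_dist (ds ! j) (rat_point (map q ds ! j)) powr p) \<le> (\<Sum>j<length ds. 1 / (k + 1))"
      using q by (intro sum_mono) simp
    also have "\<dots> \<le> 1" by (simp add: k_def)
    finally show ?thesis .
  qed
  ultimately show ?thesis
    by (intro exI[of _ "map q ds"] exI[of _ "nth ds"]) (simp only: ds length_map simp_thms)
qed

text \<open>
  Each point is rounded to a rational one, so that a diagram is encoded by a list of rational points.
  Given the first \<open>n\<close> codes, a diagram is sent to the uniform measure on its points and on the diagonal
  projections of the points of all the other diagrams. The extra index \<open>(n, 0)\<close> keeps the index set
  nonempty.
\<close>

lemma diagrams_embed_if_wasserstein_space_embeds:
  assumes p: "1 \<le> p"
    and W: "coarsely_embeds_into_Hilbert TYPE('h) (wasserstein_space p) (wasserstein_dist p)"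
  shows "coarsely_embeds_into_Hilbert TYPE('h) persistence_diagrams (diagram_dist p)"
proof -
  have p0: "0 < p" using p by simp
  obtain qs x where qs: "\<And>D :: (real \<times> real) multiset. D = image_mset (x D) (mset_set {..<length (qs D)}) \<and>
      (\<Sum>j<length (qs D). linf_dist (x D j) (rat_point (qs D ! j)) powr p) \<le> 1"
    using ex_rational_diagram[OF p0] by metis
  define lst where "lst i = (from_nat i :: (rat \<times> rat) list)" for i
  define r where "r D = to_nat (qs D)" for D
  have lst_r: "lst (r D) = qs D" for D by (simp add: lst_def r_def)
  let ?a = "3 powr p :: real"
  have a: "1 \<le> ?a" using p by (intro ge_one_powr_ge_zero) auto
  show ?thesis
  \<comment> \<open>The three factors \<open>3 powr p\<close> come from the nearly optimal matching,
    the rounding of the points and the transport estimate. The \<open>6\<close> is the factor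
    \<open>2\<close> of \<open>permutation_of_matching\<close> applied to \<open>d + 1\<close> and
    to the two rounding errors.\<close>
  proof (rule coarsely_embeds_by_finite_approximation_powr[OF W diagram_dist_nonneg wasserstein_dist_nonneg _ p0,
        of "6 * ?a ^ 3" _ r])
    fix n
    define len where "len b = (if b = n then 1 else length (lst b))" for b
    define I where "I = (SIGMA b:{..n}. {..<len b})"
    define J where "J i = {i} \<times> {..<length (lst i)}" for i
    define y where "y u = (if fst u = n then (0, 0) else rat_point (lst (fst u) ! snd u))" for u :: "nat \<times> nat"
    have "(n, 0) \<in> I" by (simp add: I_def len_def)
    then have I: "finite I" "I \<noteq> {}" and J: "finite (J i)" for i
      by (auto simp: I_def J_def)
    have JI: "J i \<subseteq> I" if "i < n" for i using that by (auto simp: I_def J_def len_def)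
    define N where "N = card I"
    have N: "0 < N" using I by (simp add: N_def card_gt_0_iff)
    \<comment> \<open>Here \<open>s powr p = N\<close>: the uniform measure averages over
      \<open>N\<close> points, and enlarging them turns the average back into the sum of the
      original costs.\<close>
    define s where "s = N powr (1 / p)"
    have s: "0 < s" "s powr p = N" using N p0 by (auto simp: s_def powr_powr)
    define P where "P i u = padded (J i) y u" for i u
    define X where "X i u = (s * fst (P i u), s * snd (P i u))" for i u
    define \<phi> where "\<phi> i = empirical I (X i)" for i
    define M where "M i i' \<sigma> = (\<Sum>u\<in>I. linf_dist (P i u) (P i' (\<sigma> u)) powr p)" for i i' \<sigma>
    have M_X: "(\<Sum>u\<in>I. linf_dist (X i u) (X i' (\<sigma> u)) powr p) / card I = M i i' \<sigma>" for i i' \<sigma>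
    proof -
      have "linf_dist (X i u) (X i' v) = s * linf_dist (P i u) (P i' v)" for u v
        using s(1) by (simp add: X_def linf_dist_def abs_mult max_mult_distrib_left flip: right_diff_distrib)
      then have "linf_dist (X i u) (X i' v) powr p = N * linf_dist (P i u) (P i' v) powr p" for u v
        using s by (simp add: powr_mult)
      then show ?thesis using N by (simp add: M_def flip: N_def sum_distrib_left)
    qed
    have upper: "wasserstein_dist p (\<phi> i) (\<phi> i') powr p \<le> ?a * M i i' \<sigma>" if \<sigma>: "bij_betw \<sigma> I I" for i i' \<sigma>
    proof -
      obtain h h' where "quantization p I (\<phi> i) (X i) h 0" "quantization p I (\<phi> i') (X i') h' 0"
        using quantization_empirical[OF I] unfolding \<phi>_def by blast
      from wasserstein_dist_quantized(1)[OF this p0 _ _ \<sigma>] show ?thesis by (simp add: M_X)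
    qed
    have lower: "\<exists>\<sigma>. bij_betw \<sigma> I I \<and> M i i' \<sigma> \<le> ?a * (wasserstein_dist p (\<phi> i) (\<phi> i') powr p + 1)" for i i'
    proof -
      obtain h h' where "quantization p I (\<phi> i) (X i) h 0" "quantization p I (\<phi> i') (X i') h' 0"
        using quantization_empirical[OF I] unfolding \<phi>_def by blast
      from wasserstein_dist_quantized(2)[OF this p0] show ?thesis by (simp add: M_X)
    qed
    \<comment> \<open>The exact points of \<open>D\<close>. The measure must depend on the code
      alone and is therefore built from the rounded points \<open>y\<close>;
      \<open>index_cost_perturb\<close> passes between \<open>e D\<close> and
      \<open>y\<close>.\<close>
    define e where "e D u = x D (snd u)" for D and u :: "nat \<times> nat"
    have e: "D = image_mset (e D) (mset_set (J (r D)))" "(\<Sum>u\<in>J (r D). linf_dist (e D u) (y u) powr p) \<le> 1"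
      "(\<Sum>u\<in>J (r D). linf_dist (y u) (e D u) powr p) \<le> 1" if "r D < n" for D
    proof -
      have Jr: "J (r D) = Pair (r D) ` {..<length (qs D)}" by (auto simp: J_def lst_r)
      have inj: "inj_on (Pair (r D)) {..<length (qs D)}" by (auto simp: inj_on_def)
      have "image_mset (e D) (mset_set (J (r D))) = image_mset (x D) (mset_set {..<length (qs D)})"
        unfolding Jr image_mset_mset_set[OF inj, symmetric] by (simp add: image_mset.compositionality o_def e_def)
      then show "D = image_mset (e D) (mset_set (J (r D)))" using qs[of D] by simp
      have "(\<Sum>u\<in>J (r D). linf_dist (e D u) (y u) powr p) =
          (\<Sum>j<length (qs D). linf_dist (x D j) (rat_point (qs D ! j)) powr p)"
        unfolding Jr sum.reindex[OF inj] using that by (simp add: e_def y_def lst_r)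
      then show le: "(\<Sum>u\<in>J (r D). linf_dist (e D u) (y u) powr p) \<le> 1" using qs[of D] by simp
      then show "(\<Sum>u\<in>J (r D). linf_dist (y u) (e D u) powr p) \<le> 1" by (simp add: linf_dist_commute)
    qed
    show "\<exists>\<phi>. \<forall>D1\<in>persistence_diagrams. \<forall>D2\<in>persistence_diagrams. r D1 < n \<longrightarrow> r D2 < n \<longrightarrow>
        \<phi> (r D1) \<in> wasserstein_space p \<and>
        diagram_dist p D1 D2 powr p \<le> 6 * ?a ^ 3 * (1 + wasserstein_dist p (\<phi> (r D1)) (\<phi> (r D2)) powr p) \<and>
        wasserstein_dist p (\<phi> (r D1)) (\<phi> (r D2)) powr p \<le> 6 * ?a ^ 3 * (1 + diagram_dist p D1 D2 powr p)"
    proof (intro exI[of _ \<phi>] ballI impI)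
      fix D1 D2 :: "(real \<times> real) multiset"
      assume n: "r D1 < n" "r D2 < n"
      define d where "d = diagram_dist p D1 D2 powr p"
      define w where "w = wasserstein_dist p (\<phi> (r D1)) (\<phi> (r D2)) powr p"
      let ?J1 = "J (r D1)" and ?J2 = "J (r D2)"
      have nonneg: "0 \<le> d" "0 \<le> w" by (simp_all add: d_def w_def)
      have a2: "?a \<le> ?a\<^sup>2" "?a\<^sup>2 \<le> ?a ^ 3" using power_increasing[of 1 2 ?a] power_increasing[of 2 3 ?a] a by simp_all
      have d_le: "d \<le> ?a * (index_cost p ?J1 ?J2 y y A g + 2)" if g: "matching ?J1 ?J2 A g" for A g
      proof -
        have "d \<le> index_cost p ?J1 ?J2 (e D1) (e D2) A g"
          using diagram_dist_le_index_cost[OF J J g p0, of "e D1" "e D2"] e(1)[OF n(1)] e(1)[OF n(2)]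
          by (simp add: d_def)
        also have "\<dots> \<le> ?a * (index_cost p ?J1 ?J2 y y A g + (\<Sum>u\<in>?J1. linf_dist (e D1 u) (y u) powr p) +
            (\<Sum>u\<in>?J2. linf_dist (e D2 u) (y u) powr p))"
          by (rule index_cost_perturb[OF J J g p0])
        also have "\<dots> \<le> ?a * (index_cost p ?J1 ?J2 y y A g + 2)"
          using e(2)[OF n(1)] e(2)[OF n(2)] by (intro mult_left_mono) auto
        finally show ?thesis .
      qed
      have "d \<le> ?a * (?a * (w + 1) + 2) \<and> w \<le> ?a * (2 * (?a * (?a * (d + 1) + 2)))"
      \<comment> \<open>Different diagrams may share a code. Their blocks then coincide instead of
        being disjoint, but both are close to the same rounded diagram and are sent to the same
        measure.\<close>
      proof (cases "r D1 = r D2")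
        case True
        have "matching ?J1 ?J2 ?J1 id" using True by (auto simp: matching_def)
        from d_le[OF this] True have "d \<le> ?a * (0 + 2)" by (simp add: index_cost_def)
        also have "\<dots> \<le> ?a * (?a * (w + 1) + 2)" using nonneg by (intro mult_left_mono) auto
        finally have "d \<le> ?a * (?a * (w + 1) + 2)" .
        moreover have "w \<le> 0"
          using upper[OF bij_betw_id, of "r D1" "r D2"] True by (simp add: w_def M_def)
        moreover have "0 \<le> ?a * (2 * (?a * (?a * (d + 1) + 2)))" using nonneg by simp
        ultimately show ?thesis by linarith
      next
        case False
        have disj: "?J1 \<inter> ?J2 = {}" using False by (auto simp: J_def)
        obtain \<sigma> where \<sigma>: "bij_betw \<sigma> I I" "M (r D1) (r D2) \<sigma> \<le> ?a * (w + 1)"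
          using lower unfolding w_def by blast
        obtain A where A: "matching ?J1 ?J2 A \<sigma>" "index_cost p ?J1 ?J2 y y A \<sigma> \<le> M (r D1) (r D2) \<sigma>"
          using matching_of_permutation[OF I(1) JI[OF n(1)] JI[OF n(2)] \<sigma>(1) p0, of y]
          unfolding M_def P_def by blast
        have "d \<le> ?a * (index_cost p ?J1 ?J2 y y A \<sigma> + 2)" by (rule d_le[OF A(1)])
        also have "\<dots> \<le> ?a * (?a * (w + 1) + 2)" using A(2) \<sigma>(2) by (intro mult_left_mono) auto
        finally have d: "d \<le> ?a * (?a * (w + 1) + 2)" .
        obtain B g where g: "matching ?J1 ?J2 B g"
          and cost: "index_cost p ?J1 ?J2 (e D1) (e D2) B g \<le> ?a * (d + 1)"
          using ex_index_cost_le_diagram_dist[OF J J p0, of "r D1" "r D2" "e D1" "e D2"]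
            e(1)[OF n(1)] e(1)[OF n(2)] unfolding d_def by metis
        have "index_cost p ?J1 ?J2 y y B g \<le> ?a * (index_cost p ?J1 ?J2 (e D1) (e D2) B g +
            (\<Sum>u\<in>?J1. linf_dist (y u) (e D1 u) powr p) + (\<Sum>u\<in>?J2. linf_dist (y u) (e D2 u) powr p))"
          by (rule index_cost_perturb[OF J J g p0])
        also have "\<dots> \<le> ?a * (?a * (d + 1) + 2)"
          using cost e(3)[OF n(1)] e(3)[OF n(2)] by (intro mult_left_mono) auto
        finally have y_cost: "index_cost p ?J1 ?J2 y y B g \<le> ?a * (?a * (d + 1) + 2)" .
        obtain \<tau> where \<tau>: "bij_betw \<tau> I I" "M (r D1) (r D2) \<tau> \<le> 2 * index_cost p ?J1 ?J2 y y B g"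
          using permutation_of_matching[OF I(1) JI[OF n(1)] JI[OF n(2)] disj g p0, of y]
          unfolding M_def P_def by blast
        have "w \<le> ?a * M (r D1) (r D2) \<tau>" unfolding w_def by (rule upper[OF \<tau>(1)])
        also have "\<dots> \<le> ?a * (2 * (?a * (?a * (d + 1) + 2)))"
          using \<tau>(2) y_cost by (intro mult_left_mono) auto
        finally show ?thesis using d by blast
      qed
      moreover have "?a * (?a * (w + 1) + 2) \<le> 6 * ?a ^ 3 * (1 + w)"
      proof -
        have "?a * (?a * (w + 1) + 2) = ?a\<^sup>2 * (w + 1) + ?a * 2" by (simp add: power2_eq_square algebra_simps)
        also have "\<dots> \<le> ?a ^ 3 * (w + 1) + ?a ^ 3 * (2 * (w + 1))"
          using a2 nonneg by (intro add_mono mult_mono) auto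
        also have "\<dots> = 3 * (?a ^ 3 * (1 + w))" by (simp add: algebra_simps)
        also have "\<dots> \<le> 6 * (?a ^ 3 * (1 + w))" using nonneg by (intro mult_right_mono) auto
        finally show ?thesis by (simp only: mult.assoc)
      qed
      moreover have "?a * (2 * (?a * (?a * (d + 1) + 2))) \<le> 6 * ?a ^ 3 * (1 + d)"
      proof -
        have "?a * (2 * (?a * (?a * (d + 1) + 2))) = 2 * (?a ^ 3 * (d + 1)) + ?a\<^sup>2 * 4"
          by (simp add: power2_eq_square power3_eq_cube algebra_simps)
        also have "\<dots> \<le> 2 * (?a ^ 3 * (d + 1)) + ?a ^ 3 * (4 * (d + 1))"
          using a2 nonneg by (intro add_left_mono mult_mono) auto
        also have "\<dots> = 6 * ?a ^ 3 * (1 + d)" by (simp add: algebra_simps)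
        finally show ?thesis .
      qed
      moreover have "\<phi> (r D1) \<in> wasserstein_space p"
        unfolding \<phi>_def by (rule empirical_in_wasserstein_space[OF I])
      ultimately show "\<phi> (r D1) \<in> wasserstein_space p \<and>
        diagram_dist p D1 D2 powr p \<le> 6 * ?a ^ 3 * (1 + wasserstein_dist p (\<phi> (r D1)) (\<phi> (r D2)) powr p) \<and>
        wasserstein_dist p (\<phi> (r D1)) (\<phi> (r D2)) powr p \<le> 6 * ?a ^ 3 * (1 + diagram_dist p D1 D2 powr p)"
        by (fold d_def w_def) linarith
    qed
  qed simp
qed

theorem theorem23:
  fixes p :: real
  assumes "1 \<le> p"
  shows "coarsely_embeds_into_Hilbert TYPE('h) persistence_diagrams (diagram_dist p) \<longleftrightarrow>
         coarsely_embeds_into_Hilbert TYPE('h) (wasserstein_space p) (wasserstein_dist p)"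
  using wasserstein_space_embeds_if_diagrams_embed[OF assms]
    diagrams_embed_if_wasserstein_space_embeds[OF assms] by blast

end
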